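(* Let $\mathfrak{g}$ be a finite-dimensional complex Lie algebra with a symmetric nondegenerate $\mathrm{ad}$-invariant bilinear form $\langle\,,\rangle$, and let $U\mathfrak{g}$ be its universal enveloping algebra. Let $C=Z(U\mathfrak{g})$ be the center of $U\mathfrak{g}$, let $\kappa=\sum_{b\in B} b\,b^*\in C$ be the Casimir and let $\gamma=\sum_{b\in B} b\otimes b^*$, where $B$ is a basis of $\mathfrak g$ and $\{b^*\mid b\in B\}$ is the dual basis with respect to $\langle\,,\rangle$. Let $M$ and $V$ be $\mathfrak{g}$-modules and let $s_1\cdot(u\otimes v)=v\otimes u$ for $u,v\in V$. Then the degenerate affine braid algebra $\mathcal{B}_k$ over $C$ acts on $M\otimes V^{\otimes k}$ via $\Phi:\mathcal{B}_k\to \mathrm{End}(M\otimes V^{\otimes k})$ defined by: - $\Phi(t_{s_i})=\mathrm{id}_M\otimes \mathrm{id}_V^{\otimes (i-1)}\otimes s_1\otimes \mathrm{id}_V^{\otimes (k-i-1)}$, so that $S_k$ acts by permuting the tensor factors of $V$; - $\Phi(\kappa_i)$ is $\kappa$ acting in the $i$th factor of $V$ in $M\otimes V^{\otimes k}$, and $\Phi(\kappa_0)$ is $\kappa$ acting on $M$; - $\Phi(\gamma_{\ell,m})$ is $\gamma$ acting in the $\ell$th and $m$th factors of $V$ in $M\otimes V^{\otimes k}$; - $\Phi(\gamma_{0,\ell})$ is $\gamma$ acting on $M$ and the $\ell$th factor of $V$ in $M\otimes V^{\otimes k}$; - $\Phi(c_i)$ is $\kappa$ acting on $M$ and the first $i$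 factors of $V$; - $\Phi(z)=z\otimes \mathrm{id}_V^{\otimes k}$ for $z\in C$. This action of $\mathcal{B}_k$ commutes with the $U\mathfrak{g}$-action on $M\otimes V^{\otimes k}$.
   Context: $\mathrm{ad}$-invariance means $\langle [x_1,x_2],x_3\rangle+\langle x_2,[x_1,x_3]\rangle=0$. The coproduct is $\Delta(x)=x\otimes1+1\otimes x$ for $x\in\mathfrak g$, and $\Delta(\kappa)=\kappa\otimes 1+1\otimes\kappa+2\gamma$. "$\kappa$ acting on $M$ and the first $i$ factors of $V$" means the action of $\kappa$ on the module $M\otimes V^{\otimes i}$ through the (iterated) coproduct, tensored with the identity on the remaining factors. Degenerate affine braid algebra. Let $C$ be a commutative ring, $S_k$ the symmetric group on $\{1,\dots,k\}$, $s_i$ the transposition switching $i$ and $i+1$. $\mathcal{B}_k$ is the $C$-algebra generated by $t_u$ ($u\in S_k$), $\kappa_0,\kappa_1$, and $y_1,\dots,y_k$ with relations $$t_ut_v=t_{uv},\quad y_iy_j=y_jy_i,\quad \kappa_0\kappa_1=\kappa_1\kappa_0,\quad \kappa_0y_i=y_i\kappa_0,\quad \kappa_1y_i=y_i\kappa_1,$$ $$\kappa_0t_{s_i}=t_{s_i}\kappa_0,\quad \kappa_1t_{s_1}\kappa_1t_{s_1}=t_{s_1}\kappa_1t_{s_1}\kappa_1,\quad \kappa_1t_{s_j}=t_{s_j}\kappa_1\ (j\neq1),$$ $$t_{s_i}(y_i+y_{i+1})=(y_i+y_{i+1})t_{s_i},\quad y_jt_{s_i}=t_{s_i}y_j\ (j\ne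 i,i+1),$$ $$t_{s_i}t_{s_{i+1}}\gamma_{i,i+1}t_{s_{i+1}}t_{s_i}=\gamma_{i+1,i+2}\ (1\le i\le k-2),\quad\text{where }\gamma_{i,i+1}=y_{i+1}-t_{s_i}y_it_{s_i}.$$ Equivalently (a known second presentation), $\mathcal{B}_k$ is generated by $t_u$ ($u\in S_k$), $\kappa_0,\dots,\kappa_k$, and $\gamma_{i,j}$ ($0\le i,j\le k$, $i\ne j$) with relations $$t_ut_v=t_{uv},\quad t_w\kappa_it_{w^{-1}}=\kappa_{w(i)},\quad t_w\gamma_{i,j}t_{w^{-1}}=\gamma_{w(i),w(j)}\quad(\text{with }w(0)=0),$$ $$\kappa_i\kappa_j=\kappa_j\kappa_i,\quad \kappa_i\gamma_{\ell,m}=\gamma_{\ell,m}\kappa_i,\quad \gamma_{i,j}=\gamma_{j,i},$$ $$\gamma_{p,r}\gamma_{\ell,m}=\gamma_{\ell,m}\gamma_{p,r}\ (p\neq\ell,\ p\ne m,\ r\ne\ell,\ r\ne m),\quad \gamma_{i,j}(\gamma_{i,r}+\gamma_{j,r})=(\gamma_{i,r}+\gamma_{j,r})\gamma_{i,j}\ (i,j,r\text{ distinct}).$$ The two presentations are related by $t_w=t_w$, $\kappa_0=\kappa_0$, $\kappa_1=\kappa_1$, $y_j=\frac12\kappa_j+\sum_{0\le\ell<j}\gamma_{\ell,j}$. The elements $c_j$ are $c_0=\kappa_0$ and $c_j=\kappa_0+2(y_1+\cdots+y_j)$ for $1\le j\le k$; equivalently $c_j=\sum_{i=0}^j\kappa_i+2\sum_{0\le\ell<m\le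 j}\gamma_{\ell,m}$. *)

theory Defs
  imports "HOL-Algebra.Algebra" "HOL-Algebra.Algebraic_Closure_Type" "HOL-Combinatorics.Permutations"
begin

section \<open>Free modules, free algebras, and algebras given by generators and relations\<close>

abbreviation CC :: "complex ring"
  where "CC \<equiv> ring_of_type_algebra"

definition free_module :: "('c, 'd) ring_scheme \<Rightarrow> 'x set \<Rightarrow> ('c, 'x \<Rightarrow> 'c) module"
  where "free_module R S =
    \<lparr>carrier = {f. range f \<subseteq> carrier R \<and> (\<forall>x. x \<notin> S \<longrightarrow> f x = \<zero>\<^bsub>R\<^esub>) \<and> finite {x. f x \<noteq> \<zero>\<^bsub>R\<^esub>}},
      monoid.mult = undefined, one = undefined,
      ring.zero = (\<lambda>x. \<zero>\<^bsub>R\<^esub>),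
      add = (\<lambda>f h x. f x \<oplus>\<^bsub>R\<^esub> h x),
      module.smult = (\<lambda>c f x. c \<otimes>\<^bsub>R\<^esub> f x)\<rparr>"

definition unit_vec :: "('c, 'd) ring_scheme \<Rightarrow> 'x \<Rightarrow> 'x \<Rightarrow> 'c"
  where "unit_vec R x = (\<lambda>y. if y = x then \<one>\<^bsub>R\<^esub> else \<zero>\<^bsub>R\<^esub>)"

text \<open>The free associative unital algebra on \<open>S\<close>: the free module on the words over \<open>S\<close>, with
  multiplication extending the concatenation of words.\<close>

definition free_algebra :: "('c, 'd) ring_scheme \<Rightarrow> 'x set \<Rightarrow> ('c, 'x list \<Rightarrow> 'c) module"
  where "free_algebra R S = (free_module R (lists S))
    \<lparr>monoid.mult := (\<lambda>f h w. \<Oplus>\<^bsub>R\<^esub>i\<in>{..length w}. f (take i w) \<otimes>\<^bsub>R\<^esub> h (drop i w)),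
      one := unit_vec R []\<rparr>"

abbreviation free_gen :: "('c, 'd) ring_scheme \<Rightarrow> 'x \<Rightarrow> 'x list \<Rightarrow> 'c"
  where "free_gen R x \<equiv> unit_vec R [x]"

text \<open>A set \<open>rels\<close> of pairs \<open>(a, b)\<close> of elements of the free algebra stands for the relations
  \<open>a = b\<close>. Note that \<^const>\<open>genideal\<close> is the two-sided ideal generated by a set.\<close>

definition rel_ideal ::
  "('c, 'd) ring_scheme \<Rightarrow> 'x set \<Rightarrow> (('x list \<Rightarrow> 'c) \<times> ('x list \<Rightarrow> 'c)) set \<Rightarrow> ('x list \<Rightarrow> 'c) set"
  where "rel_ideal R S rels =
    Idl\<^bsub>free_algebra R S\<^esub> {a \<ominus>\<^bsub>free_algebra R S\<^esub> b |a b. (a, b) \<in> rels}"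

definition presented_algebra ::
  "('c, 'd) ring_scheme \<Rightarrow> 'x set \<Rightarrow> (('x list \<Rightarrow> 'c) \<times> ('x list \<Rightarrow> 'c)) set \<Rightarrow> ('x list \<Rightarrow> 'c) set ring"
  where "presented_algebra R S rels = free_algebra R S Quot rel_ideal R S rels"

definition presented_class ::
  "('c, 'd) ring_scheme \<Rightarrow> 'x set \<Rightarrow> (('x list \<Rightarrow> 'c) \<times> ('x list \<Rightarrow> 'c)) set
    \<Rightarrow> ('x list \<Rightarrow> 'c) \<Rightarrow> ('x list \<Rightarrow> 'c) set"
  where "presented_class R S rels a = rel_ideal R S rels +>\<^bsub>free_algebra R S\<^esub> a"

text \<open>The structure map \<open>R \<rightarrow> A\<close> of a presented \<open>R\<close>-algebra \<open>A\<close>.\<close>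

definition presented_scalar ::
  "('c, 'd) ring_scheme \<Rightarrow> 'x set \<Rightarrow> (('x list \<Rightarrow> 'c) \<times> ('x list \<Rightarrow> 'c)) set
    \<Rightarrow> 'c \<Rightarrow> ('x list \<Rightarrow> 'c) set"
  where "presented_scalar R S rels c =
    presented_class R S rels (c \<odot>\<^bsub>free_algebra R S\<^esub> \<one>\<^bsub>free_algebra R S\<^esub>)"

definition center_ring :: "('a, 'b) ring_scheme \<Rightarrow> ('a, 'b) ring_scheme"
  where "center_ring A =
    A\<lparr>carrier := {z \<in> carrier A. \<forall>u \<in> carrier A. z \<otimes>\<^bsub>A\<^esub> u = u \<otimes>\<^bsub>A\<^esub> z}\<rparr>"

text \<open>The linear endomorphisms of a complex vector space, as functions that are
  \<^const>\<open>undefined\<close> off the carrier, with composition as multiplication.\<close>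

definition End_ring :: "(complex, 'm) module \<Rightarrow> ('m \<Rightarrow> 'm) ring"
  where "End_ring M =
    \<lparr>carrier = {f \<in> carrier M \<rightarrow>\<^sub>E carrier M.
        (\<forall>x \<in> carrier M. \<forall>y \<in> carrier M. f (x \<oplus>\<^bsub>M\<^esub> y) = f x \<oplus>\<^bsub>M\<^esub> f y) \<and>
        (\<forall>c. \<forall>x \<in> carrier M. f (c \<odot>\<^bsub>M\<^esub> x) = c \<odot>\<^bsub>M\<^esub> f x)},
      monoid.mult = (\<lambda>f h. compose (carrier M) f h),
      one = (\<lambda>x\<in>carrier M. x),
      ring.zero = (\<lambda>x\<in>carrier M. \<zero>\<^bsub>M\<^esub>),
      add = (\<lambda>f h. \<lambda>x\<in>carrier M. f x \<oplus>\<^bsub>M\<^esub> h x)\<rparr>"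


section \<open>Lie algebras, their modules, and universal enveloping algebras\<close>

locale lie_algebra = module CC g
  for g :: "(complex, 'g) module" +
  fixes br :: "'g \<Rightarrow> 'g \<Rightarrow> 'g"
  assumes br_closed: "\<lbrakk>x \<in> carrier g; y \<in> carrier g\<rbrakk> \<Longrightarrow> br x y \<in> carrier g"
    and br_add_left: "\<lbrakk>x \<in> carrier g; x' \<in> carrier g; y \<in> carrier g\<rbrakk>
          \<Longrightarrow> br (x \<oplus>\<^bsub>g\<^esub> x') y = br x y \<oplus>\<^bsub>g\<^esub> br x' y"
    and br_add_right: "\<lbrakk>x \<in> carrier g; y \<in> carrier g; y' \<in> carrier g\<rbrakk>
          \<Longrightarrow> br x (y \<oplus>\<^bsub>g\<^esub> y') = br x y \<oplus>\<^bsub>g\<^esub> br x y'"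
    and br_smult_left: "\<lbrakk>x \<in> carrier g; y \<in> carrier g\<rbrakk> \<Longrightarrow> br (c \<odot>\<^bsub>g\<^esub> x) y = c \<odot>\<^bsub>g\<^esub> br x y"
    and br_smult_right: "\<lbrakk>x \<in> carrier g; y \<in> carrier g\<rbrakk> \<Longrightarrow> br x (c \<odot>\<^bsub>g\<^esub> y) = c \<odot>\<^bsub>g\<^esub> br x y"
    and br_alternating: "x \<in> carrier g \<Longrightarrow> br x x = \<zero>\<^bsub>g\<^esub>"
    and br_jacobi: "\<lbrakk>x \<in> carrier g; y \<in> carrier g; z \<in> carrier g\<rbrakk>
          \<Longrightarrow> br x (br y z) \<oplus>\<^bsub>g\<^esub> br y (br z x) \<oplus>\<^bsub>g\<^esub> br z (br x y) = \<zero>\<^bsub>g\<^esub>"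

locale lie_module = lie_algebra g br + M: module CC M
  for g :: "(complex, 'g) module" and br :: "'g \<Rightarrow> 'g \<Rightarrow> 'g" and M :: "(complex, 'm) module" +
  fixes act :: "'g \<Rightarrow> 'm \<Rightarrow> 'm"
  assumes act_closed: "\<lbrakk>x \<in> carrier g; m \<in> carrier M\<rbrakk> \<Longrightarrow> act x m \<in> carrier M"
    and act_add_left: "\<lbrakk>x \<in> carrier g; y \<in> carrier g; m \<in> carrier M\<rbrakk>
          \<Longrightarrow> act (x \<oplus>\<^bsub>g\<^esub> y) m = act x m \<oplus>\<^bsub>M\<^esub> act y m"
    and act_smult_left: "\<lbrakk>x \<in> carrier g; m \<in> carrier M\<rbrakk>
          \<Longrightarrow> act (c \<odot>\<^bsub>g\<^esub> x) m = c \<odot>\<^bsub>M\<^esub> act x m"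
    and act_add_right: "\<lbrakk>x \<in> carrier g; m \<in> carrier M; n \<in> carrier M\<rbrakk>
          \<Longrightarrow> act x (m \<oplus>\<^bsub>M\<^esub> n) = act x m \<oplus>\<^bsub>M\<^esub> act x n"
    and act_smult_right: "\<lbrakk>x \<in> carrier g; m \<in> carrier M\<rbrakk>
          \<Longrightarrow> act x (c \<odot>\<^bsub>M\<^esub> m) = c \<odot>\<^bsub>M\<^esub> act x m"
    and act_br: "\<lbrakk>x \<in> carrier g; y \<in> carrier g; m \<in> carrier M\<rbrakk>
          \<Longrightarrow> act (br x y) m = act x (act y m) \<ominus>\<^bsub>M\<^esub> act y (act x m)"

definition finite_basis :: "(complex, 'g) module \<Rightarrow> 'g set \<Rightarrow> bool"
  where "finite_basis g B \<longleftrightarrow> finite B \<and> B \<subseteq> carrier g \<and>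
    (\<forall>x \<in> carrier g. \<exists>!c. c \<in> extensional B \<and> x = (\<Oplus>\<^bsub>g\<^esub>b\<in>B. c b \<odot>\<^bsub>g\<^esub> b))"

definition bilinear_form :: "(complex, 'g) module \<Rightarrow> ('g \<Rightarrow> 'g \<Rightarrow> complex) \<Rightarrow> bool"
  where "bilinear_form g form \<longleftrightarrow>
    (\<forall>x \<in> carrier g. \<forall>y \<in> carrier g. \<forall>z \<in> carrier g.
        form (x \<oplus>\<^bsub>g\<^esub> y) z = form x z + form y z \<and> form z (x \<oplus>\<^bsub>g\<^esub> y) = form z x + form z y) \<and>
    (\<forall>c. \<forall>x \<in> carrier g. \<forall>y \<in> carrier g.
        form (c \<odot>\<^bsub>g\<^esub> x) y = c * form x y \<and> form x (c \<odot>\<^bsub>g\<^esub> y) = c * form x y)"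

definition symmetric_form :: "(complex, 'g) module \<Rightarrow> ('g \<Rightarrow> 'g \<Rightarrow> complex) \<Rightarrow> bool"
  where "symmetric_form g form \<longleftrightarrow> (\<forall>x \<in> carrier g. \<forall>y \<in> carrier g. form x y = form y x)"

definition nondegenerate_form :: "(complex, 'g) module \<Rightarrow> ('g \<Rightarrow> 'g \<Rightarrow> complex) \<Rightarrow> bool"
  where "nondegenerate_form g form \<longleftrightarrow>
    (\<forall>x \<in> carrier g. (\<forall>y \<in> carrier g. form x y = 0) \<longrightarrow> x = \<zero>\<^bsub>g\<^esub>)"

definition ad_invariant_form ::
  "(complex, 'g) module \<Rightarrow> ('g \<Rightarrow> 'g \<Rightarrow> 'g) \<Rightarrow> ('g \<Rightarrow> 'g \<Rightarrow> complex) \<Rightarrow> bool"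
  where "ad_invariant_form g br form \<longleftrightarrow>
    (\<forall>x1 \<in> carrier g. \<forall>x2 \<in> carrier g. \<forall>x3 \<in> carrier g.
        form (br x1 x2) x3 + form x2 (br x1 x3) = 0)"

definition dual_basis ::
  "(complex, 'g) module \<Rightarrow> ('g \<Rightarrow> 'g \<Rightarrow> complex) \<Rightarrow> 'g set \<Rightarrow> ('g \<Rightarrow> 'g) \<Rightarrow> bool"
  where "dual_basis g form B dual \<longleftrightarrow>
    (\<forall>b \<in> B. dual b \<in> carrier g \<and> (\<forall>b' \<in> B. form b' (dual b) = (if b' = b then 1 else 0)))"

text \<open>The universal enveloping algebra is the tensor algebra of \<open>g\<close> modulo \<open>xy - yx = [x,y]\<close>. The
  first two families of relations, linearity of \<open>g \<rightarrow> Ug\<close>, cut the free algebra on the underlying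
  set of \<open>g\<close> down to the tensor algebra.\<close>

inductive_set uea_rels :: "(complex, 'g) module \<Rightarrow> ('g \<Rightarrow> 'g \<Rightarrow> 'g)
    \<Rightarrow> (('g list \<Rightarrow> complex) \<times> ('g list \<Rightarrow> complex)) set"
  for g br
  where
    uea_add: "\<lbrakk>x \<in> carrier g; y \<in> carrier g\<rbrakk> \<Longrightarrow>
      (free_gen CC (x \<oplus>\<^bsub>g\<^esub> y),
       free_gen CC x \<oplus>\<^bsub>free_algebra CC (carrier g)\<^esub> free_gen CC y) \<in> uea_rels g br"
  | uea_smult: "x \<in> carrier g \<Longrightarrow>
      (free_gen CC (c \<odot>\<^bsub>g\<^esub> x),
       c \<odot>\<^bsub>free_algebra CC (carrier g)\<^esub> free_gen CC x) \<in> uea_rels g br"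
  | uea_br: "\<lbrakk>x \<in> carrier g; y \<in> carrier g\<rbrakk> \<Longrightarrow>
      (free_gen CC x \<otimes>\<^bsub>free_algebra CC (carrier g)\<^esub> free_gen CC y
         \<ominus>\<^bsub>free_algebra CC (carrier g)\<^esub>
       free_gen CC y \<otimes>\<^bsub>free_algebra CC (carrier g)\<^esub> free_gen CC x,
       free_gen CC (br x y)) \<in> uea_rels g br"

definition uea :: "(complex, 'g) module \<Rightarrow> ('g \<Rightarrow> 'g \<Rightarrow> 'g) \<Rightarrow> ('g list \<Rightarrow> complex) set ring"
  where "uea g br = presented_algebra CC (carrier g) (uea_rels g br)"

definition uea_incl ::
  "(complex, 'g) module \<Rightarrow> ('g \<Rightarrow> 'g \<Rightarrow> 'g) \<Rightarrow> 'g \<Rightarrow> ('g list \<Rightarrow> complex) set"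
  where "uea_incl g br x = presented_class CC (carrier g) (uea_rels g br) (free_gen CC x)"

definition casimir :: "(complex, 'g) module \<Rightarrow> ('g \<Rightarrow> 'g \<Rightarrow> 'g) \<Rightarrow> 'g set \<Rightarrow> ('g \<Rightarrow> 'g)
    \<Rightarrow> ('g list \<Rightarrow> complex) set"
  where "casimir g br B dual =
    (\<Oplus>\<^bsub>uea g br\<^esub>b\<in>B. uea_incl g br b \<otimes>\<^bsub>uea g br\<^esub> uea_incl g br (dual b))"

text \<open>The action of \<open>Ug\<close> on a \<open>g\<close>-module. An element of \<open>Ug\<close> is a coset of combinations of words; a
  word \<open>x\<^sub>1 \<dots> x\<^sub>n\<close> acts as \<open>m \<mapsto> x\<^sub>1 (\<dots> (x\<^sub>n m))\<close>, and for a \<open>g\<close>-module all representatives of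
  the coset act in the same way.\<close>

definition uea_act ::
  "(complex, 'm) module \<Rightarrow> ('g \<Rightarrow> 'm \<Rightarrow> 'm) \<Rightarrow> ('g list \<Rightarrow> complex) set \<Rightarrow> 'm \<Rightarrow> 'm"
  where "uea_act M act u = (\<lambda>m\<in>carrier M.
    let p = (SOME p. p \<in> u) in \<Oplus>\<^bsub>M\<^esub>w\<in>{w. p w \<noteq> 0}. p w \<odot>\<^bsub>M\<^esub> foldr act w m)"


section \<open>The tensor space \<open>M \<otimes> V\<^sup>k\<close>\<close>

text \<open>\<open>M \<otimes> V \<otimes> \<dots> \<otimes> V\<close> is the free vector space on the tuples \<open>(m, [v\<^sub>1, \<dots>, v\<^sub>k])\<close> modulo
  multilinearity. Lists are indexed from 0, so the \<open>i\<close>th factor of \<open>V\<close> is entry \<open>i - 1\<close>.\<close>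

definition tuples :: "(complex, 'v) module \<Rightarrow> nat \<Rightarrow> 'v list set"
  where "tuples V k = {vs. length vs = k \<and> set vs \<subseteq> carrier V}"

abbreviation tensor_free :: "(complex, 'm) module \<Rightarrow> (complex, 'v) module \<Rightarrow> nat
    \<Rightarrow> (complex, 'm \<times> 'v list \<Rightarrow> complex) module"
  where "tensor_free M V k \<equiv> free_module CC (carrier M \<times> tuples V k)"

inductive_set tensor_rels :: "(complex, 'm) module \<Rightarrow> (complex, 'v) module \<Rightarrow> nat
    \<Rightarrow> (('m \<times> 'v list \<Rightarrow> complex) \<times> ('m \<times> 'v list \<Rightarrow> complex)) set"
  for M V k
  where
    add0: "\<lbrakk>m \<in> carrier M; m' \<in> carrier M; vs \<in> tuples V k\<rbrakk> \<Longrightarrow>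
      (unit_vec CC (m \<oplus>\<^bsub>M\<^esub> m', vs),
       unit_vec CC (m, vs) \<oplus>\<^bsub>tensor_free M V k\<^esub> unit_vec CC (m', vs)) \<in> tensor_rels M V k"
  | smult0: "\<lbrakk>m \<in> carrier M; vs \<in> tuples V k\<rbrakk> \<Longrightarrow>
      (unit_vec CC (c \<odot>\<^bsub>M\<^esub> m, vs),
       c \<odot>\<^bsub>tensor_free M V k\<^esub> unit_vec CC (m, vs)) \<in> tensor_rels M V k"
  | add: "\<lbrakk>m \<in> carrier M; vs \<in> tuples V k; j < k; v \<in> carrier V; v' \<in> carrier V\<rbrakk> \<Longrightarrow>
      (unit_vec CC (m, vs[j := v \<oplus>\<^bsub>V\<^esub> v']),
       unit_vec CC (m, vs[j := v]) \<oplus>\<^bsub>tensor_free M V k\<^esub> unit_vec CC (m, vs[j := v']))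
        \<in> tensor_rels M V k"
  | smult: "\<lbrakk>m \<in> carrier M; vs \<in> tuples V k; j < k; v \<in> carrier V\<rbrakk> \<Longrightarrow>
      (unit_vec CC (m, vs[j := c \<odot>\<^bsub>V\<^esub> v]),
       c \<odot>\<^bsub>tensor_free M V k\<^esub> unit_vec CC (m, vs[j := v])) \<in> tensor_rels M V k"

definition tensor_ker :: "(complex, 'm) module \<Rightarrow> (complex, 'v) module \<Rightarrow> nat
    \<Rightarrow> ('m \<times> 'v list \<Rightarrow> complex) set"
  where "tensor_ker M V k = \<Inter>{N. submodule N CC (tensor_free M V k) \<and>
    {a \<ominus>\<^bsub>tensor_free M V k\<^esub> b |a b. (a, b) \<in> tensor_rels M V k} \<subseteq> N}"

definition quot_module :: "('c, 'a, 'b) module_scheme \<Rightarrow> 'a set \<Rightarrow> ('c, 'a set) module"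
  where "quot_module F N =
    \<lparr>carrier = a_rcosets\<^bsub>F\<^esub> N, monoid.mult = undefined, one = undefined,
      ring.zero = N, add = set_add F, module.smult = (\<lambda>c S. \<Union>x\<in>S. N +>\<^bsub>F\<^esub> (c \<odot>\<^bsub>F\<^esub> x))\<rparr>"

definition tensor_space :: "(complex, 'm) module \<Rightarrow> (complex, 'v) module \<Rightarrow> nat
    \<Rightarrow> (complex, ('m \<times> 'v list \<Rightarrow> complex) set) module"
  where "tensor_space M V k = quot_module (tensor_free M V k) (tensor_ker M V k)"

definition pure_tensor :: "(complex, 'm) module \<Rightarrow> (complex, 'v) module \<Rightarrow> nat \<Rightarrow> 'm \<Rightarrow> 'v list
    \<Rightarrow> ('m \<times> 'v list \<Rightarrow> complex) set"
  where "pure_tensor M V k m vs =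
    tensor_ker M V k +>\<^bsub>tensor_free M V k\<^esub> unit_vec CC (m, vs)"

text \<open>The linear map on the tensor space with \<open>m \<otimes> v\<^sub>1 \<otimes> \<dots> \<otimes> v\<^sub>k \<mapsto> f m [v\<^sub>1, \<dots>, v\<^sub>k]\<close>, for
  multilinear \<open>f\<close> (it is then independent of the representative of the coset).\<close>

definition tensor_lift :: "(complex, 'm) module \<Rightarrow> (complex, 'v) module \<Rightarrow> nat
    \<Rightarrow> (complex, 'w) module \<Rightarrow> ('m \<Rightarrow> 'v list \<Rightarrow> 'w) \<Rightarrow> ('m \<times> 'v list \<Rightarrow> complex) set \<Rightarrow> 'w"
  where "tensor_lift M V k W f = (\<lambda>S\<in>carrier (tensor_space M V k).
    let p = (SOME p. p \<in> S)
    in \<Oplus>\<^bsub>W\<^esub>q\<in>{q. p q \<noteq> 0}. p q \<odot>\<^bsub>W\<^esub> f (fst q) (snd q))"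

text \<open>The \<open>g\<close>-module structure of the tensor space. Iterating \<open>\<Delta>(x) = x \<otimes> 1 + 1 \<otimes> x\<close>, an
  \<open>x \<in> g\<close> acts by the sum of its actions on the individual factors. Applying
  \<^const>\<open>uea_act\<close> to this action gives the action of \<open>Ug\<close> through the iterated coproduct, since
  the coproduct is the algebra homomorphism determined by its values on \<open>g\<close>.\<close>

definition tensor_act :: "(complex, 'm) module \<Rightarrow> ('g \<Rightarrow> 'm \<Rightarrow> 'm)
    \<Rightarrow> (complex, 'v) module \<Rightarrow> ('g \<Rightarrow> 'v \<Rightarrow> 'v) \<Rightarrow> nat \<Rightarrow> 'g
    \<Rightarrow> ('m \<times> 'v list \<Rightarrow> complex) set \<Rightarrow> ('m \<times> 'v list \<Rightarrow> complex) set"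
  where "tensor_act M actM V actV k x = tensor_lift M V k (tensor_space M V k)
    (\<lambda>m vs. pure_tensor M V k (actM x m) vs \<oplus>\<^bsub>tensor_space M V k\<^esub>
      (\<Oplus>\<^bsub>tensor_space M V k\<^esub>j\<in>{..<k}. pure_tensor M V k m (vs[j := actV x (vs ! j)])))"

text \<open>\<open>\<lambda>T. T \<otimes> w\<^sub>1 \<otimes> \<dots> \<otimes> w\<^sub>n\<close>, from the tensor space with \<open>i\<close> factors \<open>V\<close> to the one with
  \<open>i + n\<close> factors, where \<open>ws = [w\<^sub>1, \<dots>, w\<^sub>n]\<close>.\<close>

definition tensor_append :: "(complex, 'm) module \<Rightarrow> (complex, 'v) module \<Rightarrow> nat \<Rightarrow> 'v list
    \<Rightarrow> ('m \<times> 'v list \<Rightarrow> complex) set \<Rightarrow> ('m \<times> 'v list \<Rightarrow> complex) set"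
  where "tensor_append M V i ws = tensor_lift M V i (tensor_space M V (i + length ws))
    (\<lambda>m us. pure_tensor M V (i + length ws) m (us @ ws))"


section \<open>The degenerate affine braid algebra\<close>

abbreviation adj_transp :: "nat \<Rightarrow> nat \<Rightarrow> nat"
  where "adj_transp i \<equiv> transpose i (Suc i)"

text \<open>First the presentation by the \<open>t\<^sub>u\<close>, \<open>\<kappa>\<^sub>i\<close> and \<open>\<gamma>\<^sub>i\<^sub>j\<close>. Elements of the symmetric group are the
  \<open>u\<close> with \<open>u permutes {1..k}\<close>; they fix 0, which gives the convention \<open>w(0) = 0\<close>. Here and
  below the relation \<open>t\<^sub>1 = 1\<close> is part of the presentation: the \<open>t\<^sub>u\<close> span a copy of the group
  algebra of the symmetric group, with its identity element being the identity of the algebra.\<close>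

datatype braid_gen = Tgen "nat \<Rightarrow> nat" | Kgen nat | Ggen nat nat

definition braid_gens :: "nat \<Rightarrow> braid_gen set"
  where "braid_gens k = {Tgen u |u. u permutes {1..k}} \<union> {Kgen i |i. i \<le> k} \<union>
    {Ggen i j |i j. i \<le> k \<and> j \<le> k \<and> i \<noteq> j}"

abbreviation braid_free :: "('c, 'd) ring_scheme \<Rightarrow> nat \<Rightarrow> ('c, braid_gen list \<Rightarrow> 'c) module"
  where "braid_free C k \<equiv> free_algebra C (braid_gens k)"

abbreviation Tf :: "('c, 'd) ring_scheme \<Rightarrow> (nat \<Rightarrow> nat) \<Rightarrow> braid_gen list \<Rightarrow> 'c"
  where "Tf C u \<equiv> free_gen C (Tgen u)"
abbreviation Kf :: "('c, 'd) ring_scheme \<Rightarrow> nat \<Rightarrow> braid_gen list \<Rightarrow> 'c"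
  where "Kf C i \<equiv> free_gen C (Kgen i)"
abbreviation Gf :: "('c, 'd) ring_scheme \<Rightarrow> nat \<Rightarrow> nat \<Rightarrow> braid_gen list \<Rightarrow> 'c"
  where "Gf C i j \<equiv> free_gen C (Ggen i j)"

inductive_set braid_rels ::
  "('c, 'd) ring_scheme \<Rightarrow> nat \<Rightarrow> ((braid_gen list \<Rightarrow> 'c) \<times> (braid_gen list \<Rightarrow> 'c)) set"
  for C :: "('c, 'd) ring_scheme" and k :: nat
  where
    t_one: "(Tf C id, \<one>\<^bsub>braid_free C k\<^esub>) \<in> braid_rels C k"
  | t_mult: "\<lbrakk>u permutes {1..k}; v permutes {1..k}\<rbrakk> \<Longrightarrow>
      (Tf C u \<otimes>\<^bsub>braid_free C k\<^esub> Tf C v, Tf C (u \<circ> v)) \<in> braid_rels C k"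
  | t_kappa: "\<lbrakk>w permutes {1..k}; i \<le> k\<rbrakk> \<Longrightarrow>
      (Tf C w \<otimes>\<^bsub>braid_free C k\<^esub> Kf C i \<otimes>\<^bsub>braid_free C k\<^esub> Tf C (inv_into UNIV w), Kf C (w i))
        \<in> braid_rels C k"
  | t_gamma: "\<lbrakk>w permutes {1..k}; i \<le> k; j \<le> k; i \<noteq> j\<rbrakk> \<Longrightarrow>
      (Tf C w \<otimes>\<^bsub>braid_free C k\<^esub> Gf C i j \<otimes>\<^bsub>braid_free C k\<^esub> Tf C (inv_into UNIV w), Gf C (w i) (w j))
        \<in> braid_rels C k"
  | kappa_kappa: "\<lbrakk>i \<le> k; j \<le> k\<rbrakk> \<Longrightarrow>
      (Kf C i \<otimes>\<^bsub>braid_free C k\<^esub> Kf C j, Kf C j \<otimes>\<^bsub>braid_free C k\<^esub> Kf C i) \<in> braid_rels C k"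
  | kappa_gamma: "\<lbrakk>i \<le> k; l \<le> k; m \<le> k; l \<noteq> m\<rbrakk> \<Longrightarrow>
      (Kf C i \<otimes>\<^bsub>braid_free C k\<^esub> Gf C l m, Gf C l m \<otimes>\<^bsub>braid_free C k\<^esub> Kf C i) \<in> braid_rels C k"
  | gamma_sym: "\<lbrakk>i \<le> k; j \<le> k; i \<noteq> j\<rbrakk> \<Longrightarrow> (Gf C i j, Gf C j i) \<in> braid_rels C k"
  | gamma_gamma: "\<lbrakk>p \<le> k; r \<le> k; l \<le> k; m \<le> k; p \<noteq> r; l \<noteq> m;
        p \<noteq> l; p \<noteq> m; r \<noteq> l; r \<noteq> m\<rbrakk> \<Longrightarrow>
      (Gf C p r \<otimes>\<^bsub>braid_free C k\<^esub> Gf C l m, Gf C l m \<otimes>\<^bsub>braid_free C k\<^esub> Gf C p r) \<in> braid_rels C k"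
  | gamma_four_term: "\<lbrakk>i \<le> k; j \<le> k; r \<le> k; i \<noteq> j; i \<noteq> r; j \<noteq> r\<rbrakk> \<Longrightarrow>
      (Gf C i j \<otimes>\<^bsub>braid_free C k\<^esub> (Gf C i r \<oplus>\<^bsub>braid_free C k\<^esub> Gf C j r),
       (Gf C i r \<oplus>\<^bsub>braid_free C k\<^esub> Gf C j r) \<otimes>\<^bsub>braid_free C k\<^esub> Gf C i j) \<in> braid_rels C k"

definition braid_algebra :: "('c, 'd) ring_scheme \<Rightarrow> nat \<Rightarrow> (braid_gen list \<Rightarrow> 'c) set ring"
  where "braid_algebra C k = presented_algebra C (braid_gens k) (braid_rels C k)"

definition braid_t :: "('c, 'd) ring_scheme \<Rightarrow> nat \<Rightarrow> (nat \<Rightarrow> nat) \<Rightarrow> (braid_gen list \<Rightarrow> 'c) set"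
  where "braid_t C k u = presented_class C (braid_gens k) (braid_rels C k) (Tf C u)"

definition braid_kappa :: "('c, 'd) ring_scheme \<Rightarrow> nat \<Rightarrow> nat \<Rightarrow> (braid_gen list \<Rightarrow> 'c) set"
  where "braid_kappa C k i = presented_class C (braid_gens k) (braid_rels C k) (Kf C i)"

definition braid_gamma :: "('c, 'd) ring_scheme \<Rightarrow> nat \<Rightarrow> nat \<Rightarrow> nat \<Rightarrow> (braid_gen list \<Rightarrow> 'c) set"
  where "braid_gamma C k i j = presented_class C (braid_gens k) (braid_rels C k) (Gf C i j)"

definition braid_scalar :: "('c, 'd) ring_scheme \<Rightarrow> nat \<Rightarrow> 'c \<Rightarrow> (braid_gen list \<Rightarrow> 'c) set"
  where "braid_scalar C k = presented_scalar C (braid_gens k) (braid_rels C k)"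

definition braid_c :: "('c, 'd) ring_scheme \<Rightarrow> nat \<Rightarrow> nat \<Rightarrow> (braid_gen list \<Rightarrow> 'c) set"
  where "braid_c C k j =
    (\<Oplus>\<^bsub>braid_algebra C k\<^esub>i\<in>{..j}. braid_kappa C k i) \<oplus>\<^bsub>braid_algebra C k\<^esub>
    add_pow (braid_algebra C k) (2::nat)
      (\<Oplus>\<^bsub>braid_algebra C k\<^esub>p\<in>{(l, m). l < m \<and> m \<le> j}. braid_gamma C k (fst p) (snd p))"

text \<open>Next the presentation by the \<open>t\<^sub>u\<close>, \<open>\<kappa>\<^sub>0\<close>, \<open>\<kappa>\<^sub>1\<close> and \<open>y\<^sub>j\<close>. It is meant for \<open>k \<ge> 1\<close>.\<close>

datatype ybraid_gen = YTgen "nat \<Rightarrow> nat" | YK0gen | YK1gen | Ygen nat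

definition ybraid_gens :: "nat \<Rightarrow> ybraid_gen set"
  where "ybraid_gens k =
    {YTgen u |u. u permutes {1..k}} \<union> {YK0gen, YK1gen} \<union> {Ygen j |j. 1 \<le> j \<and> j \<le> k}"

abbreviation ybraid_free :: "('c, 'd) ring_scheme \<Rightarrow> nat \<Rightarrow> ('c, ybraid_gen list \<Rightarrow> 'c) module"
  where "ybraid_free C k \<equiv> free_algebra C (ybraid_gens k)"

abbreviation YTf :: "('c, 'd) ring_scheme \<Rightarrow> (nat \<Rightarrow> nat) \<Rightarrow> ybraid_gen list \<Rightarrow> 'c"
  where "YTf C u \<equiv> free_gen C (YTgen u)"
abbreviation Sf :: "('c, 'd) ring_scheme \<Rightarrow> nat \<Rightarrow> ybraid_gen list \<Rightarrow> 'c"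
  where "Sf C i \<equiv> YTf C (adj_transp i)"
abbreviation K0f :: "('c, 'd) ring_scheme \<Rightarrow> ybraid_gen list \<Rightarrow> 'c"
  where "K0f C \<equiv> free_gen C YK0gen"
abbreviation K1f :: "('c, 'd) ring_scheme \<Rightarrow> ybraid_gen list \<Rightarrow> 'c"
  where "K1f C \<equiv> free_gen C YK1gen"
abbreviation Yf :: "('c, 'd) ring_scheme \<Rightarrow> nat \<Rightarrow> ybraid_gen list \<Rightarrow> 'c"
  where "Yf C j \<equiv> free_gen C (Ygen j)"

definition ygamma :: "('c, 'd) ring_scheme \<Rightarrow> nat \<Rightarrow> nat \<Rightarrow> ybraid_gen list \<Rightarrow> 'c"
  where "ygamma C k i = Yf C (Suc i) \<ominus>\<^bsub>ybraid_free C k\<^esub>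
    (Sf C i \<otimes>\<^bsub>ybraid_free C k\<^esub> Yf C i \<otimes>\<^bsub>ybraid_free C k\<^esub> Sf C i)"

inductive_set ybraid_rels ::
  "('c, 'd) ring_scheme \<Rightarrow> nat \<Rightarrow> ((ybraid_gen list \<Rightarrow> 'c) \<times> (ybraid_gen list \<Rightarrow> 'c)) set"
  for C :: "('c, 'd) ring_scheme" and k :: nat
  where
    y_t_one: "(YTf C id, \<one>\<^bsub>ybraid_free C k\<^esub>) \<in> ybraid_rels C k"
  | y_t_mult: "\<lbrakk>u permutes {1..k}; v permutes {1..k}\<rbrakk> \<Longrightarrow>
      (YTf C u \<otimes>\<^bsub>ybraid_free C k\<^esub> YTf C v, YTf C (u \<circ> v)) \<in> ybraid_rels C k"
  | y_y: "\<lbrakk>1 \<le> i; i \<le> k; 1 \<le> j; j \<le> k\<rbrakk> \<Longrightarrow>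
      (Yf C i \<otimes>\<^bsub>ybraid_free C k\<^esub> Yf C j, Yf C j \<otimes>\<^bsub>ybraid_free C k\<^esub> Yf C i) \<in> ybraid_rels C k"
  | kappa0_kappa1:
      "(K0f C \<otimes>\<^bsub>ybraid_free C k\<^esub> K1f C, K1f C \<otimes>\<^bsub>ybraid_free C k\<^esub> K0f C) \<in> ybraid_rels C k"
  | kappa0_y: "\<lbrakk>1 \<le> i; i \<le> k\<rbrakk> \<Longrightarrow>
      (K0f C \<otimes>\<^bsub>ybraid_free C k\<^esub> Yf C i, Yf C i \<otimes>\<^bsub>ybraid_free C k\<^esub> K0f C) \<in> ybraid_rels C k"
  | kappa1_y: "\<lbrakk>1 \<le> i; i \<le> k\<rbrakk> \<Longrightarrow>
      (K1f C \<otimes>\<^bsub>ybraid_free C k\<^esub> Yf C i, Yf C i \<otimes>\<^bsub>ybraid_free C k\<^esub> K1f C) \<in> ybraid_rels C k"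
  | kappa0_s: "\<lbrakk>1 \<le> i; i < k\<rbrakk> \<Longrightarrow>
      (K0f C \<otimes>\<^bsub>ybraid_free C k\<^esub> Sf C i, Sf C i \<otimes>\<^bsub>ybraid_free C k\<^esub> K0f C) \<in> ybraid_rels C k"
  | kappa1_s1: "1 < k \<Longrightarrow>
      (K1f C \<otimes>\<^bsub>ybraid_free C k\<^esub> Sf C 1 \<otimes>\<^bsub>ybraid_free C k\<^esub> K1f C \<otimes>\<^bsub>ybraid_free C k\<^esub> Sf C 1,
       Sf C 1 \<otimes>\<^bsub>ybraid_free C k\<^esub> K1f C \<otimes>\<^bsub>ybraid_free C k\<^esub> Sf C 1 \<otimes>\<^bsub>ybraid_free C k\<^esub> K1f C)
        \<in> ybraid_rels C k"
  | kappa1_s: "\<lbrakk>1 \<le> j; j < k; j \<noteq> 1\<rbrakk> \<Longrightarrow>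
      (K1f C \<otimes>\<^bsub>ybraid_free C k\<^esub> Sf C j, Sf C j \<otimes>\<^bsub>ybraid_free C k\<^esub> K1f C) \<in> ybraid_rels C k"
  | s_y_sum: "\<lbrakk>1 \<le> i; i < k\<rbrakk> \<Longrightarrow>
      (Sf C i \<otimes>\<^bsub>ybraid_free C k\<^esub> (Yf C i \<oplus>\<^bsub>ybraid_free C k\<^esub> Yf C (Suc i)),
       (Yf C i \<oplus>\<^bsub>ybraid_free C k\<^esub> Yf C (Suc i)) \<otimes>\<^bsub>ybraid_free C k\<^esub> Sf C i) \<in> ybraid_rels C k"
  | y_s: "\<lbrakk>1 \<le> i; i < k; 1 \<le> j; j \<le> k; j \<noteq> i; j \<noteq> Suc i\<rbrakk> \<Longrightarrow>
      (Yf C j \<otimes>\<^bsub>ybraid_free C k\<^esub> Sf C i, Sf C i \<otimes>\<^bsub>ybraid_free C k\<^esub> Yf C j) \<in> ybraid_rels C k"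
  | s_s_gamma: "\<lbrakk>1 \<le> i; i + 2 \<le> k\<rbrakk> \<Longrightarrow>
      (Sf C i \<otimes>\<^bsub>ybraid_free C k\<^esub> Sf C (Suc i) \<otimes>\<^bsub>ybraid_free C k\<^esub> ygamma C k i
         \<otimes>\<^bsub>ybraid_free C k\<^esub> Sf C (Suc i) \<otimes>\<^bsub>ybraid_free C k\<^esub> Sf C i,
       ygamma C k (Suc i)) \<in> ybraid_rels C k"

definition ybraid_algebra :: "('c, 'd) ring_scheme \<Rightarrow> nat \<Rightarrow> (ybraid_gen list \<Rightarrow> 'c) set ring"
  where "ybraid_algebra C k = presented_algebra C (ybraid_gens k) (ybraid_rels C k)"

definition ybraid_class ::
  "('c, 'd) ring_scheme \<Rightarrow> nat \<Rightarrow> (ybraid_gen list \<Rightarrow> 'c) \<Rightarrow> (ybraid_gen list \<Rightarrow> 'c) set"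
  where "ybraid_class C k = presented_class C (ybraid_gens k) (ybraid_rels C k)"

definition ybraid_scalar :: "('c, 'd) ring_scheme \<Rightarrow> nat \<Rightarrow> 'c \<Rightarrow> (ybraid_gen list \<Rightarrow> 'c) set"
  where "ybraid_scalar C k = presented_scalar C (ybraid_gens k) (ybraid_rels C k)"

definition ybraid_c :: "('c, 'd) ring_scheme \<Rightarrow> nat \<Rightarrow> nat \<Rightarrow> (ybraid_gen list \<Rightarrow> 'c) set"
  where "ybraid_c C k j = ybraid_class C k (K0f C) \<oplus>\<^bsub>ybraid_algebra C k\<^esub>
    add_pow (ybraid_algebra C k) (2::nat) (\<Oplus>\<^bsub>ybraid_algebra C k\<^esub>i\<in>{1..j}. ybraid_class C k (Yf C i))"

end

theory Submission
  imports Defs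
begin

text \<open>
  The operators of the action all come from the \<open>k + 1\<close> commuting actions of the Lie algebra on the
  single factors of \<open>T = M \<otimes> V\<^sup>k\<close>. Write \<open>\<rho>\<^sub>p x\<close> for the operator of \<open>x\<close> on factor \<open>p\<close>, where
  factor \<open>0\<close> is \<open>M\<close>, and put \<open>\<Gamma>(r, s) = \<Sum>\<^sub>b r(b) s(b\<^sup>*)\<close> for linear maps \<open>r\<close> and \<open>s\<close> from the Lie
  algebra to an associative algebra. Then \<open>\<gamma>\<^sub>p\<^sub>q = \<Gamma>(\<rho>\<^sub>p, \<rho>\<^sub>q)\<close>, \<open>\<kappa>\<^sub>p = \<Gamma>(\<rho>\<^sub>p, \<rho>\<^sub>p)\<close>, and the Casimir element
  acting on the first \<open>i\<close> factors of \<open>V\<close> and on \<open>M\<close> is \<open>c\<^sub>i = \<Gamma>(\<Delta>\<^sub>i, \<Delta>\<^sub>i)\<close> with \<open>\<Delta>\<^sub>i = \<rho>\<^sub>0 + \<dots> + \<rho>\<^sub>i\<close>.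

  One fact carries the proof, \<open>\<Gamma>_invariant\<close>: invariance of the form says that \<open>\<Sum>\<^sub>b b \<otimes> b\<^sup>*\<close> is killed
  by the Lie algebra, so an element \<open>a\<close> that brackets with \<open>r(y)\<close> and \<open>s(y)\<close> in the way that a Lie
  algebra element \<open>x\<close> brackets with \<open>y\<close> commutes with \<open>\<Gamma>(r, s)\<close>. Thus \<open>\<kappa>\<^sub>p\<close> commutes with all \<open>\<rho>\<^sub>q\<close>, and
  \<open>\<gamma>\<^sub>i\<^sub>j\<close> commutes with \<open>\<rho>\<^sub>i + \<rho>\<^sub>j\<close>, hence with \<open>\<Gamma>(\<rho>\<^sub>i + \<rho>\<^sub>j, \<rho>\<^sub>r) = \<gamma>\<^sub>i\<^sub>r + \<gamma>\<^sub>j\<^sub>r\<close>, which is the four-term relation.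
  The permutation operators satisfy \<open>t\<^sub>w \<rho>\<^sub>p = \<rho>\<^sub>w\<^sub>(\<^sub>p\<^sub>) t\<^sub>w\<close>, and the other relations of the first
  presentation follow formally. For the second presentation the image of \<open>y\<^sub>j\<close> is
  \<open>\<kappa>\<^sub>j/2 + \<Gamma>(\<Delta>\<^bsub>j-1\<^esub>, \<rho>\<^sub>j)\<close>; its relations reduce to the same commutation rules. All of this takes
  place in an arbitrary ring with such a family of elements (locale \<open>braid_family\<close>). The operators also
  commute with \<open>\<Delta>\<^sub>k\<close>, through which the enveloping algebra acts on \<open>T\<close>.

  Algebras given by generators and relations are handled once, by their universal property (locale
  \<open>presented_evaluation\<close>) and by induction over the generators (\<open>presented_algebra_induct\<close>). For the
  enveloping algebra it turns Lie algebra representations into ring homomorphisms, and for the two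
  braid algebras it turns the verified relations into the homomorphisms of the theorem. An element \<open>z\<close> of
  the center acts by its image under the extension of \<open>\<rho>\<^sub>0\<close>, an operator that commutes with all \<open>\<rho>\<^sub>p\<close>.
  Values on pure tensors come from \<open>uea_act_intertwine\<close>: a linear map that intertwines the actions of
  the Lie algebra intertwines those of its enveloping algebra. It is used for \<open>m \<mapsto> m \<otimes> v\<^sub>1 \<otimes> \<dots> \<otimes> v\<^sub>k\<close>,
  for the insertion of a vector of \<open>V\<close> in one place, and for the map that appends the last \<open>k - i\<close> tensor
  factors.
\<close>

section \<open>Free modules\<close>

lemma free_module_carrier_iff:
  "p \<in> carrier (free_module R S) \<longleftrightarrow>
    (\<forall>x. p x \<in> carrier R) \<and> (\<forall>x. x \<notin> S \<longrightarrow> p x = \<zero>\<^bsub>R\<^esub>) \<and> finite {x. p x \<noteq> \<zero>\<^bsub>R\<^esub>}"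
  unfolding free_module_def by auto

lemma abelian_group_cong:
  assumes "abelian_group G" and "carrier H = carrier G" "\<zero>\<^bsub>H\<^esub> = \<zero>\<^bsub>G\<^esub>"
    and "\<And>x y. x \<oplus>\<^bsub>H\<^esub> y = x \<oplus>\<^bsub>G\<^esub> y"
  shows "abelian_group H"
proof -
  interpret G: abelian_group G by fact
  show ?thesis
    by (rule abelian_groupI) (use assms(2-4) G.a_inv_closed G.l_neg in \<open>auto simp: G.a_ac\<close>)
qed

lemma free_module_closed: "p \<in> carrier (free_module R S) \<Longrightarrow> p x \<in> carrier R"
  unfolding free_module_carrier_iff by blast

lemma free_module_simps [simp]:
  "p \<oplus>\<^bsub>free_module R S\<^esub> q = (\<lambda>x. p x \<oplus>\<^bsub>R\<^esub> q x)"
  "\<zero>\<^bsub>free_module R S\<^esub> = (\<lambda>x. \<zero>\<^bsub>R\<^esub>)"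
  "c \<odot>\<^bsub>free_module R S\<^esub> p = (\<lambda>x. c \<otimes>\<^bsub>R\<^esub> p x)"
  unfolding free_module_def by auto

definition word_conv :: "('c, 'd) ring_scheme \<Rightarrow> ('x list \<Rightarrow> 'c) \<Rightarrow> ('x list \<Rightarrow> 'c) \<Rightarrow> 'x list \<Rightarrow> 'c"
  where "word_conv R p q = (\<lambda>w. \<Oplus>\<^bsub>R\<^esub>i\<in>{..length w}. p (take i w) \<otimes>\<^bsub>R\<^esub> q (drop i w))"

lemma free_algebra_simps [simp]:
  "carrier (free_algebra R S) = carrier (free_module R (lists S))"
  "p \<oplus>\<^bsub>free_algebra R S\<^esub> q = (\<lambda>x. p x \<oplus>\<^bsub>R\<^esub> q x)"
  "\<zero>\<^bsub>free_algebra R S\<^esub> = (\<lambda>x. \<zero>\<^bsub>R\<^esub>)"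
  "c \<odot>\<^bsub>free_algebra R S\<^esub> p = (\<lambda>x. c \<otimes>\<^bsub>R\<^esub> p x)"
  "p \<otimes>\<^bsub>free_algebra R S\<^esub> q = word_conv R p q"
  "\<one>\<^bsub>free_algebra R S\<^esub> = unit_vec R []"
  unfolding free_algebra_def by (auto simp: free_module_def word_conv_def)

context cring
begin

lemma free_module_addI:
  "\<lbrakk>p \<in> carrier (free_module R S); q \<in> carrier (free_module R S)\<rbrakk>
    \<Longrightarrow> (\<lambda>x. p x \<oplus> q x) \<in> carrier (free_module R S)"
proof -
  assume p: "p \<in> carrier (free_module R S)" and q: "q \<in> carrier (free_module R S)"
  have "{x. p x \<oplus> q x \<noteq> \<zero>} \<subseteq> {x. p x \<noteq> \<zero>} \<union> {x. q x \<noteq> \<zero>}" by auto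
  then show ?thesis using p q unfolding free_module_carrier_iff
    by (auto intro: finite_subset)
qed

lemma free_module_smultI:
  "\<lbrakk>c \<in> carrier R; p \<in> carrier (free_module R S)\<rbrakk>
    \<Longrightarrow> (\<lambda>x. c \<otimes> p x) \<in> carrier (free_module R S)"
proof -
  assume c: "c \<in> carrier R" and p: "p \<in> carrier (free_module R S)"
  have "{x. c \<otimes> p x \<noteq> \<zero>} \<subseteq> {x. p x \<noteq> \<zero>}" using c by auto
  then show ?thesis using p c unfolding free_module_carrier_iff
    by (auto intro: finite_subset)
qed

lemma unit_vec_closed [simp, intro]: "x \<in> S \<Longrightarrow> unit_vec R x \<in> carrier (free_module R S)"
  unfolding free_module_carrier_iff unit_vec_def by auto

lemma free_module_is_module: "module R (free_module R S)"
proof (rule moduleI)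
  show "abelian_group (free_module R S)"
  proof (rule abelian_groupI)
    fix p assume p: "p \<in> carrier (free_module R S)"
    have "(\<lambda>x. \<ominus> p x) \<in> carrier (free_module R S)"
      using p unfolding free_module_carrier_iff by auto
    then show "\<exists>q\<in>carrier (free_module R S). q \<oplus>\<^bsub>free_module R S\<^esub> p = \<zero>\<^bsub>free_module R S\<^esub>"
      using p by (intro bexI[of _ "\<lambda>x. \<ominus> p x"]) (auto simp: l_neg free_module_carrier_iff)
  next
    fix p q assume "p \<in> carrier (free_module R S)" "q \<in> carrier (free_module R S)"
    then show "p \<oplus>\<^bsub>free_module R S\<^esub> q \<in> carrier (free_module R S)"
      using free_module_addI by simp
  next
    show "\<zero>\<^bsub>free_module R S\<^esub> \<in> carrier (free_module R S)" by (simp add: free_module_carrier_iff)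
  qed (auto simp: free_module_carrier_iff fun_eq_iff a_ac)
next
  fix c p assume "c \<in> carrier R" "p \<in> carrier (free_module R S)"
  then show "c \<odot>\<^bsub>free_module R S\<^esub> p \<in> carrier (free_module R S)"
    using free_module_smultI by simp
qed (auto simp: is_cring free_module_carrier_iff fun_eq_iff l_distr r_distr m_assoc)

text \<open>
  Induction on the support: removing one point \<open>y\<close> from the support of \<open>p\<close> writes \<open>p\<close> as a multiple of
  a basis vector plus an element of smaller support.
\<close>

lemma free_module_induct [consumes 1, case_names zero unit add smult]:
  assumes p: "p \<in> carrier (free_module R S)"
    and zero: "P (\<lambda>x. \<zero>)"
    and unit: "\<And>x. x \<in> S \<Longrightarrow> P (unit_vec R x)"
    and add: "\<And>p q. \<lbrakk>p \<in> carrier (free_module R S); q \<in> carrier (free_module R S); P p; P q\<rbrakk>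
      \<Longrightarrow> P (\<lambda>x. p x \<oplus> q x)"
    and smult: "\<And>c p. \<lbrakk>c \<in> carrier R; p \<in> carrier (free_module R S); P p\<rbrakk> \<Longrightarrow> P (\<lambda>x. c \<otimes> p x)"
  shows "P p"
proof -
  have "finite A \<Longrightarrow> \<forall>p \<in> carrier (free_module R S). {x. p x \<noteq> \<zero>} = A \<longrightarrow> P p" for A
  proof (induction A rule: finite_induct)
    case empty
    show ?case
    proof (intro ballI impI)
      fix p assume "p \<in> carrier (free_module R S)" "{x. p x \<noteq> \<zero>} = {}"
      then have "p = (\<lambda>x. \<zero>)" by auto
      then show "P p" using zero by simp
    qed
  next
    case (insert y A)
    show ?case
    proof (intro ballI impI)
      fix p assume p: "p \<in> carrier (free_module R S)" and supp: "{x. p x \<noteq> \<zero>} = insert y A"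
      let ?q = "p(y := \<zero>)"
      have y: "y \<in> S" "p y \<in> carrier R" using p supp unfolding free_module_carrier_iff by auto
      have q: "?q \<in> carrier (free_module R S)"
        using p unfolding free_module_carrier_iff by (auto intro: finite_subset[of _ "{x. p x \<noteq> \<zero>}"])
      have "{x. ?q x \<noteq> \<zero>} = A" using supp insert.hyps by auto
      then have Pq: "P ?q" using insert.IH q by blast
      have c: "(\<lambda>x. p y \<otimes> unit_vec R y x) \<in> carrier (free_module R S)"
        using free_module_smultI y by blast
      have "P (\<lambda>x. p y \<otimes> unit_vec R y x)" using smult unit y by blast
      then have "P (\<lambda>x. p y \<otimes> unit_vec R y x \<oplus> ?q x)" using add c q Pq by blast
      moreover have "(\<lambda>x. p y \<otimes> unit_vec R y x \<oplus> ?q x) = p"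
      proof
        fix x
        have "p x \<in> carrier R" using p unfolding free_module_carrier_iff by blast
        then show "p y \<otimes> unit_vec R y x \<oplus> ?q x = p x" using y(2)
          by (cases "x = y") (simp_all add: unit_vec_def)
      qed
      ultimately show "P p" by simp
    qed
  qed
  moreover have "finite {x. p x \<noteq> \<zero>}" using p unfolding free_module_carrier_iff by simp
  ultimately show ?thesis using p by simp
qed

end

definition free_lift :: "('c, 'd) ring_scheme \<Rightarrow> ('c, 'w, 'e) module_scheme
    \<Rightarrow> ('x \<Rightarrow> 'w) \<Rightarrow> ('x \<Rightarrow> 'c) \<Rightarrow> 'w"
  where "free_lift R W f p = (\<Oplus>\<^bsub>W\<^esub>x\<in>{x. p x \<noteq> \<zero>\<^bsub>R\<^esub>}. p x \<odot>\<^bsub>W\<^esub> f x)"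

context module
begin

text \<open>
  The support of a sum is in general smaller than the union of the supports, so additivity needs the
  freedom to sum over a larger finite set.
\<close>

lemma free_lift_eq_finsum:
  assumes p: "p \<in> carrier (free_module R S)" and f: "f \<in> S \<rightarrow> carrier M"
    and A: "finite A" "{x. p x \<noteq> \<zero>} \<subseteq> A" "A \<subseteq> S"
  shows "free_lift R M f p = (\<Oplus>\<^bsub>M\<^esub>x\<in>A. p x \<odot>\<^bsub>M\<^esub> f x)"
proof -
  have "p x \<in> carrier R" for x using p unfolding free_module_carrier_iff by auto
  moreover have "f x \<in> carrier M" if "x \<in> A" for x using f A that by auto
  ultimately show ?thesis unfolding free_lift_def
    using A by (intro M.add.finprod_mono_neutral_cong_left) auto
qed

lemma free_lift_closed:
  assumes "p \<in> carrier (free_module R S)" and "f \<in> S \<rightarrow> carrier M"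
  shows "free_lift R M f p \<in> carrier M"
  unfolding free_lift_def using assms unfolding free_module_carrier_iff
  by (intro M.finsum_closed) auto

lemma free_lift_add:
  assumes p: "p \<in> carrier (free_module R S)" and q: "q \<in> carrier (free_module R S)"
    and f: "f \<in> S \<rightarrow> carrier M"
  shows "free_lift R M f (\<lambda>x. p x \<oplus> q x) = free_lift R M f p \<oplus>\<^bsub>M\<^esub> free_lift R M f q"
proof -
  let ?A = "{x. p x \<noteq> \<zero>} \<union> {x. q x \<noteq> \<zero>}"
  have fin: "finite ?A" "?A \<subseteq> S" using p q unfolding free_module_carrier_iff by auto
  have pc: "\<And>x. p x \<in> carrier R" and qc: "\<And>x. q x \<in> carrier R"
    using p q unfolding free_module_carrier_iff by auto
  have fc: "f x \<in> carrier M" if "x \<in> ?A" for x using f fin(2) that by blast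
  have "free_lift R M f (\<lambda>x. p x \<oplus> q x) = (\<Oplus>\<^bsub>M\<^esub>x\<in>?A. (p x \<oplus> q x) \<odot>\<^bsub>M\<^esub> f x)"
    by (rule free_lift_eq_finsum[OF R.free_module_addI[OF p q] f fin(1) _ fin(2)]) auto
  also have "\<dots> = (\<Oplus>\<^bsub>M\<^esub>x\<in>?A. p x \<odot>\<^bsub>M\<^esub> f x \<oplus>\<^bsub>M\<^esub> q x \<odot>\<^bsub>M\<^esub> f x)"
    using pc qc fc by (intro M.finsum_cong') (auto simp: smult_l_distr)
  also have "\<dots> = (\<Oplus>\<^bsub>M\<^esub>x\<in>?A. p x \<odot>\<^bsub>M\<^esub> f x) \<oplus>\<^bsub>M\<^esub> (\<Oplus>\<^bsub>M\<^esub>x\<in>?A. q x \<odot>\<^bsub>M\<^esub> f x)"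
    using pc qc fc by (intro M.finsum_addf) auto
  also have "(\<Oplus>\<^bsub>M\<^esub>x\<in>?A. p x \<odot>\<^bsub>M\<^esub> f x) = free_lift R M f p"
    by (rule free_lift_eq_finsum[OF p f fin(1) _ fin(2), symmetric]) auto
  also have "(\<Oplus>\<^bsub>M\<^esub>x\<in>?A. q x \<odot>\<^bsub>M\<^esub> f x) = free_lift R M f q"
    by (rule free_lift_eq_finsum[OF q f fin(1) _ fin(2), symmetric]) auto
  finally show ?thesis .
qed

lemma free_lift_smult:
  assumes c: "c \<in> carrier R" and p: "p \<in> carrier (free_module R S)"
    and f: "f \<in> S \<rightarrow> carrier M"
  shows "free_lift R M f (\<lambda>x. c \<otimes> p x) = c \<odot>\<^bsub>M\<^esub> free_lift R M f p"
proof -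
  let ?A = "{x. p x \<noteq> \<zero>}"
  have fin: "finite ?A" "?A \<subseteq> S" using p unfolding free_module_carrier_iff by auto
  have pc: "\<And>x. p x \<in> carrier R" using p unfolding free_module_carrier_iff by auto
  have fc: "f x \<in> carrier M" if "x \<in> ?A" for x using f fin(2) that by blast
  have "free_lift R M f (\<lambda>x. c \<otimes> p x) = (\<Oplus>\<^bsub>M\<^esub>x\<in>?A. (c \<otimes> p x) \<odot>\<^bsub>M\<^esub> f x)"
    using c by (intro free_lift_eq_finsum[OF R.free_module_smultI[OF c p] f fin(1) _ fin(2)]) auto
  also have "\<dots> = (\<Oplus>\<^bsub>M\<^esub>x\<in>?A. c \<odot>\<^bsub>M\<^esub> (p x \<odot>\<^bsub>M\<^esub> f x))"
    using pc fc c by (intro M.finsum_cong') (auto simp: smult_assoc1)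
  also have "\<dots> = c \<odot>\<^bsub>M\<^esub> free_lift R M f p"
    unfolding free_lift_def using pc fc c fin(1)
    by (intro finsum_smult_ldistr[symmetric]) auto
  finally show ?thesis .
qed

lemma free_lift_zero: "free_lift R M f (\<lambda>x. \<zero>) = \<zero>\<^bsub>M\<^esub>"
  unfolding free_lift_def by simp

lemma free_lift_unit:
  assumes "x \<in> S" and f: "f \<in> S \<rightarrow> carrier M"
  shows "free_lift R M f (unit_vec R x) = f x"
proof -
  have fx: "f x \<in> carrier M" using assms by auto
  have "free_lift R M f (unit_vec R x) = (\<Oplus>\<^bsub>M\<^esub>y\<in>{x}. unit_vec R x y \<odot>\<^bsub>M\<^esub> f y)"
    using assms by (intro free_lift_eq_finsum[OF R.unit_vec_closed]) (auto simp: unit_vec_def)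
  also have "\<dots> = f x" using fx by (simp add: unit_vec_def)
  finally show ?thesis .
qed

end

section \<open>Free algebras and their evaluation\<close>

context cring
begin

text \<open>
  The laws of the product are proved by induction on the word at which it is evaluated: splitting off
  the first letter \<open>x\<close> reduces \<open>p\<close> to the function \<open>u \<mapsto> p (x u)\<close>, by \<open>word_conv_Cons\<close>.
\<close>

lemma word_conv_closed [simp]:
  "\<lbrakk>\<And>w. p w \<in> carrier R; \<And>w. q w \<in> carrier R\<rbrakk> \<Longrightarrow> word_conv R p q w \<in> carrier R"
  unfolding word_conv_def by auto

lemma word_conv_Nil:
  "\<lbrakk>\<And>w. p w \<in> carrier R; \<And>w. q w \<in> carrier R\<rbrakk> \<Longrightarrow> word_conv R p q [] = p [] \<otimes> q []"
  unfolding word_conv_def by simp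

lemma word_conv_Cons:
  assumes "\<And>w. p w \<in> carrier R" "\<And>w. q w \<in> carrier R"
  shows "word_conv R p q (x # w) = p [] \<otimes> q (x # w) \<oplus> word_conv R (\<lambda>u. p (x # u)) q w"
proof -
  have "word_conv R p q (x # w) =
      (\<Oplus>i\<in>{..length w}. p (x # take i w) \<otimes> q (drop i w)) \<oplus> p [] \<otimes> q (x # w)"
    unfolding word_conv_def using assms
    by (simp add: finsum_Suc2 del: finsum_Suc)
  then show ?thesis unfolding word_conv_def using assms by (simp add: a_comm)
qed

lemma word_conv_add_left:
  assumes "\<And>w. p w \<in> carrier R" "\<And>w. p' w \<in> carrier R" "\<And>w. q w \<in> carrier R"
  shows "word_conv R (\<lambda>w. p w \<oplus> p' w) q w = word_conv R p q w \<oplus> word_conv R p' q w"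
proof -
  have "word_conv R (\<lambda>w. p w \<oplus> p' w) q w = (\<Oplus>i\<in>{..length w}. p (take i w) \<otimes> q (drop i w) \<oplus> p' (take i w) \<otimes> q (drop i w))"
    unfolding word_conv_def using assms by (intro finsum_cong') (auto simp: l_distr)
  also have "\<dots> = word_conv R p q w \<oplus> word_conv R p' q w"
    unfolding word_conv_def using assms by (intro finsum_addf) auto
  finally show ?thesis .
qed

lemma word_conv_add_right:
  assumes "\<And>w. p w \<in> carrier R" "\<And>w. q' w \<in> carrier R" "\<And>w. q w \<in> carrier R"
  shows "word_conv R p (\<lambda>w. q w \<oplus> q' w) w = word_conv R p q w \<oplus> word_conv R p q' w"
proof -
  have "word_conv R p (\<lambda>w. q w \<oplus> q' w) w = (\<Oplus>i\<in>{..length w}. p (take i w) \<otimes> q (drop i w) \<oplus> p (take i w) \<otimes> q' (drop i w))"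
    unfolding word_conv_def using assms by (intro finsum_cong') (auto simp: r_distr)
  also have "\<dots> = word_conv R p q w \<oplus> word_conv R p q' w"
    unfolding word_conv_def using assms by (intro finsum_addf) auto
  finally show ?thesis .
qed

lemma word_conv_smult_left:
  assumes "c \<in> carrier R" "\<And>w. p w \<in> carrier R" "\<And>w. q w \<in> carrier R"
  shows "word_conv R (\<lambda>w. c \<otimes> p w) q w = c \<otimes> word_conv R p q w"
  unfolding word_conv_def using assms
  by (subst finsum_rdistr) (auto intro!: finsum_cong' simp: m_assoc)

lemma word_conv_smult_right:
  assumes "c \<in> carrier R" "\<And>w. p w \<in> carrier R" "\<And>w. q w \<in> carrier R"
  shows "word_conv R p (\<lambda>w. c \<otimes> q w) w = c \<otimes> word_conv R p q w"
  unfolding word_conv_def using assms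
  by (subst finsum_rdistr) (auto intro!: finsum_cong' simp: m_lcomm)

lemma word_conv_zero_left:
  "(\<And>w. q w \<in> carrier R) \<Longrightarrow> word_conv R (\<lambda>w. \<zero>) q w = \<zero>"
  unfolding word_conv_def by simp

lemma word_conv_assoc:
  assumes "\<And>w. p w \<in> carrier R" "\<And>w. q w \<in> carrier R" "\<And>w. r w \<in> carrier R"
  shows "word_conv R (word_conv R p q) r w = word_conv R p (word_conv R q r) w"
  using assms
proof (induction w arbitrary: p q)
  case Nil
  then show ?case by (simp add: word_conv_Nil m_assoc)
next
  case (Cons x w)
  have "word_conv R (\<lambda>u. word_conv R p q (x # u)) r w
      = word_conv R (\<lambda>u. p [] \<otimes> q (x # u) \<oplus> word_conv R (\<lambda>u. p (x # u)) q u) r w"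
    using Cons.prems by (simp add: word_conv_Cons)
  also have "\<dots> = p [] \<otimes> word_conv R (\<lambda>u. q (x # u)) r w
      \<oplus> word_conv R (\<lambda>u. p (x # u)) (word_conv R q r) w"
    using Cons.prems by (simp add: word_conv_add_left word_conv_smult_left Cons.IH)
  finally show ?case using Cons.prems
    by (simp add: word_conv_Cons[of "word_conv R p q"] word_conv_Cons[of p "word_conv R q r"]
        word_conv_Cons[of q r] word_conv_Nil r_distr m_assoc a_assoc)
qed

lemma unit_vec_apply_closed [simp]: "unit_vec R x y \<in> carrier R"
  unfolding unit_vec_def by simp

lemma word_conv_one_left:
  assumes "\<And>w. q w \<in> carrier R"
  shows "word_conv R (unit_vec R []) q w = q w"
proof (cases w)
  case Nil
  then show ?thesis using assms by (simp add: word_conv_Nil) (simp add: unit_vec_def)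
next
  case (Cons x w')
  have "(\<lambda>u. unit_vec R [] (x # u)) = (\<lambda>u. \<zero>)" by (simp add: unit_vec_def fun_eq_iff)
  then show ?thesis using assms Cons
    by (simp add: word_conv_Cons word_conv_zero_left) (simp add: unit_vec_def)
qed

lemma word_conv_one_right:
  assumes "\<And>w. p w \<in> carrier R"
  shows "word_conv R p (unit_vec R []) w = p w"
  using assms
proof (induction w arbitrary: p)
  case Nil
  then show ?case by (simp add: word_conv_Nil) (simp add: unit_vec_def)
next
  case (Cons x w)
  then show ?case by (simp add: word_conv_Cons) (simp add: unit_vec_def)
qed

lemma word_conv_unit_unit:
  "word_conv R (unit_vec R u) (unit_vec R v) = unit_vec R (u @ v)"
proof
  show "word_conv R (unit_vec R u) (unit_vec R v) w = unit_vec R (u @ v) w" for w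
  proof (induction u arbitrary: w)
    case Nil
    show ?case by (simp add: word_conv_one_left)
  next
    case (Cons y u)
    show ?case
    proof (cases w)
      case Nil
      then show ?thesis by (simp add: word_conv_Nil) (simp add: unit_vec_def)
    next
      case w: (Cons x w')
      have "(\<lambda>t. unit_vec R (y # u) (x # t)) = (if x = y then unit_vec R u else (\<lambda>t. \<zero>))"
        by (auto simp: unit_vec_def fun_eq_iff)
      moreover have "unit_vec R (y # u) [] = \<zero>" by (simp add: unit_vec_def)
      ultimately have "word_conv R (unit_vec R (y # u)) (unit_vec R v) w =
          (if x = y then unit_vec R (u @ v) w' else \<zero>)"
        using w Cons.IH by (simp add: word_conv_Cons word_conv_zero_left)
      then show ?thesis using w by (simp add: unit_vec_def)
    qed
  qed
qed

lemma word_conv_in_free_module: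
  assumes p: "p \<in> carrier (free_module R (lists S))" and q: "q \<in> carrier (free_module R (lists S))"
  shows "word_conv R p q \<in> carrier (free_module R (lists S))"
proof -
  have c: "p w \<in> carrier R" "q w \<in> carrier R" for w
    using p q by (auto simp: free_module_carrier_iff)
  have *: "\<exists>u v. w = u @ v \<and> p u \<noteq> \<zero> \<and> q v \<noteq> \<zero>" if "word_conv R p q w \<noteq> \<zero>" for w
  proof (rule ccontr)
    assume "\<not> ?thesis"
    then have "p (take i w) = \<zero> \<or> q (drop i w) = \<zero>" for i
      by (metis append_take_drop_id)
    then have "p (take i w) \<otimes> q (drop i w) = \<zero>" for i
      using c by (metis l_null r_null)
    then show False using that unfolding word_conv_def by simp
  qed
  have "{w. word_conv R p q w \<noteq> \<zero>} \<subseteq> (\<lambda>(u, v). u @ v) ` ({u. p u \<noteq> \<zero>} \<times> {v. q v \<noteq> \<zero>})"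
  proof
    fix w assume "w \<in> {w. word_conv R p q w \<noteq> \<zero>}"
    then obtain u v where "w = u @ v" "p u \<noteq> \<zero>" "q v \<noteq> \<zero>" using * by blast
    then show "w \<in> (\<lambda>(u, v). u @ v) ` ({u. p u \<noteq> \<zero>} \<times> {v. q v \<noteq> \<zero>})"
      by (intro image_eqI[of _ _ "(u, v)"]) auto
  qed
  moreover have "finite ({u. p u \<noteq> \<zero>} \<times> {v. q v \<noteq> \<zero>})"
    using p q by (auto simp: free_module_carrier_iff)
  ultimately have "finite {w. word_conv R p q w \<noteq> \<zero>}" by (meson finite_imageI finite_subset)
  moreover have "word_conv R p q w = \<zero>" if "w \<notin> lists S" for w
  proof (rule ccontr)
    assume "word_conv R p q w \<noteq> \<zero>"
    then obtain u v where "w = u @ v" "p u \<noteq> \<zero>" "q v \<noteq> \<zero>" using * by blast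
    then show False using p q that by (auto simp: free_module_carrier_iff)
  qed
  ultimately show ?thesis using c by (simp add: free_module_carrier_iff)
qed

lemma free_algebra_is_ring: "ring (free_algebra R S)"
proof (rule ringI)
  interpret F: module R "free_module R (lists S)" by (rule free_module_is_module)
  show "abelian_group (free_algebra R S)"
    by (rule abelian_group_cong[OF F.abelian_group_axioms]) simp_all
  show "Group.monoid (free_algebra R S)"
  proof (rule Group.monoidI)
    show "\<one>\<^bsub>free_algebra R S\<^esub> \<in> carrier (free_algebra R S)" by simp
  next
    fix p q assume "p \<in> carrier (free_algebra R S)" "q \<in> carrier (free_algebra R S)"
    then show "p \<otimes>\<^bsub>free_algebra R S\<^esub> q \<in> carrier (free_algebra R S)"
      using word_conv_in_free_module by simp
  qed (auto simp: fun_eq_iff free_module_closed word_conv_assoc word_conv_one_left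
      word_conv_one_right)
qed (auto simp: fun_eq_iff free_module_closed word_conv_add_left word_conv_add_right)

end

text \<open>
  The ring \<open>A\<close> by restriction of scalars along \<open>\<sigma>\<close>, so that evaluation in \<open>A\<close> becomes a case of linear
  extension from a free module.
\<close>

definition scalar_module :: "('c \<Rightarrow> 'a) \<Rightarrow> ('a, 'e) ring_scheme \<Rightarrow> ('c, 'a) module"
  where "scalar_module \<sigma> A = \<lparr>carrier = carrier A, monoid.mult = monoid.mult A, one = one A,
    ring.zero = ring.zero A, add = add A, module.smult = (\<lambda>c a. \<sigma> c \<otimes>\<^bsub>A\<^esub> a)\<rparr>"

definition word_prod :: "('a, 'e) ring_scheme \<Rightarrow> ('x \<Rightarrow> 'a) \<Rightarrow> 'x list \<Rightarrow> 'a"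
  where "word_prod A f w = foldr (\<lambda>x a. f x \<otimes>\<^bsub>A\<^esub> a) w \<one>\<^bsub>A\<^esub>"

definition free_eval :: "('c, 'd) ring_scheme \<Rightarrow> ('c \<Rightarrow> 'a) \<Rightarrow> ('a, 'e) ring_scheme \<Rightarrow> ('x \<Rightarrow> 'a)
    \<Rightarrow> ('x list \<Rightarrow> 'c) \<Rightarrow> 'a"
  where "free_eval R \<sigma> A f = free_lift R (scalar_module \<sigma> A) (word_prod A f)"

lemma scalar_module_simps [simp]:
  "carrier (scalar_module \<sigma> A) = carrier A"
  "a \<oplus>\<^bsub>scalar_module \<sigma> A\<^esub> b = a \<oplus>\<^bsub>A\<^esub> b"
  "\<zero>\<^bsub>scalar_module \<sigma> A\<^esub> = \<zero>\<^bsub>A\<^esub>"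
  "c \<odot>\<^bsub>scalar_module \<sigma> A\<^esub> a = \<sigma> c \<otimes>\<^bsub>A\<^esub> a"
  "finsum (scalar_module \<sigma> A) = finsum A"
  unfolding scalar_module_def finsum_def finprod_def by (auto simp: fun_eq_iff)

lemma scalar_module_is_module:
  assumes "cring R" and "ring A" and \<sigma>: "\<sigma> \<in> ring_hom R A"
  shows "module R (scalar_module \<sigma> A)"
proof -
  interpret R: cring R by fact
  interpret A: ring A by fact
  show ?thesis
  proof (rule moduleI)
    show "abelian_group (scalar_module \<sigma> A)"
      by (rule abelian_group_cong[OF A.is_abelian_group]) simp_all
  qed (auto simp: R.is_cring ring_hom_closed[OF \<sigma>] ring_hom_add[OF \<sigma>] ring_hom_mult[OF \<sigma>]
      ring_hom_one[OF \<sigma>] A.l_distr A.r_distr A.m_assoc)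
qed

text \<open>
  Data for evaluating elements of the free algebra on \<open>S\<close> in a ring \<open>A\<close>. Since \<open>A\<close>
  may be noncommutative, the image of \<open>R\<close> is required to commute with the images of the generators.
\<close>

locale evaluation = R: cring R + A: ring A
  for R :: "('c, 'd) ring_scheme" and A :: "('a, 'e) ring_scheme" +
  fixes \<sigma> :: "'c \<Rightarrow> 'a" and S :: "'x set" and f :: "'x \<Rightarrow> 'a"
  assumes \<sigma>: "\<sigma> \<in> ring_hom R A"
    and f_closed [simp]: "x \<in> S \<Longrightarrow> f x \<in> carrier A"
    and central: "\<lbrakk>c \<in> carrier R; x \<in> S\<rbrakk> \<Longrightarrow> \<sigma> c \<otimes>\<^bsub>A\<^esub> f x = f x \<otimes>\<^bsub>A\<^esub> \<sigma> c"
begin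

abbreviation "ev \<equiv> free_eval R \<sigma> A f"

sublocale W: module R "scalar_module \<sigma> A"
  by (rule scalar_module_is_module[OF R.is_cring A.ring_axioms \<sigma>])

sublocale F: ring "free_algebra R S"
  by (rule R.free_algebra_is_ring)

lemma \<sigma>_closed [simp]: "c \<in> carrier R \<Longrightarrow> \<sigma> c \<in> carrier A"
  by (rule ring_hom_closed[OF \<sigma>])

lemma word_prod_closed [simp]: "w \<in> lists S \<Longrightarrow> word_prod A f w \<in> carrier A"
  unfolding word_prod_def by (induction w) auto

lemma word_prod_append:
  "\<lbrakk>u \<in> lists S; v \<in> lists S\<rbrakk> \<Longrightarrow> word_prod A f (u @ v) = word_prod A f u \<otimes>\<^bsub>A\<^esub> word_prod A f v"
proof (induction u)
  case Nil
  then show ?case using word_prod_closed[of v] by (simp add: word_prod_def)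
next
  case (Cons x u)
  then show ?case using word_prod_closed[of u] word_prod_closed[of v]
    by (simp add: word_prod_def A.m_assoc)
qed

lemma word_prod_central:
  "\<lbrakk>c \<in> carrier R; w \<in> lists S\<rbrakk> \<Longrightarrow> \<sigma> c \<otimes>\<^bsub>A\<^esub> word_prod A f w = word_prod A f w \<otimes>\<^bsub>A\<^esub> \<sigma> c"
proof (induction w)
  case Nil
  then show ?case by (simp add: word_prod_def)
next
  case (Cons x w)
  let ?w = "word_prod A f w"
  have c: "f x \<in> carrier A" "?w \<in> carrier A" "\<sigma> c \<in> carrier A"
    using Cons.prems by auto
  have "\<sigma> c \<otimes>\<^bsub>A\<^esub> (f x \<otimes>\<^bsub>A\<^esub> ?w) = f x \<otimes>\<^bsub>A\<^esub> \<sigma> c \<otimes>\<^bsub>A\<^esub> ?w"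
    using c Cons.prems by (simp add: A.m_assoc[symmetric] central)
  also have "\<dots> = f x \<otimes>\<^bsub>A\<^esub> ?w \<otimes>\<^bsub>A\<^esub> \<sigma> c"
    using c Cons by (simp add: A.m_assoc)
  finally show ?case by (simp add: word_prod_def)
qed

lemma word_prod_funcset: "word_prod A f \<in> lists S \<rightarrow> carrier (scalar_module \<sigma> A)"
  by simp

lemma ev_closed [simp]: "p \<in> carrier (free_algebra R S) \<Longrightarrow> ev p \<in> carrier A"
  using W.free_lift_closed[OF _ word_prod_funcset] by (simp add: free_eval_def)

lemma ev_add:
  "\<lbrakk>p \<in> carrier (free_algebra R S); q \<in> carrier (free_algebra R S)\<rbrakk>
    \<Longrightarrow> ev (p \<oplus>\<^bsub>free_algebra R S\<^esub> q) = ev p \<oplus>\<^bsub>A\<^esub> ev q"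
  using W.free_lift_add[OF _ _ word_prod_funcset] by (simp add: free_eval_def)

lemma ev_smult:
  "\<lbrakk>c \<in> carrier R; p \<in> carrier (free_algebra R S)\<rbrakk>
    \<Longrightarrow> ev (c \<odot>\<^bsub>free_algebra R S\<^esub> p) = \<sigma> c \<otimes>\<^bsub>A\<^esub> ev p"
  using W.free_lift_smult[OF _ _ word_prod_funcset] by (simp add: free_eval_def)

lemma ev_unit_vec: "w \<in> lists S \<Longrightarrow> ev (unit_vec R w) = word_prod A f w"
  using W.free_lift_unit[OF _ word_prod_funcset] by (simp add: free_eval_def)

lemma ev_gen: "x \<in> S \<Longrightarrow> ev (free_gen R x) = f x"
  by (simp add: ev_unit_vec) (simp add: word_prod_def)

lemma ev_zero: "ev (\<lambda>w. \<zero>\<^bsub>R\<^esub>) = \<zero>\<^bsub>A\<^esub>"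
  using W.free_lift_zero by (simp add: free_eval_def)

text \<open>
  Both sides are bilinear in \<open>p\<close> and \<open>q\<close>, so it suffices to compare them on words. Moving a coefficient
  of \<open>q\<close> past a word is where centrality is used.
\<close>

lemma ev_mult:
  assumes "p \<in> carrier (free_algebra R S)" "q \<in> carrier (free_algebra R S)"
  shows "ev (p \<otimes>\<^bsub>free_algebra R S\<^esub> q) = ev p \<otimes>\<^bsub>A\<^esub> ev q"
proof -
  have conv_unit: "ev (word_conv R (unit_vec R u) q) = word_prod A f u \<otimes>\<^bsub>A\<^esub> ev q"
    if u: "u \<in> lists S" and "q \<in> carrier (free_module R (lists S))" for u q
    using that(2)
  proof (induction q rule: R.free_module_induct)
    case zero
    have "word_conv R (unit_vec R u) (\<lambda>w. \<zero>\<^bsub>R\<^esub>) = (\<lambda>w. \<zero>\<^bsub>R\<^esub>)"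
      by (simp add: word_conv_def fun_eq_iff)
    then show ?case using u by (simp add: ev_zero)
  next
    case (unit v)
    then show ?case using u by (simp add: R.word_conv_unit_unit ev_unit_vec word_prod_append)
  next
    case (add p q)
    have "word_conv R (unit_vec R u) (\<lambda>w. p w \<oplus>\<^bsub>R\<^esub> q w) =
        word_conv R (unit_vec R u) p \<oplus>\<^bsub>free_algebra R S\<^esub> word_conv R (unit_vec R u) q"
      using add by (simp add: R.word_conv_add_right free_module_closed fun_eq_iff)
    moreover have "ev (\<lambda>w. p w \<oplus>\<^bsub>R\<^esub> q w) = ev p \<oplus>\<^bsub>A\<^esub> ev q" using ev_add add by simp
    moreover have "word_conv R (unit_vec R u) p \<in> carrier (free_algebra R S)"
      "word_conv R (unit_vec R u) q \<in> carrier (free_algebra R S)"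
      using add u by (auto intro!: R.word_conv_in_free_module simp del: in_lists_conv_set)
    ultimately show ?case using add u
      by (simp only: ev_add) (simp add: A.r_distr)
  next
    case (smult c q)
    have "word_conv R (unit_vec R u) (\<lambda>w. c \<otimes>\<^bsub>R\<^esub> q w) =
        c \<odot>\<^bsub>free_algebra R S\<^esub> word_conv R (unit_vec R u) q"
      using smult by (simp add: R.word_conv_smult_right free_module_closed fun_eq_iff)
    moreover have "ev (\<lambda>w. c \<otimes>\<^bsub>R\<^esub> q w) = \<sigma> c \<otimes>\<^bsub>A\<^esub> ev q" using ev_smult smult by simp
    moreover have "word_conv R (unit_vec R u) q \<in> carrier (free_algebra R S)"
      using smult u by (auto intro!: R.word_conv_in_free_module simp del: in_lists_conv_set)
    ultimately have "ev (word_conv R (unit_vec R u) (\<lambda>w. c \<otimes>\<^bsub>R\<^esub> q w)) =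
        (\<sigma> c \<otimes>\<^bsub>A\<^esub> word_prod A f u) \<otimes>\<^bsub>A\<^esub> ev q"
      using smult u by (simp only: ev_smult) (simp add: A.m_assoc)
    also have "\<dots> = word_prod A f u \<otimes>\<^bsub>A\<^esub> ev (\<lambda>w. c \<otimes>\<^bsub>R\<^esub> q w)"
      using smult u ev_smult[of c q] by (simp add: word_prod_central A.m_assoc)
    finally show ?case .
  qed
  have "p \<in> carrier (free_module R (lists S))" using assms by simp
  then have "ev (word_conv R p q) = ev p \<otimes>\<^bsub>A\<^esub> ev q"
  proof (induction p rule: R.free_module_induct)
    case zero
    have "word_conv R (\<lambda>w. \<zero>\<^bsub>R\<^esub>) q = (\<lambda>w. \<zero>\<^bsub>R\<^esub>)"
      using assms by (simp add: R.word_conv_zero_left free_module_closed fun_eq_iff)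
    then show ?case using assms by (simp add: ev_zero)
  next
    case (unit u)
    then show ?case using conv_unit[of u q] assms by (simp add: ev_unit_vec)
  next
    case (add p p')
    have "word_conv R (\<lambda>w. p w \<oplus>\<^bsub>R\<^esub> p' w) q =
        word_conv R p q \<oplus>\<^bsub>free_algebra R S\<^esub> word_conv R p' q"
      using add assms by (simp add: R.word_conv_add_left free_module_closed fun_eq_iff)
    moreover have "ev (\<lambda>w. p w \<oplus>\<^bsub>R\<^esub> p' w) = ev p \<oplus>\<^bsub>A\<^esub> ev p'" using ev_add add by simp
    moreover have "word_conv R p q \<in> carrier (free_algebra R S)"
      "word_conv R p' q \<in> carrier (free_algebra R S)"
      using add assms by (auto intro!: R.word_conv_in_free_module simp del: in_lists_conv_set)
    ultimately show ?case using add assms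
      by (simp only: ev_add) (simp add: A.l_distr)
  next
    case (smult c p)
    have "word_conv R (\<lambda>w. c \<otimes>\<^bsub>R\<^esub> p w) q = c \<odot>\<^bsub>free_algebra R S\<^esub> word_conv R p q"
      using smult assms by (simp add: R.word_conv_smult_left free_module_closed fun_eq_iff)
    moreover have "ev (\<lambda>w. c \<otimes>\<^bsub>R\<^esub> p w) = \<sigma> c \<otimes>\<^bsub>A\<^esub> ev p" using ev_smult smult by simp
    moreover have "word_conv R p q \<in> carrier (free_algebra R S)"
      using smult assms by (auto intro!: R.word_conv_in_free_module simp del: in_lists_conv_set)
    ultimately show ?case
      using smult assms by (simp only: ev_smult) (simp add: A.m_assoc)
  qed
  then show ?thesis by simp
qed

lemma ev_hom: "ev \<in> ring_hom (free_algebra R S) A"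
proof (rule ring_hom_memI)
  show "ev \<one>\<^bsub>free_algebra R S\<^esub> = \<one>\<^bsub>A\<^esub>"
    by (simp add: ev_unit_vec) (simp add: word_prod_def)
qed (fact ev_closed ev_mult ev_add)+

end

section \<open>Algebras given by generators and relations\<close>

locale presentation = R: cring R for R :: "('c, 'd) ring_scheme" (structure) +
  fixes S :: "'x set" and rels :: "(('x list \<Rightarrow> 'c) \<times> ('x list \<Rightarrow> 'c)) set"
  assumes rels_closed: "(a, b) \<in> rels \<Longrightarrow>
    a \<in> carrier (free_algebra R S) \<and> b \<in> carrier (free_algebra R S)"
begin

abbreviation "FA \<equiv> free_algebra R S"
abbreviation "PA \<equiv> presented_algebra R S rels"
abbreviation "cls \<equiv> presented_class R S rels"

sublocale F: ring FA
  by (rule R.free_algebra_is_ring)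

lemma rel_ideal_ideal: "ideal (rel_ideal R S rels) FA"
  unfolding rel_ideal_def using rels_closed by (intro F.genideal_ideal) blast

sublocale I: ideal "rel_ideal R S rels" FA
  by (rule rel_ideal_ideal)

lemma presented_algebra_is_ring: "ring PA"
  unfolding presented_algebra_def by (rule I.quotient_is_ring)

sublocale PA: ring PA
  by (rule presented_algebra_is_ring)

lemma cls_hom: "cls \<in> ring_hom FA PA"
  using I.rcos_ring_hom unfolding presented_algebra_def presented_class_def .

lemma carrier_PA: "carrier PA = cls ` carrier FA"
  unfolding presented_algebra_def presented_class_def FactRing_simps by auto

lemma gen_closed: "x \<in> S \<Longrightarrow> free_gen R x \<in> carrier FA"
  by auto

lemma presented_scalar_closed: "c \<in> carrier R \<Longrightarrow> presented_scalar R S rels c \<in> carrier PA"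
proof -
  assume c: "c \<in> carrier R"
  have "unit_vec R [] \<in> carrier (free_module R (lists S))" by (rule R.unit_vec_closed) simp
  then have "c \<odot>\<^bsub>FA\<^esub> \<one>\<^bsub>FA\<^esub> \<in> carrier FA"
    using R.free_module_smultI[OF c R.unit_vec_closed[of "[]" "lists S"]] by simp
  then show ?thesis unfolding presented_scalar_def carrier_PA by blast
qed

lemma presented_gen_closed: "x \<in> S \<Longrightarrow> cls (free_gen R x) \<in> carrier PA"
  using gen_closed carrier_PA by blast

text \<open>
  Multiplication by a coefficient is multiplication by the corresponding scalar of the algebra, so
  closure under sums and products is enough.
\<close>

lemma presented_algebra_induct [consumes 1, case_names scalar gen add mult]:
  assumes a: "a \<in> carrier PA"
    and scalar: "\<And>c. c \<in> carrier R \<Longrightarrow> Q (presented_scalar R S rels c)"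
    and gen: "\<And>x. x \<in> S \<Longrightarrow> Q (cls (free_gen R x))"
    and add: "\<And>a b. \<lbrakk>a \<in> carrier PA; b \<in> carrier PA; Q a; Q b\<rbrakk> \<Longrightarrow> Q (a \<oplus>\<^bsub>PA\<^esub> b)"
    and mult: "\<And>a b. \<lbrakk>a \<in> carrier PA; b \<in> carrier PA; Q a; Q b\<rbrakk> \<Longrightarrow> Q (a \<otimes>\<^bsub>PA\<^esub> b)"
  shows "Q a"
proof -
  obtain p where p: "p \<in> carrier (free_module R (lists S))" "a = cls p"
    using a carrier_PA by auto
  have closed: "cls p \<in> carrier PA" if "p \<in> carrier (free_module R (lists S))" for p
    using that carrier_PA by auto
  have "Q (cls p)" using p(1)
  proof (induction p rule: R.free_module_induct)
    case zero
    have "(\<lambda>w. \<zero> \<otimes> unit_vec R [] w) = (\<lambda>w. \<zero>)" by (simp add: fun_eq_iff)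
    then show ?case using scalar[OF R.zero_closed] unfolding presented_scalar_def by simp
  next
    case (unit w)
    then show ?case
    proof (induction w rule: list.induct)
      case Nil
      have "(\<lambda>w. \<one> \<otimes> unit_vec R [] w) = unit_vec R []" by (simp add: fun_eq_iff)
      then show ?case using scalar[OF R.one_closed] unfolding presented_scalar_def by simp
    next
      case (Cons x w)
      then have x: "x \<in> S" and w: "w \<in> lists S" by auto
      have uw: "unit_vec R w \<in> carrier FA" using w R.unit_vec_closed by simp
      have "cls (unit_vec R (x # w)) = cls (free_gen R x) \<otimes>\<^bsub>PA\<^esub> cls (unit_vec R w)"
        using ring_hom_mult[OF cls_hom gen_closed[OF x] uw] by (simp add: R.word_conv_unit_unit)
      then show ?case
        using mult[of "cls (free_gen R x)" "cls (unit_vec R w)"] gen[OF x] Cons.IH[OF w]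
          presented_gen_closed[OF x] closed uw by simp
    qed
  next
    case (add p q)
    then show ?case using ring_hom_add[OF cls_hom, of p q] assms(4)[of "cls p" "cls q"] closed
      by simp
  next
    case (smult c p)
    have c1: "(\<lambda>w. c \<otimes> unit_vec R [] w) \<in> carrier FA"
      using R.free_module_smultI[OF smult(1), OF R.unit_vec_closed[of "[]" "lists S"]] by simp
    have "(\<lambda>w. c \<otimes> p w) = word_conv R (\<lambda>w. c \<otimes> unit_vec R [] w) p"
      using smult(1,2)
      by (simp add: fun_eq_iff R.word_conv_smult_left R.word_conv_one_left free_module_closed)
    then have "cls (\<lambda>w. c \<otimes> p w) = presented_scalar R S rels c \<otimes>\<^bsub>PA\<^esub> cls p"
      using ring_hom_mult[OF cls_hom c1, of p] smult(2) unfolding presented_scalar_def by simp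
    then show ?case
      using mult[OF presented_scalar_closed[OF smult(1)] closed[OF smult(2)] scalar[OF smult(1)]
          smult(3)] by simp
  qed
  then show ?thesis using p(2) by simp
qed

lemma cls_eqI: "(a, b) \<in> rels \<Longrightarrow> cls a = cls b"
proof -
  assume ab: "(a, b) \<in> rels"
  then have c: "a \<in> carrier FA" "b \<in> carrier FA" using rels_closed by auto
  have "a \<ominus>\<^bsub>FA\<^esub> b \<in> rel_ideal R S rels"
    unfolding rel_ideal_def using ab rels_closed
    by (intro subsetD[OF F.genideal_self]) blast+
  then have "a \<in> rel_ideal R S rels +>\<^bsub>FA\<^esub> b"
    using c I.a_rcos_module_minus[OF F.ring_axioms] by blast
  then show ?thesis unfolding presented_class_def
    using c I.a_repr_independence' by metis
qed

end

text \<open>The hypotheses of the universal property of a presented algebra.\<close>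

locale presented_evaluation = evaluation R A \<sigma> S f + presentation R S rels
  for R :: "('c, 'd) ring_scheme" and A :: "('a, 'e) ring_scheme"
    and \<sigma> :: "'c \<Rightarrow> 'a" and S :: "'x set" and f :: "'x \<Rightarrow> 'a"
    and rels :: "(('x list \<Rightarrow> 'c) \<times> ('x list \<Rightarrow> 'c)) set" +
  assumes rels_hold: "(a, b) \<in> rels \<Longrightarrow> free_eval R \<sigma> A f a = free_eval R \<sigma> A f b"
begin

text \<open>
  The induced map on cosets, computed on a chosen representative; it has the form in which the action of
  the enveloping algebra is defined.
\<close>

definition lift :: "('x list \<Rightarrow> 'c) set \<Rightarrow> 'a"
  where "lift U = ev (SOME p. p \<in> U)"

text \<open>
  The kernel of the evaluation is an ideal that contains the relations, hence the ideal generated by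
  them, so the value does not depend on the representative.
\<close>

lemma lift_cls: "p \<in> carrier FA \<Longrightarrow> lift (cls p) = ev p"
proof -
  assume p: "p \<in> carrier FA"
  interpret h: ring_hom_ring FA A ev
    by (rule ring_hom_ringI2[OF F.ring_axioms A.ring_axioms ev_hom])
  have "{a \<ominus>\<^bsub>FA\<^esub> b |a b. (a, b) \<in> rels} \<subseteq> a_kernel FA A ev"
  proof clarify
    fix a b assume ab: "(a, b) \<in> rels"
    then have c: "a \<in> carrier FA" "b \<in> carrier FA" using rels_closed by auto
    have "ev (a \<ominus>\<^bsub>FA\<^esub> b) = \<zero>\<^bsub>A\<^esub>"
      using c rels_hold[OF ab] unfolding a_minus_def
      by (simp add: A.r_neg del: free_algebra_simps)
    then show "a \<ominus>\<^bsub>FA\<^esub> b \<in> a_kernel FA A ev"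
      using c unfolding a_kernel_def' by (simp del: free_algebra_simps)
  qed
  then have sub: "rel_ideal R S rels \<subseteq> a_kernel FA A ev"
    unfolding rel_ideal_def by (rule F.genideal_minimal[OF h.kernel_is_ideal])
  have "p \<in> cls p" unfolding presented_class_def using p by (rule I.a_rcos_self)
  then have "(SOME q. q \<in> cls p) \<in> cls p" by (rule someI[of "\<lambda>q. q \<in> cls p"])
  then obtain i where i: "i \<in> rel_ideal R S rels" and q: "(SOME q. q \<in> cls p) = i \<oplus>\<^bsub>FA\<^esub> p"
    unfolding presented_class_def a_r_coset_def' by blast
  have "i \<in> carrier FA" "ev i = \<zero>\<^bsub>A\<^esub>" using sub i unfolding a_kernel_def' by auto
  then show ?thesis unfolding lift_def q using p by (simp del: free_algebra_simps)
qed

lemma lift_hom: "lift \<in> ring_hom PA A"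
proof (rule ring_hom_memI)
  fix a b assume "a \<in> carrier PA" "b \<in> carrier PA"
  then obtain p q where p: "p \<in> carrier FA" "a = cls p" and q: "q \<in> carrier FA" "b = cls q"
    unfolding carrier_PA by blast
  show "lift (a \<otimes>\<^bsub>PA\<^esub> b) = lift a \<otimes>\<^bsub>A\<^esub> lift b"
    using p q ring_hom_mult[OF cls_hom, of p q, symmetric] lift_cls ev_mult F.m_closed
    by (simp del: free_algebra_simps)
  show "lift (a \<oplus>\<^bsub>PA\<^esub> b) = lift a \<oplus>\<^bsub>A\<^esub> lift b"
    using p q ring_hom_add[OF cls_hom, of p q, symmetric] lift_cls ev_add F.a_closed
    by (simp del: free_algebra_simps)
next
  fix a assume "a \<in> carrier PA"
  then show "lift a \<in> carrier A" unfolding carrier_PA using lift_cls ev_closed by auto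
next
  show "lift \<one>\<^bsub>PA\<^esub> = \<one>\<^bsub>A\<^esub>"
    using ring_hom_one[OF cls_hom, symmetric] lift_cls[OF F.one_closed] ring_hom_one[OF ev_hom]
    by (simp del: free_algebra_simps)
qed

lemma lift_gen: "x \<in> S \<Longrightarrow> lift (cls (free_gen R x)) = f x"
  using lift_cls[OF gen_closed] ev_gen by simp

lemma lift_scalar: "c \<in> carrier R \<Longrightarrow> lift (presented_scalar R S rels c) = \<sigma> c"
proof -
  assume c: "c \<in> carrier R"
  have "c \<odot>\<^bsub>FA\<^esub> \<one>\<^bsub>FA\<^esub> \<in> carrier FA"
    using R.free_module_smultI[OF c R.unit_vec_closed[of "[]" "lists S"]] by simp
  then have "lift (presented_scalar R S rels c) = \<sigma> c \<otimes>\<^bsub>A\<^esub> ev \<one>\<^bsub>FA\<^esub>"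
    unfolding presented_scalar_def using lift_cls ev_smult[OF c F.one_closed] by simp
  then show ?thesis using c ring_hom_one[OF ev_hom] by (simp del: free_algebra_simps)
qed

text \<open>The centralizer of \<open>a\<close> is a subring.\<close>

lemma lift_commute:
  assumes X: "a \<in> carrier A" and "u \<in> carrier PA"
    and scal: "\<And>c. c \<in> carrier R \<Longrightarrow> a \<otimes>\<^bsub>A\<^esub> \<sigma> c = \<sigma> c \<otimes>\<^bsub>A\<^esub> a"
    and gen: "\<And>x. x \<in> S \<Longrightarrow> a \<otimes>\<^bsub>A\<^esub> f x = f x \<otimes>\<^bsub>A\<^esub> a"
  shows "a \<otimes>\<^bsub>A\<^esub> lift u = lift u \<otimes>\<^bsub>A\<^esub> a"
  using assms(2)
proof (induction u rule: presented_algebra_induct)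
  case (scalar c)
  then show ?case using scal by (simp add: lift_scalar)
next
  case (gen x)
  then show ?case using assms(4) by (simp add: lift_gen)
next
  case (add u v)
  then show ?case using X ring_hom_add[OF lift_hom] ring_hom_closed[OF lift_hom]
    by (simp add: A.l_distr A.r_distr)
next
  case (mult u v)
  then have c: "lift u \<in> carrier A" "lift v \<in> carrier A" using ring_hom_closed[OF lift_hom] by auto
  have "a \<otimes>\<^bsub>A\<^esub> (lift u \<otimes>\<^bsub>A\<^esub> lift v) = lift u \<otimes>\<^bsub>A\<^esub> a \<otimes>\<^bsub>A\<^esub> lift v"
    using X c mult by (simp add: A.m_assoc[symmetric])
  also have "\<dots> = lift u \<otimes>\<^bsub>A\<^esub> lift v \<otimes>\<^bsub>A\<^esub> a"
    using X c mult by (simp add: A.m_assoc)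
  finally show ?case using mult ring_hom_mult[OF lift_hom] by simp
qed

end

section \<open>Linear maps and quotient modules\<close>

definition mod_hom :: "('c, 'd) ring_scheme \<Rightarrow> ('c, 'm, 'e) module_scheme \<Rightarrow> ('c, 'w, 'f) module_scheme
    \<Rightarrow> ('m \<Rightarrow> 'w) set"
  where "mod_hom R M W = {h \<in> carrier M \<rightarrow> carrier W.
    (\<forall>x \<in> carrier M. \<forall>y \<in> carrier M. h (x \<oplus>\<^bsub>M\<^esub> y) = h x \<oplus>\<^bsub>W\<^esub> h y) \<and>
    (\<forall>c \<in> carrier R. \<forall>x \<in> carrier M. h (c \<odot>\<^bsub>M\<^esub> x) = c \<odot>\<^bsub>W\<^esub> h x)}"

lemma mod_homD:
  assumes "h \<in> mod_hom R M W"
  shows "x \<in> carrier M \<Longrightarrow> h x \<in> carrier W"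
    and "\<lbrakk>x \<in> carrier M; y \<in> carrier M\<rbrakk> \<Longrightarrow> h (x \<oplus>\<^bsub>M\<^esub> y) = h x \<oplus>\<^bsub>W\<^esub> h y"
    and "\<lbrakk>c \<in> carrier R; x \<in> carrier M\<rbrakk> \<Longrightarrow> h (c \<odot>\<^bsub>M\<^esub> x) = c \<odot>\<^bsub>W\<^esub> h x"
  using assms unfolding mod_hom_def by auto

lemma mod_homI:
  assumes "\<And>x. x \<in> carrier M \<Longrightarrow> h x \<in> carrier W"
    and "\<And>x y. \<lbrakk>x \<in> carrier M; y \<in> carrier M\<rbrakk> \<Longrightarrow> h (x \<oplus>\<^bsub>M\<^esub> y) = h x \<oplus>\<^bsub>W\<^esub> h y"
    and "\<And>c x. \<lbrakk>c \<in> carrier R; x \<in> carrier M\<rbrakk> \<Longrightarrow> h (c \<odot>\<^bsub>M\<^esub> x) = c \<odot>\<^bsub>W\<^esub> h x"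
  shows "h \<in> mod_hom R M W"
  using assms unfolding mod_hom_def by auto

lemma mod_hom_zero:
  assumes "h \<in> mod_hom R M W" "module R M" "module R W"
  shows "h \<zero>\<^bsub>M\<^esub> = \<zero>\<^bsub>W\<^esub>"
proof -
  interpret M: module R M by fact
  interpret W: module R W by fact
  have "h (\<zero>\<^bsub>R\<^esub> \<odot>\<^bsub>M\<^esub> \<zero>\<^bsub>M\<^esub>) = \<zero>\<^bsub>R\<^esub> \<odot>\<^bsub>W\<^esub> h \<zero>\<^bsub>M\<^esub>"
    by (rule mod_homD(3)[OF assms(1)]) simp_all
  then show ?thesis using mod_homD(1)[OF assms(1), of "\<zero>\<^bsub>M\<^esub>"] by simp
qed

lemma mod_hom_finsum:
  assumes h: "h \<in> mod_hom R M W" "module R M" "module R W" and g: "g \<in> A \<rightarrow> carrier M"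
  shows "h (\<Oplus>\<^bsub>M\<^esub>a\<in>A. g a) = (\<Oplus>\<^bsub>W\<^esub>a\<in>A. h (g a))"
proof -
  interpret M: module R M by fact
  interpret W: module R W by fact
  show ?thesis using g
  proof (induction A rule: infinite_finite_induct)
    case (insert a A)
    then have "(\<Oplus>\<^bsub>M\<^esub>a\<in>A. g a) \<in> carrier M" by (intro M.finsum_closed) auto
    moreover have "(\<lambda>a. h (g a)) \<in> A \<rightarrow> carrier W" "h (g a) \<in> carrier W"
      using insert.prems mod_homD(1)[OF h(1)] by auto
    ultimately show ?case using insert mod_homD(2)[OF h(1)] by simp
  qed (simp_all add: mod_hom_zero[OF h])
qed

locale quotient_module = F: module R F for R :: "('c, 'd) ring_scheme" and F :: "('c, 'a, 'e) module_scheme" +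
  fixes N
  assumes sub: "submodule N R F"
begin

lemma subgroup: "abelian_subgroup N F"
  by (rule abelian_subgroupI3[OF additive_subgroup.intro[OF submodule.axioms(1)[OF sub]]
        F.abelian_group_axioms])

sublocale N: abelian_subgroup N F
  by (rule subgroup)

abbreviation "Q \<equiv> quot_module F N"
abbreviation "q \<equiv> \<lambda>x. N +>\<^bsub>F\<^esub> x"

lemma quot_simps:
  "carrier Q = q ` carrier F" "\<zero>\<^bsub>Q\<^esub> = N"
  "a \<oplus>\<^bsub>Q\<^esub> b = a <+>\<^bsub>F\<^esub> b"
  unfolding quot_module_def A_RCOSETS_defs a_r_coset_def r_coset_def by auto

lemma q_add: "\<lbrakk>x \<in> carrier F; y \<in> carrier F\<rbrakk> \<Longrightarrow> q (x \<oplus>\<^bsub>F\<^esub> y) = q x \<oplus>\<^bsub>Q\<^esub> q y"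
  unfolding quot_simps by (simp add: N.a_rcos_sum)

lemma q_smult: "\<lbrakk>c \<in> carrier R; x \<in> carrier F\<rbrakk> \<Longrightarrow> q (c \<odot>\<^bsub>F\<^esub> x) = c \<odot>\<^bsub>Q\<^esub> q x"
proof -
  assume c: "c \<in> carrier R" and x: "x \<in> carrier F"
  have cosets: "q (c \<odot>\<^bsub>F\<^esub> y) = q (c \<odot>\<^bsub>F\<^esub> x)" if y: "y \<in> q x" for y
  proof -
    obtain n where n: "n \<in> N" "y = n \<oplus>\<^bsub>F\<^esub> x"
      using y by (auto simp: a_r_coset_def')
    have "n \<in> carrier F" using n(1) by simp
    then have "c \<odot>\<^bsub>F\<^esub> y = c \<odot>\<^bsub>F\<^esub> n \<oplus>\<^bsub>F\<^esub> c \<odot>\<^bsub>F\<^esub> x"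
      using n c x by (simp add: F.smult_r_distr)
    moreover have "c \<odot>\<^bsub>F\<^esub> n \<in> N" using submodule.smult_closed[OF sub c n(1)] .
    ultimately have "c \<odot>\<^bsub>F\<^esub> y \<in> q (c \<odot>\<^bsub>F\<^esub> x)" unfolding a_r_coset_def' by blast
    then show ?thesis by (rule N.a_repr_independence'[OF _ F.smult_closed[OF c x], symmetric])
  qed
  have xq: "x \<in> q x" using x by (rule N.a_rcos_self)
  have "(\<Union>y\<in>q x. q (c \<odot>\<^bsub>F\<^esub> y)) = q (c \<odot>\<^bsub>F\<^esub> x)"
    by (rule UN_constant_eq[OF xq]) (intro ballI cosets)
  then show ?thesis by (simp add: quot_module_def)
qed

lemma q_mod_hom: "q \<in> mod_hom R F Q"
  by (rule mod_homI) (auto simp: quot_simps(1) q_add q_smult)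

lemma quot_module_is_module: "module R Q"
proof (rule moduleI)
  let ?G = "\<lparr>carrier = a_rcosets\<^bsub>F\<^esub> N, monoid.mult = undefined, one = undefined,
      ring.zero = N, add = set_add F\<rparr>"
  have "abelian_group ?G"
    by (rule comm_group_abelian_groupI)
      (simp add: N.a_factorgroup_is_comm_group[unfolded A_FactGroup_def'])
  then show "abelian_group Q"
    by (rule abelian_group_cong) (simp_all add: quot_module_def)
next
  show "cring R" by (rule F.R.is_cring)
next
  fix c U assume "c \<in> carrier R" "U \<in> carrier Q"
  then show "c \<odot>\<^bsub>Q\<^esub> U \<in> carrier Q" unfolding quot_simps(1) by (auto simp: q_smult[symmetric])
next
  fix c d U assume *: "c \<in> carrier R" "d \<in> carrier R" "U \<in> carrier Q"
  then obtain x where x: "x \<in> carrier F" "U = q x" unfolding quot_simps(1) by blast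
  show "(c \<oplus>\<^bsub>R\<^esub> d) \<odot>\<^bsub>Q\<^esub> U = c \<odot>\<^bsub>Q\<^esub> U \<oplus>\<^bsub>Q\<^esub> d \<odot>\<^bsub>Q\<^esub> U"
    "(c \<otimes>\<^bsub>R\<^esub> d) \<odot>\<^bsub>Q\<^esub> U = c \<odot>\<^bsub>Q\<^esub> (d \<odot>\<^bsub>Q\<^esub> U)"
    using * x by (simp_all add: q_smult[symmetric] q_add[symmetric] F.smult_l_distr F.smult_assoc1)
next
  fix c U U' assume *: "c \<in> carrier R" "U \<in> carrier Q" "U' \<in> carrier Q"
  then obtain x y where x: "x \<in> carrier F" "U = q x" "y \<in> carrier F" "U' = q y"
    unfolding quot_simps(1) by blast
  show "c \<odot>\<^bsub>Q\<^esub> (U \<oplus>\<^bsub>Q\<^esub> U') = c \<odot>\<^bsub>Q\<^esub> U \<oplus>\<^bsub>Q\<^esub> c \<odot>\<^bsub>Q\<^esub> U'"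
    using * x by (simp add: q_smult[symmetric] q_add[symmetric] F.smult_r_distr)
next
  fix U assume "U \<in> carrier Q"
  then show "\<one>\<^bsub>R\<^esub> \<odot>\<^bsub>Q\<^esub> U = U" unfolding quot_simps(1) by (auto simp: q_smult[symmetric])
qed

text \<open>
  A linear map that vanishes on \<open>N\<close> has the same value on the chosen representative of a coset as on
  every other one.
\<close>

lemma mod_hom_representative:
  assumes h: "h \<in> mod_hom R F W" and W: "module R W" and N: "\<And>n. n \<in> N \<Longrightarrow> h n = \<zero>\<^bsub>W\<^esub>"
    and x: "x \<in> carrier F"
  shows "h (SOME p. p \<in> q x) = h x"
proof -
  interpret W: module R W by fact
  have "x \<in> q x" using x by (rule N.a_rcos_self)
  then have "(SOME p. p \<in> q x) \<in> q x" by (rule someI[of "\<lambda>p. p \<in> q x"])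
  then have "\<exists>n\<in>N. (SOME p. p \<in> q x) = n \<oplus>\<^bsub>F\<^esub> x"
    unfolding a_r_coset_def' by (simp only: UN_iff singleton_iff)
  then obtain n where n: "n \<in> N" and e: "(SOME p. p \<in> q x) = n \<oplus>\<^bsub>F\<^esub> x"
    by (rule bexE)
  have nc: "n \<in> carrier F" using n by (rule N.a_Hcarr)
  have "h (n \<oplus>\<^bsub>F\<^esub> x) = h n \<oplus>\<^bsub>W\<^esub> h x" by (rule mod_homD(2)[OF h nc x])
  also have "\<dots> = h x" unfolding N[OF n] by (rule W.l_zero[OF mod_homD(1)[OF h x]])
  finally show ?thesis unfolding e .
qed

end

lemma mod_hom_kernel_submodule:
  assumes h: "h \<in> mod_hom R M W" "module R M" "module R W"
  shows "submodule {x \<in> carrier M. h x = \<zero>\<^bsub>W\<^esub>} R M"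
proof -
  interpret M: module R M by fact
  interpret W: module R W by fact
  show ?thesis
  proof (rule M.submoduleI)
    fix a assume a: "a \<in> {x \<in> carrier M. h x = \<zero>\<^bsub>W\<^esub>}"
    then have ac: "a \<in> carrier M" and ha: "h a = \<zero>\<^bsub>W\<^esub>" by auto
    have c: "h (\<ominus>\<^bsub>M\<^esub> a) \<in> carrier W" by (rule mod_homD(1)[OF h(1) M.a_inv_closed[OF ac]])
    have "h (\<ominus>\<^bsub>M\<^esub> a) = h (\<ominus>\<^bsub>M\<^esub> a) \<oplus>\<^bsub>W\<^esub> h a"
      unfolding ha by (rule W.r_zero[OF c, symmetric])
    also have "\<dots> = h (\<ominus>\<^bsub>M\<^esub> a \<oplus>\<^bsub>M\<^esub> a)"
      by (rule mod_homD(2)[OF h(1) M.a_inv_closed[OF ac] ac, symmetric])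
    also have "\<dots> = \<zero>\<^bsub>W\<^esub>" unfolding M.l_neg[OF ac] by (rule mod_hom_zero[OF h])
    finally show "\<ominus>\<^bsub>M\<^esub> a \<in> {x \<in> carrier M. h x = \<zero>\<^bsub>W\<^esub>}" using ac by simp
  qed (auto simp: mod_homD(2,3)[OF h(1)] mod_hom_zero[OF h])
qed

section \<open>Tensor spaces\<close>

lemma CC_simps [simp]:
  "carrier CC = UNIV" "\<zero>\<^bsub>CC\<^esub> = 0" "\<one>\<^bsub>CC\<^esub> = 1" "a \<oplus>\<^bsub>CC\<^esub> b = a + b" "a \<otimes>\<^bsub>CC\<^esub> b = a * b"
  unfolding ring_of_type_algebra_def by simp_all

lemma CC_cring: "cring CC"
  by (rule cring_from_type_algebra)

lemma tuples_update [simp]: "\<lbrakk>vs \<in> tuples V k; v \<in> carrier V\<rbrakk> \<Longrightarrow> vs[j := v] \<in> tuples V k"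
  unfolding tuples_def using set_update_subset_insert[of vs j v] by auto

lemma tuples_nth [simp]: "\<lbrakk>vs \<in> tuples V k; j < k\<rbrakk> \<Longrightarrow> vs ! j \<in> carrier V"
  unfolding tuples_def by auto

lemma tuples_length: "vs \<in> tuples V k \<Longrightarrow> length vs = k"
  unfolding tuples_def by simp

text \<open>
  Linearity in place \<open>j\<close> is expressed by varying entry \<open>j\<close> of a fixed tuple, as in the relations that
  define the tensor space.
\<close>

definition multilinear :: "(complex, 'm) module \<Rightarrow> (complex, 'v) module \<Rightarrow> nat
    \<Rightarrow> (complex, 'w) module \<Rightarrow> ('m \<Rightarrow> 'v list \<Rightarrow> 'w) \<Rightarrow> bool"
  where "multilinear M V k W f \<longleftrightarrow>
    (\<forall>vs \<in> tuples V k. (\<lambda>m. f m vs) \<in> mod_hom CC M W) \<and>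
    (\<forall>m \<in> carrier M. \<forall>vs \<in> tuples V k. \<forall>j < k. (\<lambda>v. f m (vs[j := v])) \<in> mod_hom CC V W)"

locale tensor = M: module CC M + V: module CC V
  for M :: "(complex, 'm) module" and V :: "(complex, 'v) module" +
  fixes k :: nat
begin

abbreviation "FT \<equiv> tensor_free M V k"
abbreviation "NT \<equiv> tensor_ker M V k"
abbreviation "TT \<equiv> tensor_space M V k"
abbreviation "pure \<equiv> pure_tensor M V k"

lemma FT_module: "module CC FT"
  by (rule cring.free_module_is_module[OF CC_cring])

sublocale FT: module CC FT
  by (rule FT_module)

lemma unit_vec_FT: "\<lbrakk>m \<in> carrier M; vs \<in> tuples V k\<rbrakk> \<Longrightarrow> unit_vec CC (m, vs) \<in> carrier FT"
  by (rule cring.unit_vec_closed[OF CC_cring]) simp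

lemma tensor_rels_closed:
  assumes "(a, b) \<in> tensor_rels M V k"
  shows "a \<in> carrier FT \<and> b \<in> carrier FT"
  using assms
proof cases
  case (add0 m m' vs)
  then show ?thesis using unit_vec_FT FT.a_closed by (simp del: free_module_simps)
next
  case (smult0 m vs c)
  then show ?thesis using unit_vec_FT FT.smult_closed by (simp del: free_module_simps)
next
  case (add m vs j v v')
  then show ?thesis using unit_vec_FT FT.a_closed by (simp del: free_module_simps)
next
  case (smult m vs j v c)
  then show ?thesis using unit_vec_FT FT.smult_closed by (simp del: free_module_simps)
qed

lemma tensor_diff_closed:
  "{a \<ominus>\<^bsub>FT\<^esub> b |a b. (a, b) \<in> tensor_rels M V k} \<subseteq> carrier FT"
  using tensor_rels_closed FT.minus_closed by blast

lemma NT_submodule: "submodule NT CC FT"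
proof -
  have NT: "x \<in> NT \<longleftrightarrow> (\<forall>N. submodule N CC FT \<and>
      {a \<ominus>\<^bsub>FT\<^esub> b |a b. (a, b) \<in> tensor_rels M V k} \<subseteq> N \<longrightarrow> x \<in> N)" for x
    unfolding tensor_ker_def by blast
  have "submodule (carrier FT) CC FT" by (rule FT.carrier_is_submodule)
  then have sub: "NT \<subseteq> carrier FT" using tensor_diff_closed NT by blast
  have zero: "\<zero>\<^bsub>FT\<^esub> \<in> N" if "submodule N CC FT" for N
    using subgroup.one_closed[OF submodule.axioms(1)[OF that]] by simp
  show ?thesis
    by (rule FT.submoduleI[OF sub])
      (simp_all add: NT zero FT.submoduleE(3-5) del: free_module_simps)
qed

sublocale QT: quotient_module CC FT NT
  by (intro quotient_module.intro quotient_module_axioms.intro NT_submodule FT_module)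

lemma TT_module: "module CC TT"
  unfolding tensor_space_def by (rule QT.quot_module_is_module)

sublocale TT: module CC TT
  by (rule TT_module)

lemma q_mod_hom: "(\<lambda>p. NT +>\<^bsub>FT\<^esub> p) \<in> mod_hom CC FT TT"
  using QT.q_mod_hom unfolding tensor_space_def .

lemma carrier_TT: "carrier TT = (\<lambda>p. NT +>\<^bsub>FT\<^esub> p) ` carrier FT"
  unfolding tensor_space_def by (rule QT.quot_simps(1))

lemma pure_closed [simp]: "\<lbrakk>m \<in> carrier M; vs \<in> tuples V k\<rbrakk> \<Longrightarrow> pure m vs \<in> carrier TT"
  unfolding pure_tensor_def carrier_TT using unit_vec_FT by blast

lemma tensor_rels_eq:
  assumes "(a, b) \<in> tensor_rels M V k"
  shows "NT +>\<^bsub>FT\<^esub> a = NT +>\<^bsub>FT\<^esub> b"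
proof -
  have c: "a \<in> carrier FT" "b \<in> carrier FT" using tensor_rels_closed[OF assms] by auto
  have "a \<ominus>\<^bsub>FT\<^esub> b \<in> NT" using assms unfolding tensor_ker_def by blast
  then have "a \<in> NT +>\<^bsub>FT\<^esub> b" unfolding a_minus_def using c QT.N.a_rcos_module by blast
  then show ?thesis using c QT.N.a_repr_independence' by metis
qed

lemma pure_linear_left:
  assumes "vs \<in> tuples V k"
  shows "(\<lambda>m. pure m vs) \<in> mod_hom CC M TT"
proof (rule mod_homI)
  fix m m' assume m: "m \<in> carrier M" "m' \<in> carrier M"
  show "pure (m \<oplus>\<^bsub>M\<^esub> m') vs = pure m vs \<oplus>\<^bsub>TT\<^esub> pure m' vs"
    unfolding pure_tensor_def tensor_rels_eq[OF tensor_rels.add0[OF m assms]]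
    using m assms by (intro mod_homD(2)[OF q_mod_hom] unit_vec_FT)
next
  fix c m assume m: "m \<in> carrier M"
  show "pure (c \<odot>\<^bsub>M\<^esub> m) vs = c \<odot>\<^bsub>TT\<^esub> pure m vs"
    unfolding pure_tensor_def tensor_rels_eq[OF tensor_rels.smult0[OF m assms]]
    using m assms by (intro mod_homD(3)[OF q_mod_hom] unit_vec_FT) auto
qed (use assms in simp)

lemma pure_linear_right:
  assumes m: "m \<in> carrier M" and vs: "vs \<in> tuples V k" and j: "j < k"
  shows "(\<lambda>v. pure m (vs[j := v])) \<in> mod_hom CC V TT"
proof (rule mod_homI)
  fix v v' assume v: "v \<in> carrier V" "v' \<in> carrier V"
  show "pure m (vs[j := v \<oplus>\<^bsub>V\<^esub> v']) = pure m (vs[j := v]) \<oplus>\<^bsub>TT\<^esub> pure m (vs[j := v'])"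
    unfolding pure_tensor_def tensor_rels_eq[OF tensor_rels.add[OF m vs j v]]
    using m vs v by (intro mod_homD(2)[OF q_mod_hom] unit_vec_FT tuples_update)
next
  fix c v assume v: "v \<in> carrier V"
  show "pure m (vs[j := c \<odot>\<^bsub>V\<^esub> v]) = c \<odot>\<^bsub>TT\<^esub> pure m (vs[j := v])"
    unfolding pure_tensor_def tensor_rels_eq[OF tensor_rels.smult[OF m vs j v]]
    using m vs v by (intro mod_homD(3)[OF q_mod_hom] unit_vec_FT tuples_update) auto
qed (use assms in simp)

text \<open>The tensor space is spanned by pure tensors.\<close>

lemma tensor_induct [consumes 1, case_names zero pure add smult]:
  assumes t: "t \<in> carrier TT"
    and zero: "Q \<zero>\<^bsub>TT\<^esub>"
    and pure: "\<And>m vs. \<lbrakk>m \<in> carrier M; vs \<in> tuples V k\<rbrakk> \<Longrightarrow> Q (pure m vs)"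
    and add: "\<And>s t. \<lbrakk>s \<in> carrier TT; t \<in> carrier TT; Q s; Q t\<rbrakk> \<Longrightarrow> Q (s \<oplus>\<^bsub>TT\<^esub> t)"
    and smult: "\<And>c t. \<lbrakk>t \<in> carrier TT; Q t\<rbrakk> \<Longrightarrow> Q (c \<odot>\<^bsub>TT\<^esub> t)"
  shows "Q t"
proof -
  let ?q = "\<lambda>p. NT +>\<^bsub>FT\<^esub> p"
  obtain p where p: "p \<in> carrier FT" and tp: "t = ?q p" using t carrier_TT by auto
  have closed: "?q p \<in> carrier TT" if "p \<in> carrier FT" for p using that carrier_TT by auto
  have "Q (?q p)" using p
  proof (induction p rule: cring.free_module_induct[OF CC_cring, consumes 1, case_names zero unit add smult])
    case zero
    then show ?case using mod_hom_zero[OF q_mod_hom FT_module TT_module] assms(2) by simp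
  next
    case (unit x)
    then show ?case using assms(3) unfolding pure_tensor_def by (cases x) auto
  next
    case (add p r)
    then show ?case using mod_homD(2)[OF q_mod_hom add(1,2)] assms(4)[of "?q p" "?q r"] closed by simp
  next
    case (smult c p)
    then show ?case using mod_homD(3)[OF q_mod_hom smult(1,2)] assms(5)[of "?q p" c] closed by simp
  qed
  then show ?thesis unfolding tp .
qed

lemma mod_hom_tensor_eqI:
  assumes W: "module CC W" and h: "h \<in> mod_hom CC TT W" and h': "h' \<in> mod_hom CC TT W"
    and eq: "\<And>m vs. \<lbrakk>m \<in> carrier M; vs \<in> tuples V k\<rbrakk> \<Longrightarrow> h (pure m vs) = h' (pure m vs)"
    and t: "t \<in> carrier TT"
  shows "h t = h' t"
  using t
proof (induction t rule: tensor_induct)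
  case zero
  then show ?case using mod_hom_zero[OF h TT_module W] mod_hom_zero[OF h' TT_module W] by simp
qed (use eq mod_homD[OF h] mod_homD[OF h'] in simp_all)

lemma multilinearD:
  assumes f: "multilinear M V k W f"
  shows "vs \<in> tuples V k \<Longrightarrow> (\<lambda>m. f m vs) \<in> mod_hom CC M W"
    and "\<lbrakk>m \<in> carrier M; vs \<in> tuples V k; j < k\<rbrakk> \<Longrightarrow> (\<lambda>v. f m (vs[j := v])) \<in> mod_hom CC V W"
  using f unfolding multilinear_def by auto

text \<open>
  The universal property of the tensor space: the linear extension of \<open>f\<close> to the free module vanishes on
  the multilinearity relations, hence on the submodule that they generate.
\<close>

lemma tensor_lift_pure_and_linear:
  assumes W: "module CC W" and f: "multilinear M V k W f"
  shows tensor_lift_pure: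
      "\<lbrakk>m \<in> carrier M; vs \<in> tuples V k\<rbrakk> \<Longrightarrow> tensor_lift M V k W f (pure m vs) = f m vs"
    and tensor_lift_mod_hom: "tensor_lift M V k W f \<in> mod_hom CC TT W"
    and tensor_lift_extensional: "tensor_lift M V k W f \<in> extensional (carrier TT)"
proof -
  interpret W: module CC W by (rule W)
  define h where "h = free_lift CC W (\<lambda>q. f (fst q) (snd q))"
  have fc: "(\<lambda>q. f (fst q) (snd q)) \<in> carrier M \<times> tuples V k \<rightarrow> carrier W"
    using mod_homD(1)[OF multilinearD(1)[OF f]] by auto
  have h_hom: "h \<in> mod_hom CC FT W"
    unfolding h_def
    using W.free_lift_closed[OF _ fc] W.free_lift_add[OF _ _ fc] W.free_lift_smult[OF _ _ fc]
    by (intro mod_homI) simp_all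
  have h_unit: "h (unit_vec CC (m, vs)) = f m vs" if "m \<in> carrier M" "vs \<in> tuples V k" for m vs
    unfolding h_def using W.free_lift_unit[OF _ fc, of "(m, vs)"] that by simp
  have rel: "h a = h b" if "(a, b) \<in> tensor_rels M V k" for a b
    using that
  proof cases
    case (add0 m m' vs)
    then show ?thesis using mod_homD(2)[OF multilinearD(1)[OF f]]
        mod_homD(2)[OF h_hom unit_vec_FT unit_vec_FT]
      by (simp add: h_unit del: free_module_simps)
  next
    case (smult0 m vs c)
    then show ?thesis using mod_homD(3)[OF multilinearD(1)[OF f]]
        mod_homD(3)[OF h_hom _ unit_vec_FT]
      by (simp add: h_unit del: free_module_simps)
  next
    case (add m vs j v v')
    then show ?thesis using mod_homD(2)[OF multilinearD(2)[OF f]]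
        mod_homD(2)[OF h_hom unit_vec_FT unit_vec_FT]
      by (simp add: h_unit del: free_module_simps)
  next
    case (smult m vs j v c)
    then show ?thesis using mod_homD(3)[OF multilinearD(2)[OF f]]
        mod_homD(3)[OF h_hom _ unit_vec_FT]
      by (simp add: h_unit del: free_module_simps)
  qed
  have "{a \<ominus>\<^bsub>FT\<^esub> b |a b. (a, b) \<in> tensor_rels M V k} \<subseteq> {x \<in> carrier FT. h x = \<zero>\<^bsub>W\<^esub>}"
  proof clarify
    fix a b assume ab: "(a, b) \<in> tensor_rels M V k"
    then have c: "a \<in> carrier FT" "b \<in> carrier FT" using tensor_rels_closed by auto
    have "h (a \<ominus>\<^bsub>FT\<^esub> b) \<oplus>\<^bsub>W\<^esub> h b = h a"
      using mod_homD(2)[OF h_hom FT.minus_closed[OF c] c(2)] c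
      by (simp add: a_minus_def FT.a_assoc FT.l_neg del: free_module_simps)
    then have "h (a \<ominus>\<^bsub>FT\<^esub> b) = \<zero>\<^bsub>W\<^esub>"
      using rel[OF ab] mod_homD(1)[OF h_hom] FT.minus_closed[OF c] c
      by (metis W.add.r_cancel_one')
    then show "a \<ominus>\<^bsub>FT\<^esub> b \<in> carrier FT \<and> h (a \<ominus>\<^bsub>FT\<^esub> b) = \<zero>\<^bsub>W\<^esub>"
      using FT.minus_closed[OF c] by simp
  qed
  then have "NT \<subseteq> {x \<in> carrier FT. h x = \<zero>\<^bsub>W\<^esub>}"
    unfolding tensor_ker_def
    using mod_hom_kernel_submodule[OF h_hom FT_module W] by blast
  then have N0: "h n = \<zero>\<^bsub>W\<^esub>" if "n \<in> NT" for n using that by blast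
  have *: "tensor_lift M V k W f (NT +>\<^bsub>FT\<^esub> p) = h p" if p: "p \<in> carrier FT" for p
  proof -
    have "NT +>\<^bsub>FT\<^esub> p \<in> carrier TT" using p carrier_TT by blast
    then have "tensor_lift M V k W f (NT +>\<^bsub>FT\<^esub> p) = h (SOME r. r \<in> NT +>\<^bsub>FT\<^esub> p)"
      by (simp add: tensor_lift_def h_def free_lift_def Let_def)
    then show ?thesis using QT.mod_hom_representative[OF h_hom W N0 p] by simp
  qed
  show "tensor_lift M V k W f (pure m vs) = f m vs" if "m \<in> carrier M" "vs \<in> tuples V k" for m vs
    unfolding pure_tensor_def using *[OF unit_vec_FT] h_unit that by simp
  show "tensor_lift M V k W f \<in> mod_hom CC TT W"
  proof (rule mod_homI)
    fix t assume "t \<in> carrier TT"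
    then show "tensor_lift M V k W f t \<in> carrier W"
      using * mod_homD(1)[OF h_hom] unfolding carrier_TT by auto
  next
    fix s t assume "s \<in> carrier TT" "t \<in> carrier TT"
    then obtain p r where p: "p \<in> carrier FT" "s = NT +>\<^bsub>FT\<^esub> p" "r \<in> carrier FT" "t = NT +>\<^bsub>FT\<^esub> r"
      unfolding carrier_TT by blast
    have "s \<oplus>\<^bsub>TT\<^esub> t = NT +>\<^bsub>FT\<^esub> (p \<oplus>\<^bsub>FT\<^esub> r)" using mod_homD(2)[OF q_mod_hom] p by simp
    then show "tensor_lift M V k W f (s \<oplus>\<^bsub>TT\<^esub> t) = tensor_lift M V k W f s \<oplus>\<^bsub>W\<^esub> tensor_lift M V k W f t"
      using * p mod_homD(2)[OF h_hom] FT.a_closed by (simp del: free_module_simps)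
  next
    fix c t assume c: "c \<in> carrier CC" and "t \<in> carrier TT"
    then obtain p where p: "p \<in> carrier FT" "t = NT +>\<^bsub>FT\<^esub> p"
      unfolding carrier_TT by blast
    have "c \<odot>\<^bsub>TT\<^esub> t = NT +>\<^bsub>FT\<^esub> (c \<odot>\<^bsub>FT\<^esub> p)" using mod_homD(3)[OF q_mod_hom] p c by simp
    then show "tensor_lift M V k W f (c \<odot>\<^bsub>TT\<^esub> t) = c \<odot>\<^bsub>W\<^esub> tensor_lift M V k W f t"
      using * p c mod_homD(3)[OF h_hom] FT.smult_closed by (simp del: free_module_simps CC_simps)
  qed
  show "tensor_lift M V k W f \<in> extensional (carrier TT)"
    unfolding tensor_lift_def by simp
qed

end

section \<open>Endomorphism rings\<close>

lemma End_ring_simps [simp]: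
  "carrier (End_ring W) = mod_hom CC W W \<inter> extensional (carrier W)"
  "a \<otimes>\<^bsub>End_ring W\<^esub> b = compose (carrier W) a b"
  "\<one>\<^bsub>End_ring W\<^esub> = (\<lambda>x\<in>carrier W. x)"
  "\<zero>\<^bsub>End_ring W\<^esub> = (\<lambda>x\<in>carrier W. \<zero>\<^bsub>W\<^esub>)"
  "a \<oplus>\<^bsub>End_ring W\<^esub> b = (\<lambda>x\<in>carrier W. a x \<oplus>\<^bsub>W\<^esub> b x)"
  unfolding End_ring_def mod_hom_def by (auto simp: PiE_def)

lemma End_ring_is_ring:
  assumes W: "module CC W"
  shows "ring (End_ring W)"
proof -
  interpret W: module CC W by (rule W)
  have compose_assoc': "compose (carrier W) (compose (carrier W) a b) c =
      compose (carrier W) a (compose (carrier W) b c)"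
    if "c \<in> mod_hom CC W W" for a b c
    using mod_homD(1)[OF that] by (auto simp: compose_def fun_eq_iff)
  show ?thesis
  proof (rule ringI)
    show "abelian_group (End_ring W)"
    proof (rule abelian_groupI)
      fix a assume a: "a \<in> carrier (End_ring W)"
      then have ah: "a \<in> mod_hom CC W W" by simp
      let ?n = "\<lambda>x\<in>carrier W. \<ominus>\<^bsub>W\<^esub> a x"
      have "?n \<in> carrier (End_ring W)"
        using mod_homD[OF ah] by (auto intro!: mod_homI simp: W.minus_add W.smult_r_minus)
      moreover have "?n \<oplus>\<^bsub>End_ring W\<^esub> a = \<zero>\<^bsub>End_ring W\<^esub>"
        using mod_homD(1)[OF ah] by (auto simp: fun_eq_iff W.l_neg)
      ultimately show "\<exists>b\<in>carrier (End_ring W). b \<oplus>\<^bsub>End_ring W\<^esub> a = \<zero>\<^bsub>End_ring W\<^esub>" by blast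
    next
      fix a b assume "a \<in> carrier (End_ring W)" "b \<in> carrier (End_ring W)"
      then have h: "a \<in> mod_hom CC W W" "b \<in> mod_hom CC W W" by auto
      show "a \<oplus>\<^bsub>End_ring W\<^esub> b \<in> carrier (End_ring W)"
        using mod_homD[OF h(1)] mod_homD[OF h(2)]
        by (auto intro!: mod_homI simp: W.smult_r_distr W.a_ac)
      show "a \<oplus>\<^bsub>End_ring W\<^esub> b = b \<oplus>\<^bsub>End_ring W\<^esub> a"
        using mod_homD(1)[OF h(1)] mod_homD(1)[OF h(2)] by (auto simp: fun_eq_iff W.a_ac)
      fix c assume "c \<in> carrier (End_ring W)"
      then have h': "c \<in> mod_hom CC W W" by auto
      show "a \<oplus>\<^bsub>End_ring W\<^esub> b \<oplus>\<^bsub>End_ring W\<^esub> c = a \<oplus>\<^bsub>End_ring W\<^esub> (b \<oplus>\<^bsub>End_ring W\<^esub> c)"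
        using mod_homD(1)[OF h(1)] mod_homD(1)[OF h(2)] mod_homD(1)[OF h']
        by (auto simp: fun_eq_iff W.a_ac)
    next
      show "\<zero>\<^bsub>End_ring W\<^esub> \<in> carrier (End_ring W)" by (auto intro!: mod_homI)
    next
      fix a assume "a \<in> carrier (End_ring W)"
      then have h: "a \<in> mod_hom CC W W" "a \<in> extensional (carrier W)" by auto
      then show "\<zero>\<^bsub>End_ring W\<^esub> \<oplus>\<^bsub>End_ring W\<^esub> a = a"
        using mod_homD(1)[OF h(1)] by (auto simp: fun_eq_iff extensional_def)
    qed
    show "Group.monoid (End_ring W)"
    proof (rule Group.monoidI)
      fix a b assume "a \<in> carrier (End_ring W)" "b \<in> carrier (End_ring W)"
      then have h: "a \<in> mod_hom CC W W" "b \<in> mod_hom CC W W" by auto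
      show "a \<otimes>\<^bsub>End_ring W\<^esub> b \<in> carrier (End_ring W)"
        using mod_homD[OF h(1)] mod_homD[OF h(2)]
        by (auto intro!: mod_homI simp: compose_def)
      fix c assume "c \<in> carrier (End_ring W)"
      then show "a \<otimes>\<^bsub>End_ring W\<^esub> b \<otimes>\<^bsub>End_ring W\<^esub> c = a \<otimes>\<^bsub>End_ring W\<^esub> (b \<otimes>\<^bsub>End_ring W\<^esub> c)"
        using compose_assoc' by auto
    next
      show "\<one>\<^bsub>End_ring W\<^esub> \<in> carrier (End_ring W)" by (auto intro!: mod_homI)
    next
      fix a assume "a \<in> carrier (End_ring W)"
      then have h: "a \<in> mod_hom CC W W" "a \<in> extensional (carrier W)" by auto
      show "\<one>\<^bsub>End_ring W\<^esub> \<otimes>\<^bsub>End_ring W\<^esub> a = a" "a \<otimes>\<^bsub>End_ring W\<^esub> \<one>\<^bsub>End_ring W\<^esub> = a"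
        using mod_homD(1)[OF h(1)] h(2) by (auto simp: fun_eq_iff extensional_def compose_def)
    qed
  next
    fix a b c
    assume "a \<in> carrier (End_ring W)" "b \<in> carrier (End_ring W)" "c \<in> carrier (End_ring W)"
    then have h: "a \<in> mod_hom CC W W" "b \<in> mod_hom CC W W" "c \<in> mod_hom CC W W" by auto
    show "(a \<oplus>\<^bsub>End_ring W\<^esub> b) \<otimes>\<^bsub>End_ring W\<^esub> c = a \<otimes>\<^bsub>End_ring W\<^esub> c \<oplus>\<^bsub>End_ring W\<^esub> b \<otimes>\<^bsub>End_ring W\<^esub> c"
      "c \<otimes>\<^bsub>End_ring W\<^esub> (a \<oplus>\<^bsub>End_ring W\<^esub> b) = c \<otimes>\<^bsub>End_ring W\<^esub> a \<oplus>\<^bsub>End_ring W\<^esub> c \<otimes>\<^bsub>End_ring W\<^esub> b"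
      using mod_homD(1,2)[OF h(1)] mod_homD(1,2)[OF h(2)] mod_homD(1,2)[OF h(3)]
      by (auto simp: fun_eq_iff compose_def)
  qed
qed

definition End_scalar :: "(complex, 'w) module \<Rightarrow> complex \<Rightarrow> 'w \<Rightarrow> 'w"
  where "End_scalar W c = (\<lambda>x\<in>carrier W. c \<odot>\<^bsub>W\<^esub> x)"

lemma End_scalar_hom:
  assumes W: "module CC W"
  shows "End_scalar W \<in> ring_hom CC (End_ring W)"
proof -
  interpret W: module CC W by (rule W)
  have sm: "c \<odot>\<^bsub>W\<^esub> (d \<odot>\<^bsub>W\<^esub> x) = (c * d) \<odot>\<^bsub>W\<^esub> x" if "x \<in> carrier W" for c d x
    using W.smult_assoc1[of c d x] that by simp
  have sa: "(c + d) \<odot>\<^bsub>W\<^esub> x = c \<odot>\<^bsub>W\<^esub> x \<oplus>\<^bsub>W\<^esub> d \<odot>\<^bsub>W\<^esub> x" if "x \<in> carrier W" for c d x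
    using W.smult_l_distr[of c d x] that by simp
  have s1: "1 \<odot>\<^bsub>W\<^esub> x = x" if "x \<in> carrier W" for x
    using W.smult_one[of x] that by simp
  have sc: "c \<odot>\<^bsub>W\<^esub> x \<in> carrier W" if "x \<in> carrier W" for c x
    using W.smult_closed[of c x] that by simp
  show ?thesis unfolding End_scalar_def
    by (rule ring_hom_memI)
      (auto intro!: mod_homI simp: W.smult_r_distr sm sa s1 sc mult.commute compose_def fun_eq_iff)
qed

lemma End_scalar_central:
  assumes W: "module CC W" and a: "a \<in> carrier (End_ring W)"
  shows "End_scalar W c \<otimes>\<^bsub>End_ring W\<^esub> a = a \<otimes>\<^bsub>End_ring W\<^esub> End_scalar W c"
proof -
  interpret W: module CC W by (rule W)
  have "c \<odot>\<^bsub>W\<^esub> x \<in> carrier W" if "x \<in> carrier W" for x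
    using W.smult_closed[of c x] that by simp
  moreover have "a \<in> mod_hom CC W W" using a by simp
  ultimately show ?thesis unfolding End_scalar_def
    using mod_homD(1,3)[of a CC W W] by (auto simp: compose_def fun_eq_iff)
qed

lemma End_finsum_apply:
  assumes W: "module CC W" and f: "f \<in> I \<rightarrow> carrier (End_ring W)" and x: "x \<in> carrier W"
  shows "(\<Oplus>\<^bsub>End_ring W\<^esub>i\<in>I. f i) x = (\<Oplus>\<^bsub>W\<^esub>i\<in>I. f i x)"
proof -
  interpret W: module CC W by (rule W)
  interpret E: ring "End_ring W" by (rule End_ring_is_ring[OF W])
  show ?thesis using f
  proof (induction I rule: infinite_finite_induct)
    case (insert i I)
    moreover have "f j x \<in> carrier W" if "j \<in> insert i I" for j
      using insert.prems that x mod_homD(1)[of "f j" CC W W] by auto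
    ultimately show ?case using x by (simp add: Pi_def)
  qed (use x in simp_all)
qed

section \<open>Invariant forms\<close>

lemma (in abelian_monoid) finsum_swap:
  assumes "finite I" "finite J" "\<And>i j. \<lbrakk>i \<in> I; j \<in> J\<rbrakk> \<Longrightarrow> f i j \<in> carrier G"
  shows "(\<Oplus>i\<in>I. \<Oplus>j\<in>J. f i j) = (\<Oplus>j\<in>J. \<Oplus>i\<in>I. f i j)"
  using assms(1,3)
proof (induction I rule: finite_induct)
  case empty
  then show ?case by simp
next
  case (insert i I)
  have "(\<Oplus>j\<in>J. \<Oplus>i\<in>insert i I. f i j) = (\<Oplus>j\<in>J. f i j \<oplus> (\<Oplus>i\<in>I. f i j))"
    using insert by (intro finsum_cong') (auto simp: Pi_def)
  also have "\<dots> = (\<Oplus>j\<in>J. f i j) \<oplus> (\<Oplus>j\<in>J. \<Oplus>i\<in>I. f i j)"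
    using insert.prems by (intro finsum_addf) (auto intro!: finsum_closed)
  finally show ?case using insert by (simp add: Pi_def)
qed

locale quadratic_lie_algebra = lie_algebra g br
  for g :: "(complex, 'g) module" and br :: "'g \<Rightarrow> 'g \<Rightarrow> 'g" +
  fixes form :: "'g \<Rightarrow> 'g \<Rightarrow> complex" and B :: "'g set" and dual :: "'g \<Rightarrow> 'g"
  assumes basis: "finite_basis g B"
    and bilinear: "bilinear_form g form"
    and symmetric: "symmetric_form g form"
    and nondegenerate: "nondegenerate_form g form"
    and invariant: "ad_invariant_form g br form"
    and dual: "dual_basis g form B dual"
begin

lemma B_finite [simp]: "finite B"
  using basis unfolding finite_basis_def by simp

lemma B_closed [simp]: "b \<in> B \<Longrightarrow> b \<in> carrier g"
  using basis unfolding finite_basis_def by blast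

lemma dual_closed [simp]: "b \<in> B \<Longrightarrow> dual b \<in> carrier g"
  using dual unfolding dual_basis_def by blast

lemma smult_g [simp]: "x \<in> carrier g \<Longrightarrow> c \<odot>\<^bsub>g\<^esub> x \<in> carrier g"
  using smult_closed[of c x] by simp

lemma form_sym: "\<lbrakk>x \<in> carrier g; y \<in> carrier g\<rbrakk> \<Longrightarrow> form x y = form y x"
  using symmetric unfolding symmetric_form_def by blast

lemma form_add: "\<lbrakk>x \<in> carrier g; y \<in> carrier g; z \<in> carrier g\<rbrakk> \<Longrightarrow> form (x \<oplus>\<^bsub>g\<^esub> y) z = form x z + form y z"
  using bilinear unfolding bilinear_form_def by blast

lemma form_smult: "\<lbrakk>x \<in> carrier g; z \<in> carrier g\<rbrakk> \<Longrightarrow> form (c \<odot>\<^bsub>g\<^esub> x) z = c * form x z"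
  using bilinear unfolding bilinear_form_def by blast

lemma form_zero: "z \<in> carrier g \<Longrightarrow> form \<zero>\<^bsub>g\<^esub> z = 0"
  using form_add[of "\<zero>\<^bsub>g\<^esub>" "\<zero>\<^bsub>g\<^esub>" z] by simp

lemma form_sum:
  assumes "finite I" "\<And>i. i \<in> I \<Longrightarrow> v i \<in> carrier g" "z \<in> carrier g"
  shows "form (\<Oplus>\<^bsub>g\<^esub>i\<in>I. c i \<odot>\<^bsub>g\<^esub> v i) z = (\<Sum>i\<in>I. c i * form (v i) z)"
  using assms
proof (induction I rule: finite_induct)
  case (insert i I)
  then have "(\<Oplus>\<^bsub>g\<^esub>i\<in>I. c i \<odot>\<^bsub>g\<^esub> v i) \<in> carrier g" by (intro M.finsum_closed) auto
  then show ?case using insert by (simp add: Pi_def form_add form_smult)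
qed (simp add: form_zero)

lemma basis_expansion: "x \<in> carrier g \<Longrightarrow> x = (\<Oplus>\<^bsub>g\<^esub>b\<in>B. form x (dual b) \<odot>\<^bsub>g\<^esub> b)"
proof -
  assume x: "x \<in> carrier g"
  then obtain c where c: "x = (\<Oplus>\<^bsub>g\<^esub>b\<in>B. c b \<odot>\<^bsub>g\<^esub> b)"
    using basis unfolding finite_basis_def by blast
  have "form x (dual b) = c b" if b: "b \<in> B" for b
  proof -
    have "form x (dual b) = (\<Sum>b'\<in>B. c b' * form b' (dual b))"
      unfolding c using b by (intro form_sum) auto
    also have "\<dots> = (\<Sum>b'\<in>B. if b' = b then c b' else 0)"
      using dual b unfolding dual_basis_def by (intro sum.cong) auto
    also have "\<dots> = c b" using b by simp
    finally show ?thesis .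
  qed
  then have "(\<Oplus>\<^bsub>g\<^esub>b\<in>B. c b \<odot>\<^bsub>g\<^esub> b) = (\<Oplus>\<^bsub>g\<^esub>b\<in>B. form x (dual b) \<odot>\<^bsub>g\<^esub> b)"
    by (intro M.finsum_cong') auto
  then show ?thesis using c by simp
qed

text \<open>
  By nondegeneracy it suffices to pair both sides with an arbitrary \<open>y\<close>, and there the claim is the basis
  expansion of \<open>y\<close>.
\<close>

lemma dual_basis_expansion: "x \<in> carrier g \<Longrightarrow> x = (\<Oplus>\<^bsub>g\<^esub>b\<in>B. form x b \<odot>\<^bsub>g\<^esub> dual b)"
proof -
  assume x: "x \<in> carrier g"
  define s where "s = (\<Oplus>\<^bsub>g\<^esub>b\<in>B. form x b \<odot>\<^bsub>g\<^esub> dual b)"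
  have s: "s \<in> carrier g" unfolding s_def by (intro M.finsum_closed) auto
  have eq: "form x y = form s y" if y: "y \<in> carrier g" for y
  proof -
    have "form x y = form y x" using x y by (rule form_sym)
    also have "\<dots> = (\<Sum>b\<in>B. form y (dual b) * form b x)"
      by (subst basis_expansion[OF y]) (rule form_sum, use x in auto)
    also have "\<dots> = (\<Sum>b\<in>B. form x b * form (dual b) y)"
      using x y by (intro sum.cong) (auto simp: form_sym mult.commute)
    also have "\<dots> = form s y" unfolding s_def by (rule form_sum[symmetric]) (use y in auto)
    finally show ?thesis .
  qed
  have neg: "\<ominus>\<^bsub>g\<^esub> s \<in> carrier g" using s by simp
  have "form (x \<ominus>\<^bsub>g\<^esub> s) y = 0" if y: "y \<in> carrier g" for y
  proof -
    have "form s y + form (\<ominus>\<^bsub>g\<^esub> s) y = 0"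
      using form_add[OF s neg y] form_zero[OF y] s by (simp add: M.r_neg)
    then show ?thesis using form_add[OF x neg y] eq[OF y] by (simp add: a_minus_def)
  qed
  moreover have mc: "x \<ominus>\<^bsub>g\<^esub> s \<in> carrier g" using x s by (rule M.minus_closed)
  ultimately have "x \<ominus>\<^bsub>g\<^esub> s = \<zero>\<^bsub>g\<^esub>"
    using nondegenerate unfolding nondegenerate_form_def by blast
  then have "x \<ominus>\<^bsub>g\<^esub> s \<oplus>\<^bsub>g\<^esub> s = s" using s by simp
  moreover have "x \<ominus>\<^bsub>g\<^esub> s \<oplus>\<^bsub>g\<^esub> s = x"
    using x s neg by (simp add: a_minus_def M.a_assoc M.l_neg)
  ultimately have "x = s" by simp
  then show ?thesis unfolding s_def .
qed

text \<open>
  The tensor \<open>\<Sum>\<^sub>b b \<otimes> b\<^sup>*\<close> is invariant under the Lie algebra; to avoid the tensor product the statement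
  is about its image under a bilinear map \<open>\<beta>\<close>. If \<open>a\<close> is the matrix of \<open>[x, -]\<close> in the basis \<open>B\<close>, then
  invariance of the form says that its matrix in the dual basis is minus the transpose of \<open>a\<close>, and the
  two double sums cancel.
\<close>

lemma contraction_invariant:
  assumes W: "module CC W"
    and left: "\<And>y. y \<in> carrier g \<Longrightarrow> (\<lambda>x. \<beta> x y) \<in> mod_hom CC g W"
    and right: "\<And>x. x \<in> carrier g \<Longrightarrow> \<beta> x \<in> mod_hom CC g W"
    and x: "x \<in> carrier g"
  shows "(\<Oplus>\<^bsub>W\<^esub>b\<in>B. \<beta> (br x b) (dual b)) \<oplus>\<^bsub>W\<^esub> (\<Oplus>\<^bsub>W\<^esub>b\<in>B. \<beta> b (br x (dual b))) = \<zero>\<^bsub>W\<^esub>"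
proof -
  interpret W: module CC W by (rule W)
  have g: "module CC g" by (rule module_axioms)
  define a where "a b b' = form (br x b) (dual b')" for b b'
  have bc: "\<beta> y z \<in> carrier W" if "y \<in> carrier g" "z \<in> carrier g" for y z
    using mod_homD(1)[OF right] that by auto
  have sc: "c \<odot>\<^bsub>W\<^esub> u \<in> carrier W" if "u \<in> carrier W" for c u
    using W.smult_closed[of c u] that by simp
  have "\<beta> (br x b) (dual b) = (\<Oplus>\<^bsub>W\<^esub>b'\<in>B. a b b' \<odot>\<^bsub>W\<^esub> \<beta> b' (dual b))" if b: "b \<in> B" for b
  proof -
    have "\<beta> (br x b) (dual b) = \<beta> (\<Oplus>\<^bsub>g\<^esub>b'\<in>B. a b b' \<odot>\<^bsub>g\<^esub> b') (dual b)"
      using basis_expansion[OF br_closed[OF x B_closed[OF b]]] unfolding a_def by simp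
    also have "\<dots> = (\<Oplus>\<^bsub>W\<^esub>b'\<in>B. \<beta> (a b b' \<odot>\<^bsub>g\<^esub> b') (dual b))"
      using b by (intro mod_hom_finsum[OF left g W]) auto
    also have "\<dots> = (\<Oplus>\<^bsub>W\<^esub>b'\<in>B. a b b' \<odot>\<^bsub>W\<^esub> \<beta> b' (dual b))"
      using b by (intro W.finsum_cong') (auto simp: mod_homD(3)[OF left] bc sc)
    finally show ?thesis .
  qed
  then have 1: "(\<Oplus>\<^bsub>W\<^esub>b\<in>B. \<beta> (br x b) (dual b)) = (\<Oplus>\<^bsub>W\<^esub>b\<in>B. \<Oplus>\<^bsub>W\<^esub>b'\<in>B. a b b' \<odot>\<^bsub>W\<^esub> \<beta> b' (dual b))"
    by (intro W.finsum_cong') (auto intro!: W.finsum_closed simp: bc sc)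
  have a': "form (br x (dual b)) b' = - a b' b" if "b \<in> B" "b' \<in> B" for b b'
  proof -
    have "form (br x (dual b)) b' + form (dual b) (br x b') = 0"
      using invariant x that unfolding ad_invariant_form_def by auto
    then show ?thesis unfolding a_def
      using form_sym[of "dual b" "br x b'"] br_closed x that by (simp add: eq_neg_iff_add_eq_0)
  qed
  have "\<beta> b (br x (dual b)) = (\<Oplus>\<^bsub>W\<^esub>b'\<in>B. (- a b' b) \<odot>\<^bsub>W\<^esub> \<beta> b (dual b'))" if b: "b \<in> B" for b
  proof -
    have "br x (dual b) = (\<Oplus>\<^bsub>g\<^esub>b'\<in>B. form (br x (dual b)) b' \<odot>\<^bsub>g\<^esub> dual b')"
      by (rule dual_basis_expansion[OF br_closed[OF x dual_closed[OF b]]])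
    also have "\<dots> = (\<Oplus>\<^bsub>g\<^esub>b'\<in>B. (- a b' b) \<odot>\<^bsub>g\<^esub> dual b')"
      using b by (intro M.finsum_cong') (auto simp: a')
    finally have "\<beta> b (br x (dual b)) = \<beta> b (\<Oplus>\<^bsub>g\<^esub>b'\<in>B. (- a b' b) \<odot>\<^bsub>g\<^esub> dual b')" by simp
    also have "\<dots> = (\<Oplus>\<^bsub>W\<^esub>b'\<in>B. \<beta> b ((- a b' b) \<odot>\<^bsub>g\<^esub> dual b'))"
      using b by (intro mod_hom_finsum[OF right g W]) auto
    also have "\<dots> = (\<Oplus>\<^bsub>W\<^esub>b'\<in>B. (- a b' b) \<odot>\<^bsub>W\<^esub> \<beta> b (dual b'))"
      using b by (intro W.finsum_cong') (auto simp: mod_homD(3)[OF right] bc sc)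
    finally show ?thesis .
  qed
  then have "(\<Oplus>\<^bsub>W\<^esub>b\<in>B. \<beta> b (br x (dual b))) = (\<Oplus>\<^bsub>W\<^esub>b\<in>B. \<Oplus>\<^bsub>W\<^esub>b'\<in>B. (- a b' b) \<odot>\<^bsub>W\<^esub> \<beta> b (dual b'))"
    by (intro W.finsum_cong') (auto intro!: W.finsum_closed simp: bc sc)
  also have "\<dots> = (\<Oplus>\<^bsub>W\<^esub>b'\<in>B. \<Oplus>\<^bsub>W\<^esub>b\<in>B. (- a b' b) \<odot>\<^bsub>W\<^esub> \<beta> b (dual b'))"
    by (intro W.finsum_swap) (auto simp: bc sc)
  finally have 2: "(\<Oplus>\<^bsub>W\<^esub>b\<in>B. \<beta> b (br x (dual b))) = (\<Oplus>\<^bsub>W\<^esub>b'\<in>B. \<Oplus>\<^bsub>W\<^esub>b\<in>B. (- a b' b) \<odot>\<^bsub>W\<^esub> \<beta> b (dual b'))" .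
  have cancel: "c \<odot>\<^bsub>W\<^esub> u \<oplus>\<^bsub>W\<^esub> (- c) \<odot>\<^bsub>W\<^esub> u = \<zero>\<^bsub>W\<^esub>" if "u \<in> carrier W" for c u
    using W.smult_l_distr[of c "- c" u] W.smult_l_null[of u] that by simp
  have "(\<Oplus>\<^bsub>W\<^esub>b\<in>B. \<beta> (br x b) (dual b)) \<oplus>\<^bsub>W\<^esub> (\<Oplus>\<^bsub>W\<^esub>b\<in>B. \<beta> b (br x (dual b))) =
      (\<Oplus>\<^bsub>W\<^esub>b\<in>B. (\<Oplus>\<^bsub>W\<^esub>b'\<in>B. a b b' \<odot>\<^bsub>W\<^esub> \<beta> b' (dual b)) \<oplus>\<^bsub>W\<^esub> (\<Oplus>\<^bsub>W\<^esub>b'\<in>B. (- a b b') \<odot>\<^bsub>W\<^esub> \<beta> b' (dual b)))"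
    unfolding 1 2 by (intro W.finsum_addf[symmetric]) (auto intro!: W.finsum_closed simp: bc sc)
  also have "\<dots> = (\<Oplus>\<^bsub>W\<^esub>b\<in>B. \<Oplus>\<^bsub>W\<^esub>b'\<in>B. a b b' \<odot>\<^bsub>W\<^esub> \<beta> b' (dual b) \<oplus>\<^bsub>W\<^esub> (- a b b') \<odot>\<^bsub>W\<^esub> \<beta> b' (dual b))"
    by (intro W.finsum_cong' refl W.finsum_addf[symmetric]) (auto intro!: W.finsum_closed simp: bc sc)
  also have "\<dots> = (\<Oplus>\<^bsub>W\<^esub>b\<in>B. \<Oplus>\<^bsub>W\<^esub>b'\<in>B. \<zero>\<^bsub>W\<^esub>)"
    by (intro W.finsum_cong' refl) (auto simp: cancel bc)
  also have "\<dots> = \<zero>\<^bsub>W\<^esub>" by simp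
  finally show ?thesis .
qed

text \<open>
  The coefficients of \<open>b\<^sup>*\<close> in the basis are the values \<open>\<langle>b\<^sup>*, b'\<^sup>*\<rangle>\<close> of the form, which are symmetric in
  \<open>b\<close> and \<open>b'\<close>.
\<close>

lemma contraction_symmetric:
  assumes W: "module CC W"
    and left: "\<And>y. y \<in> carrier g \<Longrightarrow> (\<lambda>x. \<beta> x y) \<in> mod_hom CC g W"
    and right: "\<And>x. x \<in> carrier g \<Longrightarrow> \<beta> x \<in> mod_hom CC g W"
  shows "(\<Oplus>\<^bsub>W\<^esub>b\<in>B. \<beta> b (dual b)) = (\<Oplus>\<^bsub>W\<^esub>b\<in>B. \<beta> (dual b) b)"
proof -
  interpret W: module CC W by (rule W)
  have g: "module CC g" by (rule module_axioms)
  define a where "a b b' = form (dual b) (dual b')" for b b'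
  have bc: "\<beta> y z \<in> carrier W" if "y \<in> carrier g" "z \<in> carrier g" for y z
    using mod_homD(1)[OF right] that by auto
  have sc: "c \<odot>\<^bsub>W\<^esub> u \<in> carrier W" if "u \<in> carrier W" for c u
    using W.smult_closed[of c u] that by simp
  have dual_eq: "dual b = (\<Oplus>\<^bsub>g\<^esub>b'\<in>B. a b b' \<odot>\<^bsub>g\<^esub> b')" if b: "b \<in> B" for b
    using basis_expansion[OF dual_closed[OF b]] unfolding a_def .
  have "\<beta> b (dual b) = (\<Oplus>\<^bsub>W\<^esub>b'\<in>B. a b b' \<odot>\<^bsub>W\<^esub> \<beta> b b')" if b: "b \<in> B" for b
  proof -
    have "\<beta> b (dual b) = \<beta> b (\<Oplus>\<^bsub>g\<^esub>b'\<in>B. a b b' \<odot>\<^bsub>g\<^esub> b')" using dual_eq[OF b] by simp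
    also have "\<dots> = (\<Oplus>\<^bsub>W\<^esub>b'\<in>B. \<beta> b (a b b' \<odot>\<^bsub>g\<^esub> b'))"
      using b by (intro mod_hom_finsum[OF right g W]) auto
    also have "\<dots> = (\<Oplus>\<^bsub>W\<^esub>b'\<in>B. a b b' \<odot>\<^bsub>W\<^esub> \<beta> b b')"
      using b by (intro W.finsum_cong') (auto simp: mod_homD(3)[OF right] bc sc)
    finally show ?thesis .
  qed
  then have "(\<Oplus>\<^bsub>W\<^esub>b\<in>B. \<beta> b (dual b)) = (\<Oplus>\<^bsub>W\<^esub>b\<in>B. \<Oplus>\<^bsub>W\<^esub>b'\<in>B. a b b' \<odot>\<^bsub>W\<^esub> \<beta> b b')"
    by (intro W.finsum_cong') (auto intro!: W.finsum_closed simp: bc sc)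
  also have "\<dots> = (\<Oplus>\<^bsub>W\<^esub>b'\<in>B. \<Oplus>\<^bsub>W\<^esub>b\<in>B. a b b' \<odot>\<^bsub>W\<^esub> \<beta> b b')"
    by (intro W.finsum_swap) (auto simp: bc sc)
  also have "\<dots> = (\<Oplus>\<^bsub>W\<^esub>b\<in>B. \<beta> (dual b) b)"
  proof (intro W.finsum_cong' refl)
    fix b assume b: "b \<in> B"
    have "\<beta> (dual b) b = \<beta> (\<Oplus>\<^bsub>g\<^esub>b'\<in>B. a b b' \<odot>\<^bsub>g\<^esub> b') b" using dual_eq[OF b] by simp
    also have "\<dots> = (\<Oplus>\<^bsub>W\<^esub>b'\<in>B. \<beta> (a b b' \<odot>\<^bsub>g\<^esub> b') b)"
      using b by (intro mod_hom_finsum[OF left g W]) auto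
    also have "\<dots> = (\<Oplus>\<^bsub>W\<^esub>b'\<in>B. a b' b \<odot>\<^bsub>W\<^esub> \<beta> b' b)"
      using b by (intro W.finsum_cong')
        (auto simp: mod_homD(3)[OF left] bc sc a_def form_sym[of "dual b"])
    finally show "(\<Oplus>\<^bsub>W\<^esub>b'\<in>B. a b' b \<odot>\<^bsub>W\<^esub> \<beta> b' b) = \<beta> (dual b) b" by simp
  qed (auto simp: bc)
  finally show ?thesis .
qed

end

section \<open>Contractions in an associative algebra\<close>

text \<open>
  A ring \<open>A\<close> that is a complex algebra through the central ring homomorphism \<open>\<sigma>\<close>. It will be the
  enveloping algebra, where the Casimir element is shown to be central, or an endomorphism ring.
\<close>

locale casimir_ring = quadratic_lie_algebra g br form B dual + A: ring A
  for g :: "(complex, 'g) module" and br form B dual and A :: "('a, 'e) ring_scheme" +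
  fixes \<sigma> :: "complex \<Rightarrow> 'a"
  assumes \<sigma>: "\<sigma> \<in> ring_hom CC A"
    and \<sigma>_central: "a \<in> carrier A \<Longrightarrow> \<sigma> c \<otimes>\<^bsub>A\<^esub> a = a \<otimes>\<^bsub>A\<^esub> \<sigma> c"
begin

lemma \<sigma>_closed [simp]: "\<sigma> c \<in> carrier A"
  using ring_hom_closed[OF \<sigma>] by simp

definition lin :: "('g \<Rightarrow> 'a) \<Rightarrow> bool"
  where "lin r \<longleftrightarrow> r \<in> mod_hom CC g (scalar_module \<sigma> A)"

lemma linI:
  assumes "\<And>x. x \<in> carrier g \<Longrightarrow> r x \<in> carrier A"
    and "\<And>x y. \<lbrakk>x \<in> carrier g; y \<in> carrier g\<rbrakk> \<Longrightarrow> r (x \<oplus>\<^bsub>g\<^esub> y) = r x \<oplus>\<^bsub>A\<^esub> r y"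
    and "\<And>c x. x \<in> carrier g \<Longrightarrow> r (c \<odot>\<^bsub>g\<^esub> x) = \<sigma> c \<otimes>\<^bsub>A\<^esub> r x"
  shows "lin r"
  unfolding lin_def using assms by (intro mod_homI) auto

lemma linD:
  assumes "lin r"
  shows "x \<in> carrier g \<Longrightarrow> r x \<in> carrier A"
    and "\<lbrakk>x \<in> carrier g; y \<in> carrier g\<rbrakk> \<Longrightarrow> r (x \<oplus>\<^bsub>g\<^esub> y) = r x \<oplus>\<^bsub>A\<^esub> r y"
    and "x \<in> carrier g \<Longrightarrow> r (c \<odot>\<^bsub>g\<^esub> x) = \<sigma> c \<otimes>\<^bsub>A\<^esub> r x"
  using mod_homD[of r CC g "scalar_module \<sigma> A"] assms unfolding lin_def by auto

definition \<Gamma> :: "('g \<Rightarrow> 'a) \<Rightarrow> ('g \<Rightarrow> 'a) \<Rightarrow> 'a"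
  where "\<Gamma> r s = (\<Oplus>\<^bsub>A\<^esub>b\<in>B. r b \<otimes>\<^bsub>A\<^esub> s (dual b))"

lemma \<Gamma>_closed [simp]: "\<lbrakk>lin r; lin s\<rbrakk> \<Longrightarrow> \<Gamma> r s \<in> carrier A"
  unfolding \<Gamma>_def using linD(1) by (intro A.finsum_closed) auto

lemma product_bilinear:
  assumes r: "lin r" and s: "lin s"
  shows "y \<in> carrier g \<Longrightarrow> (\<lambda>x. r x \<otimes>\<^bsub>A\<^esub> s y) \<in> mod_hom CC g (scalar_module \<sigma> A)"
    and "x \<in> carrier g \<Longrightarrow> (\<lambda>y. r x \<otimes>\<^bsub>A\<^esub> s y) \<in> mod_hom CC g (scalar_module \<sigma> A)"
proof -
  note rc = linD(1)[OF r] and sc = linD(1)[OF s]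
  show "(\<lambda>x. r x \<otimes>\<^bsub>A\<^esub> s y) \<in> mod_hom CC g (scalar_module \<sigma> A)" if "y \<in> carrier g"
    using that by (intro mod_homI) (auto simp: rc sc linD(2,3)[OF r] A.l_distr A.m_assoc)
  have "r x \<otimes>\<^bsub>A\<^esub> (\<sigma> c \<otimes>\<^bsub>A\<^esub> s y) = \<sigma> c \<otimes>\<^bsub>A\<^esub> (r x \<otimes>\<^bsub>A\<^esub> s y)"
    if "x \<in> carrier g" "y \<in> carrier g" for c x y
  proof -
    have "r x \<otimes>\<^bsub>A\<^esub> (\<sigma> c \<otimes>\<^bsub>A\<^esub> s y) = (r x \<otimes>\<^bsub>A\<^esub> \<sigma> c) \<otimes>\<^bsub>A\<^esub> s y"
      using that by (simp add: rc sc A.m_assoc)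
    also have "\<dots> = (\<sigma> c \<otimes>\<^bsub>A\<^esub> r x) \<otimes>\<^bsub>A\<^esub> s y" using that by (simp add: rc \<sigma>_central)
    finally show ?thesis using that by (simp add: rc sc A.m_assoc)
  qed
  then show "(\<lambda>y. r x \<otimes>\<^bsub>A\<^esub> s y) \<in> mod_hom CC g (scalar_module \<sigma> A)" if "x \<in> carrier g"
    using that by (intro mod_homI) (auto simp: rc sc linD(2,3)[OF s] A.r_distr)
qed

lemma A_module: "module CC (scalar_module \<sigma> A)"
  by (rule scalar_module_is_module[OF CC_cring A.ring_axioms \<sigma>])

lemma \<Gamma>_sym:
  assumes r: "lin r" and s: "lin s"
    and com: "\<And>x y. \<lbrakk>x \<in> carrier g; y \<in> carrier g\<rbrakk> \<Longrightarrow> r x \<otimes>\<^bsub>A\<^esub> s y = s y \<otimes>\<^bsub>A\<^esub> r x"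
  shows "\<Gamma> r s = \<Gamma> s r"
proof -
  have "\<Gamma> r s = (\<Oplus>\<^bsub>A\<^esub>b\<in>B. r (dual b) \<otimes>\<^bsub>A\<^esub> s b)"
    using contraction_symmetric[OF A_module product_bilinear[OF r s]] unfolding \<Gamma>_def by simp
  also have "\<dots> = \<Gamma> s r" unfolding \<Gamma>_def
    by (intro A.finsum_cong') (auto simp: com linD(1)[OF r] linD(1)[OF s])
  finally show ?thesis .
qed

text \<open>
  By the hypotheses the commutator with \<open>a\<close> is a derivation that acts on the values of \<open>r\<close> and \<open>s\<close> as
  \<open>[x, -]\<close> does on their arguments. It therefore maps \<open>\<Gamma> r s\<close> to the image of \<open>x \<cdot> \<Sum>\<^sub>b b \<otimes> b\<^sup>*\<close>, which
  is zero.
\<close>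

lemma \<Gamma>_invariant:
  assumes r: "lin r" and s: "lin s" and a: "a \<in> carrier A" and x: "x \<in> carrier g"
    and ar: "\<And>y. y \<in> carrier g \<Longrightarrow> a \<otimes>\<^bsub>A\<^esub> r y = r y \<otimes>\<^bsub>A\<^esub> a \<oplus>\<^bsub>A\<^esub> r (br x y)"
    and as: "\<And>y. y \<in> carrier g \<Longrightarrow> a \<otimes>\<^bsub>A\<^esub> s y = s y \<otimes>\<^bsub>A\<^esub> a \<oplus>\<^bsub>A\<^esub> s (br x y)"
  shows "a \<otimes>\<^bsub>A\<^esub> \<Gamma> r s = \<Gamma> r s \<otimes>\<^bsub>A\<^esub> a"
proof -
  note rc = linD(1)[OF r] and sc = linD(1)[OF s] and bc = br_closed[OF x]
  have step: "a \<otimes>\<^bsub>A\<^esub> (r y \<otimes>\<^bsub>A\<^esub> s z) =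
      (r y \<otimes>\<^bsub>A\<^esub> s z) \<otimes>\<^bsub>A\<^esub> a \<oplus>\<^bsub>A\<^esub> (r (br x y) \<otimes>\<^bsub>A\<^esub> s z \<oplus>\<^bsub>A\<^esub> r y \<otimes>\<^bsub>A\<^esub> s (br x z))"
    if y: "y \<in> carrier g" and z: "z \<in> carrier g" for y z
  proof -
    have "a \<otimes>\<^bsub>A\<^esub> (r y \<otimes>\<^bsub>A\<^esub> s z) = (a \<otimes>\<^bsub>A\<^esub> r y) \<otimes>\<^bsub>A\<^esub> s z"
      using a y z by (simp add: rc sc A.m_assoc)
    also have "\<dots> = r y \<otimes>\<^bsub>A\<^esub> (a \<otimes>\<^bsub>A\<^esub> s z) \<oplus>\<^bsub>A\<^esub> r (br x y) \<otimes>\<^bsub>A\<^esub> s z"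
      using a y z by (simp add: rc sc bc ar A.m_assoc A.l_distr)
    also have "\<dots> = (r y \<otimes>\<^bsub>A\<^esub> s z) \<otimes>\<^bsub>A\<^esub> a \<oplus>\<^bsub>A\<^esub> (r (br x y) \<otimes>\<^bsub>A\<^esub> s z \<oplus>\<^bsub>A\<^esub> r y \<otimes>\<^bsub>A\<^esub> s (br x z))"
      using a y z by (simp add: rc sc bc as A.m_assoc A.r_distr A.a_ac)
    finally show ?thesis .
  qed
  have "a \<otimes>\<^bsub>A\<^esub> \<Gamma> r s = (\<Oplus>\<^bsub>A\<^esub>b\<in>B. a \<otimes>\<^bsub>A\<^esub> (r b \<otimes>\<^bsub>A\<^esub> s (dual b)))"
    unfolding \<Gamma>_def using a by (intro A.finsum_rdistr) (auto simp: rc sc)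
  also have "\<dots> = (\<Oplus>\<^bsub>A\<^esub>b\<in>B. (r b \<otimes>\<^bsub>A\<^esub> s (dual b)) \<otimes>\<^bsub>A\<^esub> a \<oplus>\<^bsub>A\<^esub>
      (r (br x b) \<otimes>\<^bsub>A\<^esub> s (dual b) \<oplus>\<^bsub>A\<^esub> r b \<otimes>\<^bsub>A\<^esub> s (br x (dual b))))"
    using a by (intro A.finsum_cong') (auto simp: step rc sc bc)
  also have "\<dots> = (\<Oplus>\<^bsub>A\<^esub>b\<in>B. (r b \<otimes>\<^bsub>A\<^esub> s (dual b)) \<otimes>\<^bsub>A\<^esub> a) \<oplus>\<^bsub>A\<^esub>
      (\<Oplus>\<^bsub>A\<^esub>b\<in>B. r (br x b) \<otimes>\<^bsub>A\<^esub> s (dual b) \<oplus>\<^bsub>A\<^esub> r b \<otimes>\<^bsub>A\<^esub> s (br x (dual b)))"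
    using a by (intro A.finsum_addf) (auto simp: rc sc bc)
  also have "(\<Oplus>\<^bsub>A\<^esub>b\<in>B. r (br x b) \<otimes>\<^bsub>A\<^esub> s (dual b) \<oplus>\<^bsub>A\<^esub> r b \<otimes>\<^bsub>A\<^esub> s (br x (dual b))) =
      (\<Oplus>\<^bsub>A\<^esub>b\<in>B. r (br x b) \<otimes>\<^bsub>A\<^esub> s (dual b)) \<oplus>\<^bsub>A\<^esub> (\<Oplus>\<^bsub>A\<^esub>b\<in>B. r b \<otimes>\<^bsub>A\<^esub> s (br x (dual b)))"
    by (intro A.finsum_addf) (auto simp: rc sc bc)
  also have "\<dots> = \<zero>\<^bsub>A\<^esub>"
    using contraction_invariant[OF A_module product_bilinear[OF r s] x] by simp
  also have "(\<Oplus>\<^bsub>A\<^esub>b\<in>B. (r b \<otimes>\<^bsub>A\<^esub> s (dual b)) \<otimes>\<^bsub>A\<^esub> a) = \<Gamma> r s \<otimes>\<^bsub>A\<^esub> a"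
    unfolding \<Gamma>_def using a by (intro A.finsum_ldistr[symmetric]) (auto simp: rc sc)
  finally show ?thesis using a r s by simp
qed

text \<open>
  For \<open>a\<close> a permutation operator this moves \<open>\<gamma>\<close> to other tensor factors; for \<open>r' = r\<close> and \<open>s' = s\<close> it is
  a criterion for commuting with \<open>\<Gamma> r s\<close>.
\<close>

lemma \<Gamma>_intertwine:
  assumes lin: "lin r" "lin s" "lin r'" "lin s'" and a: "a \<in> carrier A"
    and ar: "\<And>y. y \<in> carrier g \<Longrightarrow> a \<otimes>\<^bsub>A\<^esub> r y = r' y \<otimes>\<^bsub>A\<^esub> a"
    and as: "\<And>y. y \<in> carrier g \<Longrightarrow> a \<otimes>\<^bsub>A\<^esub> s y = s' y \<otimes>\<^bsub>A\<^esub> a"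
  shows "a \<otimes>\<^bsub>A\<^esub> \<Gamma> r s = \<Gamma> r' s' \<otimes>\<^bsub>A\<^esub> a"
proof -
  note c = lin[THEN linD(1)]
  have step: "a \<otimes>\<^bsub>A\<^esub> (r y \<otimes>\<^bsub>A\<^esub> s z) = (r' y \<otimes>\<^bsub>A\<^esub> s' z) \<otimes>\<^bsub>A\<^esub> a"
    if y: "y \<in> carrier g" and z: "z \<in> carrier g" for y z
  proof -
    have "a \<otimes>\<^bsub>A\<^esub> (r y \<otimes>\<^bsub>A\<^esub> s z) = (a \<otimes>\<^bsub>A\<^esub> r y) \<otimes>\<^bsub>A\<^esub> s z"
      using a y z by (simp add: c A.m_assoc)
    also have "\<dots> = r' y \<otimes>\<^bsub>A\<^esub> (a \<otimes>\<^bsub>A\<^esub> s z)" using a y z by (simp add: c ar A.m_assoc)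
    finally show ?thesis using a y z by (simp add: c as A.m_assoc)
  qed
  have "a \<otimes>\<^bsub>A\<^esub> \<Gamma> r s = (\<Oplus>\<^bsub>A\<^esub>b\<in>B. a \<otimes>\<^bsub>A\<^esub> (r b \<otimes>\<^bsub>A\<^esub> s (dual b)))"
    unfolding \<Gamma>_def using a by (intro A.finsum_rdistr) (auto simp: c)
  also have "\<dots> = (\<Oplus>\<^bsub>A\<^esub>b\<in>B. (r' b \<otimes>\<^bsub>A\<^esub> s' (dual b)) \<otimes>\<^bsub>A\<^esub> a)"
    using a by (intro A.finsum_cong') (auto simp: step c)
  also have "\<dots> = \<Gamma> r' s' \<otimes>\<^bsub>A\<^esub> a"
    unfolding \<Gamma>_def using a by (intro A.finsum_ldistr[symmetric]) (auto simp: c)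
  finally show ?thesis .
qed

lemmas \<Gamma>_commute = \<Gamma>_intertwine[where r = r and r' = r and s = s and s' = s for r s]

lemma lin_add: "\<lbrakk>lin r; lin s\<rbrakk> \<Longrightarrow> lin (\<lambda>x. r x \<oplus>\<^bsub>A\<^esub> s x)"
  by (rule linI) (auto simp: linD A.r_distr A.a_ac)

lemma lin_zero: "lin (\<lambda>x. \<zero>\<^bsub>A\<^esub>)"
  by (rule linI) auto

lemma \<Gamma>_add_left:
  assumes "lin r" "lin r'" "lin s"
  shows "\<Gamma> (\<lambda>x. r x \<oplus>\<^bsub>A\<^esub> r' x) s = \<Gamma> r s \<oplus>\<^bsub>A\<^esub> \<Gamma> r' s"
proof -
  have "\<Gamma> (\<lambda>x. r x \<oplus>\<^bsub>A\<^esub> r' x) s = (\<Oplus>\<^bsub>A\<^esub>b\<in>B. r b \<otimes>\<^bsub>A\<^esub> s (dual b) \<oplus>\<^bsub>A\<^esub> r' b \<otimes>\<^bsub>A\<^esub> s (dual b))"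
    unfolding \<Gamma>_def by (intro A.finsum_cong') (auto simp: assms[THEN linD(1)] A.l_distr)
  also have "\<dots> = \<Gamma> r s \<oplus>\<^bsub>A\<^esub> \<Gamma> r' s"
    unfolding \<Gamma>_def by (intro A.finsum_addf) (auto simp: assms[THEN linD(1)])
  finally show ?thesis .
qed

lemma \<Gamma>_add_right:
  assumes "lin r" "lin s" "lin s'"
  shows "\<Gamma> r (\<lambda>x. s x \<oplus>\<^bsub>A\<^esub> s' x) = \<Gamma> r s \<oplus>\<^bsub>A\<^esub> \<Gamma> r s'"
proof -
  have "\<Gamma> r (\<lambda>x. s x \<oplus>\<^bsub>A\<^esub> s' x) = (\<Oplus>\<^bsub>A\<^esub>b\<in>B. r b \<otimes>\<^bsub>A\<^esub> s (dual b) \<oplus>\<^bsub>A\<^esub> r b \<otimes>\<^bsub>A\<^esub> s' (dual b))"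
    unfolding \<Gamma>_def by (intro A.finsum_cong') (auto simp: assms[THEN linD(1)] A.r_distr)
  also have "\<dots> = \<Gamma> r s \<oplus>\<^bsub>A\<^esub> \<Gamma> r s'"
    unfolding \<Gamma>_def by (intro A.finsum_addf) (auto simp: assms[THEN linD(1)])
  finally show ?thesis .
qed

lemma \<Gamma>_zero_left: "lin s \<Longrightarrow> \<Gamma> (\<lambda>x. \<zero>\<^bsub>A\<^esub>) s = \<zero>\<^bsub>A\<^esub>"
proof -
  assume s: "lin s"
  have "\<Gamma> (\<lambda>x. \<zero>\<^bsub>A\<^esub>) s = (\<Oplus>\<^bsub>A\<^esub>b\<in>B. \<zero>\<^bsub>A\<^esub>)"
    unfolding \<Gamma>_def by (intro A.finsum_cong') (auto simp: linD(1)[OF s])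
  then show ?thesis by simp
qed

lemma \<Gamma>_zero_right: "lin r \<Longrightarrow> \<Gamma> r (\<lambda>x. \<zero>\<^bsub>A\<^esub>) = \<zero>\<^bsub>A\<^esub>"
proof -
  assume r: "lin r"
  have "\<Gamma> r (\<lambda>x. \<zero>\<^bsub>A\<^esub>) = (\<Oplus>\<^bsub>A\<^esub>b\<in>B. \<zero>\<^bsub>A\<^esub>)"
    unfolding \<Gamma>_def by (intro A.finsum_cong') (auto simp: linD(1)[OF r])
  then show ?thesis by simp
qed

text \<open>
  The bracket condition is written as a commutation rule, without subtraction, which is the form required
  by \<open>\<Gamma>_invariant\<close>.
\<close>

definition lie_hom :: "('g \<Rightarrow> 'a) \<Rightarrow> bool"
  where "lie_hom r \<longleftrightarrow> lin r \<and> (\<forall>x \<in> carrier g. \<forall>y \<in> carrier g.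
    r x \<otimes>\<^bsub>A\<^esub> r y = r y \<otimes>\<^bsub>A\<^esub> r x \<oplus>\<^bsub>A\<^esub> r (br x y))"

lemma casimir_commutes:
  assumes "lie_hom r" and "x \<in> carrier g"
  shows "r x \<otimes>\<^bsub>A\<^esub> \<Gamma> r r = \<Gamma> r r \<otimes>\<^bsub>A\<^esub> r x"
proof (rule \<Gamma>_invariant[OF _ _ _ assms(2)])
  show "lin r" "lin r" using assms(1) unfolding lie_hom_def by blast+
  then show "r x \<in> carrier A" using assms(2) by (intro linD(1))
qed (use assms in \<open>unfold lie_hom_def, blast+\<close>)

end

section \<open>The braid relations\<close>

lemma (in ring) add_pow_two: "a \<in> carrier R \<Longrightarrow> add_pow R (2::nat) a = a \<oplus> a"
  by (simp add: numeral_2_eq_2 add_pow_def)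

lemma permutes_atMost: "\<lbrakk>w permutes {1..k}; p \<le> k\<rbrakk> \<Longrightarrow> w p \<le> (k::nat)"
  using permutes_in_image[of w "{1..k}" p] permutes_not_in[of w "{1..k}" p]
  by (cases "p = 0") auto

lemma adj_transp_permutes: "\<lbrakk>1 \<le> i; i < k\<rbrakk> \<Longrightarrow> adj_transp i permutes {1..k}"
  by (rule permutes_swap_id) auto

text \<open>
  The properties of the operators on the tensor space from which all relations follow: \<open>k + 1\<close> commuting
  images of the Lie algebra that are permuted by a copy of the symmetric group.
\<close>

locale braid_family = casimir_ring g br form B dual A \<sigma>
  for g :: "(complex, 'g) module" and br form B dual and A :: "('a, 'e) ring_scheme" and \<sigma> +
  fixes k :: nat and \<rho> :: "nat \<Rightarrow> 'g \<Rightarrow> 'a" and t :: "(nat \<Rightarrow> nat) \<Rightarrow> 'a"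
  assumes \<rho>_hom: "p \<le> k \<Longrightarrow> lie_hom (\<rho> p)"
    and \<rho>_commute: "\<lbrakk>p \<le> k; q \<le> k; p \<noteq> q; x \<in> carrier g; y \<in> carrier g\<rbrakk>
      \<Longrightarrow> \<rho> p x \<otimes>\<^bsub>A\<^esub> \<rho> q y = \<rho> q y \<otimes>\<^bsub>A\<^esub> \<rho> p x"
    and t_closed [simp]: "w permutes {1..k} \<Longrightarrow> t w \<in> carrier A"
    and t_id: "t id = \<one>\<^bsub>A\<^esub>"
    and t_mult: "\<lbrakk>u permutes {1..k}; v permutes {1..k}\<rbrakk> \<Longrightarrow> t u \<otimes>\<^bsub>A\<^esub> t v = t (u \<circ> v)"
    and t_\<rho>: "\<lbrakk>w permutes {1..k}; p \<le> k; x \<in> carrier g\<rbrakk>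
      \<Longrightarrow> t w \<otimes>\<^bsub>A\<^esub> \<rho> p x = \<rho> (w p) x \<otimes>\<^bsub>A\<^esub> t w"
begin

lemma \<rho>_lin [simp]: "p \<le> k \<Longrightarrow> lin (\<rho> p)"
  using \<rho>_hom unfolding lie_hom_def by blast

lemma \<rho>_closed [simp]: "\<lbrakk>p \<le> k; x \<in> carrier g\<rbrakk> \<Longrightarrow> \<rho> p x \<in> carrier A"
  by (rule linD(1)[OF \<rho>_lin])

lemma \<rho>_br: "\<lbrakk>p \<le> k; x \<in> carrier g; y \<in> carrier g\<rbrakk>
    \<Longrightarrow> \<rho> p x \<otimes>\<^bsub>A\<^esub> \<rho> p y = \<rho> p y \<otimes>\<^bsub>A\<^esub> \<rho> p x \<oplus>\<^bsub>A\<^esub> \<rho> p (br x y)"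
  using \<rho>_hom unfolding lie_hom_def by blast

text \<open>The image of \<open>\<gamma>\<^sub>p\<^sub>q\<close>, or of \<open>\<kappa>\<^sub>p\<close> if \<open>p = q\<close>.\<close>

definition gam :: "nat \<Rightarrow> nat \<Rightarrow> 'a"
  where "gam p q = \<Gamma> (\<rho> p) (\<rho> q)"

lemma gam_closed [simp]: "\<lbrakk>p \<le> k; q \<le> k\<rbrakk> \<Longrightarrow> gam p q \<in> carrier A"
  unfolding gam_def by simp

lemma gam_sym: "\<lbrakk>p \<le> k; q \<le> k\<rbrakk> \<Longrightarrow> gam p q = gam q p"
  unfolding gam_def by (cases "p = q") (auto intro!: \<Gamma>_sym \<rho>_commute)

lemma t_gam: "\<lbrakk>w permutes {1..k}; p \<le> k; q \<le> k\<rbrakk>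
    \<Longrightarrow> t w \<otimes>\<^bsub>A\<^esub> gam p q = gam (w p) (w q) \<otimes>\<^bsub>A\<^esub> t w"
  unfolding gam_def by (intro \<Gamma>_intertwine) (auto simp: t_\<rho> permutes_atMost)

lemma t_inverse: "w permutes {1..k} \<Longrightarrow> t w \<otimes>\<^bsub>A\<^esub> t (inv_into UNIV w) = \<one>\<^bsub>A\<^esub>"
  using t_mult[of w "inv_into UNIV w"] permutes_inv[of w] t_id
  by (simp add: permutes_inv_o)

lemma t_gam_conj: "\<lbrakk>w permutes {1..k}; p \<le> k; q \<le> k\<rbrakk>
    \<Longrightarrow> t w \<otimes>\<^bsub>A\<^esub> gam p q \<otimes>\<^bsub>A\<^esub> t (inv_into UNIV w) = gam (w p) (w q)"
  using permutes_inv[of w "{1..k}"] t_inverse[of w]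
  by (simp add: t_gam A.m_assoc permutes_atMost)

lemma \<rho>_gam_other: "\<lbrakk>l \<le> k; p \<le> k; q \<le> k; l \<noteq> p; l \<noteq> q; x \<in> carrier g\<rbrakk>
    \<Longrightarrow> \<rho> l x \<otimes>\<^bsub>A\<^esub> gam p q = gam p q \<otimes>\<^bsub>A\<^esub> \<rho> l x"
  unfolding gam_def by (intro \<Gamma>_commute) (auto simp: \<rho>_commute)

lemma \<rho>_kappa: "\<lbrakk>l \<le> k; p \<le> k; x \<in> carrier g\<rbrakk>
    \<Longrightarrow> \<rho> l x \<otimes>\<^bsub>A\<^esub> gam p p = gam p p \<otimes>\<^bsub>A\<^esub> \<rho> l x"
  using \<rho>_gam_other[of l p p x] casimir_commutes[OF \<rho>_hom, of p x] unfolding gam_def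
  by (cases "l = p") auto

lemma commute_gam:
  assumes "a \<in> carrier A" "p \<le> k" "q \<le> k"
    and "\<And>x. x \<in> carrier g \<Longrightarrow> a \<otimes>\<^bsub>A\<^esub> \<rho> p x = \<rho> p x \<otimes>\<^bsub>A\<^esub> a"
    and "\<And>x. x \<in> carrier g \<Longrightarrow> a \<otimes>\<^bsub>A\<^esub> \<rho> q x = \<rho> q x \<otimes>\<^bsub>A\<^esub> a"
  shows "a \<otimes>\<^bsub>A\<^esub> gam p q = gam p q \<otimes>\<^bsub>A\<^esub> a"
  unfolding gam_def using assms by (intro \<Gamma>_commute) auto

lemma kappa_gam: "\<lbrakk>i \<le> k; p \<le> k; q \<le> k\<rbrakk>
    \<Longrightarrow> gam i i \<otimes>\<^bsub>A\<^esub> gam p q = gam p q \<otimes>\<^bsub>A\<^esub> gam i i"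
  by (rule commute_gam) (auto simp: \<rho>_kappa)

lemma gam_gam: "\<lbrakk>p \<le> k; r \<le> k; l \<le> k; m \<le> k; p \<noteq> l; p \<noteq> m; r \<noteq> l; r \<noteq> m\<rbrakk>
    \<Longrightarrow> gam p r \<otimes>\<^bsub>A\<^esub> gam l m = gam l m \<otimes>\<^bsub>A\<^esub> gam p r"
  by (rule commute_gam) (auto simp: \<rho>_gam_other)

text \<open>
  The element \<open>\<rho>\<^sub>i x + \<rho>\<^sub>j x\<close> brackets with the images of \<open>\<rho>\<^sub>i\<close> and of \<open>\<rho>\<^sub>j\<close> as \<open>x\<close> does, so it commutes
  with \<open>\<gamma>\<^sub>i\<^sub>j\<close>; and \<open>\<gamma>\<^sub>i\<^sub>r + \<gamma>\<^sub>j\<^sub>r\<close> is the contraction of \<open>\<rho>\<^sub>i + \<rho>\<^sub>j\<close> with \<open>\<rho>\<^sub>r\<close>.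
\<close>

lemma gam_four_term:
  assumes ijr: "i \<le> k" "j \<le> k" "r \<le> k" "i \<noteq> j" "i \<noteq> r" "j \<noteq> r"
  shows "gam i j \<otimes>\<^bsub>A\<^esub> (gam i r \<oplus>\<^bsub>A\<^esub> gam j r) = (gam i r \<oplus>\<^bsub>A\<^esub> gam j r) \<otimes>\<^bsub>A\<^esub> gam i j"
proof -
  have "(\<rho> i x \<oplus>\<^bsub>A\<^esub> \<rho> j x) \<otimes>\<^bsub>A\<^esub> gam i j = gam i j \<otimes>\<^bsub>A\<^esub> (\<rho> i x \<oplus>\<^bsub>A\<^esub> \<rho> j x)"
    if x: "x \<in> carrier g" for x
    unfolding gam_def
  proof (rule \<Gamma>_invariant[OF _ _ _ x])
    fix y assume y: "y \<in> carrier g"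
    note c = br_closed[OF x y]
    show "(\<rho> i x \<oplus>\<^bsub>A\<^esub> \<rho> j x) \<otimes>\<^bsub>A\<^esub> \<rho> i y = \<rho> i y \<otimes>\<^bsub>A\<^esub> (\<rho> i x \<oplus>\<^bsub>A\<^esub> \<rho> j x) \<oplus>\<^bsub>A\<^esub> \<rho> i (br x y)"
      using ijr x y c
      by (simp add: A.l_distr A.r_distr \<rho>_br[OF _ x y] \<rho>_commute[of j i x y] A.a_ac)
    show "(\<rho> i x \<oplus>\<^bsub>A\<^esub> \<rho> j x) \<otimes>\<^bsub>A\<^esub> \<rho> j y = \<rho> j y \<otimes>\<^bsub>A\<^esub> (\<rho> i x \<oplus>\<^bsub>A\<^esub> \<rho> j x) \<oplus>\<^bsub>A\<^esub> \<rho> j (br x y)"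
      using ijr x y c
      by (simp add: A.l_distr A.r_distr \<rho>_br[OF _ x y] \<rho>_commute[of i j x y] A.a_ac)
  qed (use ijr x in auto)
  then have "gam i j \<otimes>\<^bsub>A\<^esub> \<Gamma> (\<lambda>x. \<rho> i x \<oplus>\<^bsub>A\<^esub> \<rho> j x) (\<rho> r) = \<Gamma> (\<lambda>x. \<rho> i x \<oplus>\<^bsub>A\<^esub> \<rho> j x) (\<rho> r) \<otimes>\<^bsub>A\<^esub> gam i j"
    using ijr by (intro \<Gamma>_commute) (auto intro!: lin_add simp: \<rho>_gam_other)
  moreover have "\<Gamma> (\<lambda>x. \<rho> i x \<oplus>\<^bsub>A\<^esub> \<rho> j x) (\<rho> r) = gam i r \<oplus>\<^bsub>A\<^esub> gam j r"
    unfolding gam_def using ijr by (intro \<Gamma>_add_left) auto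
  ultimately show ?thesis by simp
qed

text \<open>
  The action on the first \<open>n\<close> of the factors \<open>0, \<dots>, k\<close> through the coproduct. The bound is exclusive, so
  that \<open>Del j\<close> involves the factors before \<open>j\<close>, and the action on all factors is \<open>Del (Suc k)\<close>.
\<close>

definition Del :: "nat \<Rightarrow> 'g \<Rightarrow> 'a"
  where "Del n x = (\<Oplus>\<^bsub>A\<^esub>p\<in>{..<n}. \<rho> p x)"

lemma Del_0: "Del 0 = (\<lambda>x. \<zero>\<^bsub>A\<^esub>)"
  unfolding Del_def by (simp add: fun_eq_iff)

lemma Del_Suc: "\<lbrakk>n \<le> k; x \<in> carrier g\<rbrakk> \<Longrightarrow> Del (Suc n) x = Del n x \<oplus>\<^bsub>A\<^esub> \<rho> n x"
proof -
  assume n: "n \<le> k" and x: "x \<in> carrier g"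
  then have "(\<lambda>p. \<rho> p x) \<in> {..<n} \<rightarrow> carrier A" by auto
  moreover from this have "(\<Oplus>\<^bsub>A\<^esub>p\<in>{..<n}. \<rho> p x) \<in> carrier A" by (rule A.finsum_closed)
  ultimately show ?thesis unfolding Del_def lessThan_Suc using n x by (simp add: A.a_comm)
qed

lemma Del_closed [simp]: "\<lbrakk>n \<le> Suc k; x \<in> carrier g\<rbrakk> \<Longrightarrow> Del n x \<in> carrier A"
  unfolding Del_def by (intro A.finsum_closed) auto

lemma Del_lin [simp]: "n \<le> Suc k \<Longrightarrow> lin (Del n)"
proof (induction n)
  case 0
  then show ?case by (simp add: Del_0 lin_zero)
next
  case (Suc n)
  then have n: "n \<le> k" and l: "lin (Del n)" by auto
  show ?case
    using linD[OF lin_add[OF l \<rho>_lin[OF n]]] Suc.prems n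
    by (intro linI) (auto simp: Del_Suc)
qed

lemma \<Gamma>_Del_Suc_left:
  "\<lbrakk>n \<le> k; lin s\<rbrakk> \<Longrightarrow> \<Gamma> (Del (Suc n)) s = \<Gamma> (Del n) s \<oplus>\<^bsub>A\<^esub> \<Gamma> (\<rho> n) s"
  using \<Gamma>_add_left[of "Del n" "\<rho> n" s]
    A.finsum_cong'[of B B "\<lambda>b. (Del n b \<oplus>\<^bsub>A\<^esub> \<rho> n b) \<otimes>\<^bsub>A\<^esub> s (dual b)" "\<lambda>b. Del (Suc n) b \<otimes>\<^bsub>A\<^esub> s (dual b)"]
  unfolding \<Gamma>_def by (simp add: Del_Suc linD(1) Pi_def)

lemma \<Gamma>_Del_Suc_right:
  "\<lbrakk>n \<le> k; lin s\<rbrakk> \<Longrightarrow> \<Gamma> s (Del (Suc n)) = \<Gamma> s (Del n) \<oplus>\<^bsub>A\<^esub> \<Gamma> s (\<rho> n)"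
  using \<Gamma>_add_right[of s "Del n" "\<rho> n"]
    A.finsum_cong'[of B B "\<lambda>b. s b \<otimes>\<^bsub>A\<^esub> (Del n (dual b) \<oplus>\<^bsub>A\<^esub> \<rho> n (dual b))" "\<lambda>b. s b \<otimes>\<^bsub>A\<^esub> Del (Suc n) (dual b)"]
  unfolding \<Gamma>_def by (simp add: Del_Suc linD(1) Pi_def)

lemma commute_Del:
  assumes "a \<in> carrier A" "n \<le> Suc k"
    and "\<And>p. p < n \<Longrightarrow> a \<otimes>\<^bsub>A\<^esub> \<rho> p x = \<rho> p x \<otimes>\<^bsub>A\<^esub> a" and x: "x \<in> carrier g"
  shows "a \<otimes>\<^bsub>A\<^esub> Del n x = Del n x \<otimes>\<^bsub>A\<^esub> a"
  using assms(2,3)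
proof (induction n)
  case 0
  then show ?case using assms(1) by (simp add: Del_0)
next
  case (Suc n)
  then show ?case using assms(1) x by (simp add: Del_Suc A.l_distr A.r_distr)
qed

lemma Del_\<rho>_other:
  "\<lbrakk>n \<le> q; q \<le> k; x \<in> carrier g; y \<in> carrier g\<rbrakk> \<Longrightarrow> Del n x \<otimes>\<^bsub>A\<^esub> \<rho> q y = \<rho> q y \<otimes>\<^bsub>A\<^esub> Del n x"
  by (rule commute_Del[symmetric]) (auto simp: \<rho>_commute)

lemma Del_\<rho>:
  "\<lbrakk>q < n; n \<le> Suc k; x \<in> carrier g; y \<in> carrier g\<rbrakk>
    \<Longrightarrow> Del n x \<otimes>\<^bsub>A\<^esub> \<rho> q y = \<rho> q y \<otimes>\<^bsub>A\<^esub> Del n x \<oplus>\<^bsub>A\<^esub> \<rho> q (br x y)"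
proof (induction n)
  case (Suc n)
  note c = br_closed[OF Suc.prems(3,4)]
  show ?case
  proof (cases "q = n")
    case True
    then show ?thesis using Suc.prems c Del_\<rho>_other[of n n x y]
      by (simp add: Del_Suc A.l_distr A.r_distr \<rho>_br[of n x y] A.a_ac)
  next
    case False
    then show ?thesis using Suc.prems c Suc.IH \<rho>_commute[of n q x y]
      by (simp add: Del_Suc A.l_distr A.r_distr A.a_ac)
  qed
qed simp

lemma Del_Del:
  "\<lbrakk>n \<le> m; m \<le> Suc k; x \<in> carrier g; y \<in> carrier g\<rbrakk>
    \<Longrightarrow> Del m x \<otimes>\<^bsub>A\<^esub> Del n y = Del n y \<otimes>\<^bsub>A\<^esub> Del m x \<oplus>\<^bsub>A\<^esub> Del n (br x y)"
proof (induction n)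
  case 0
  then show ?case by (simp add: Del_0)
next
  case (Suc n)
  note c = br_closed[OF Suc.prems(3,4)]
  show ?case using Suc.prems c Suc.IH Del_\<rho>[of n m x y]
    by (simp add: Del_Suc A.l_distr A.r_distr A.a_ac)
qed

lemma Del_lie_hom: "n \<le> Suc k \<Longrightarrow> lie_hom (Del n)"
  unfolding lie_hom_def by (intro conjI ballI Del_lin Del_Del) auto

lemma Del_gam: "\<lbrakk>p < n; q < n; n \<le> Suc k; x \<in> carrier g\<rbrakk>
    \<Longrightarrow> Del n x \<otimes>\<^bsub>A\<^esub> gam p q = gam p q \<otimes>\<^bsub>A\<^esub> Del n x"
  unfolding gam_def by (intro \<Gamma>_invariant[of _ _ _ x]) (auto intro!: Del_\<rho>)

lemma t_Del:
  assumes w: "w permutes {1..k}" and n: "n \<le> Suc k" and wn: "w ` {..<n} = {..<n}"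
    and x: "x \<in> carrier g"
  shows "t w \<otimes>\<^bsub>A\<^esub> Del n x = Del n x \<otimes>\<^bsub>A\<^esub> t w"
proof -
  have c: "\<rho> (w p) x \<in> carrier A" "\<rho> p x \<in> carrier A" if "p < n" for p
    using that n w x permutes_atMost[of w k p] by auto
  have "t w \<otimes>\<^bsub>A\<^esub> Del n x = (\<Oplus>\<^bsub>A\<^esub>p\<in>{..<n}. t w \<otimes>\<^bsub>A\<^esub> \<rho> p x)"
    unfolding Del_def using w c by (intro A.finsum_rdistr) auto
  also have "\<dots> = (\<Oplus>\<^bsub>A\<^esub>p\<in>{..<n}. \<rho> (w p) x \<otimes>\<^bsub>A\<^esub> t w)"
    using w n x c by (intro A.finsum_cong') (auto simp: t_\<rho>)
  also have "\<dots> = (\<Oplus>\<^bsub>A\<^esub>p\<in>{..<n}. \<rho> (w p) x) \<otimes>\<^bsub>A\<^esub> t w"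
    using w c by (intro A.finsum_ldistr[symmetric]) auto
  also have "(\<Oplus>\<^bsub>A\<^esub>p\<in>{..<n}. \<rho> (w p) x) = (\<Oplus>\<^bsub>A\<^esub>p\<in>w ` {..<n}. \<rho> p x)"
    using c wn inj_on_subset[OF permutes_inj[OF w]]
    by (intro A.finsum_reindex[symmetric]) auto
  finally show ?thesis unfolding wn Del_def .
qed

text \<open>
  The image of \<open>y\<^sub>j\<close>. The sum of the \<open>\<gamma>\<^sub>l\<^sub>j\<close> over \<open>l < j\<close> is kept as one contraction, because the
  commutation rules apply to contractions as a whole.
\<close>

definition yy :: "nat \<Rightarrow> 'a"
  where "yy j = \<sigma> (1/2) \<otimes>\<^bsub>A\<^esub> gam j j \<oplus>\<^bsub>A\<^esub> \<Gamma> (Del j) (\<rho> j)"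

lemma yy_closed [simp]: "j \<le> k \<Longrightarrow> yy j \<in> carrier A"
  unfolding yy_def by simp

lemma half_gam: "p \<le> k \<Longrightarrow> q \<le> k \<Longrightarrow> \<sigma> (1/2) \<otimes>\<^bsub>A\<^esub> gam p q \<oplus>\<^bsub>A\<^esub> \<sigma> (1/2) \<otimes>\<^bsub>A\<^esub> gam p q = gam p q"
proof -
  assume pq: "p \<le> k" "q \<le> k"
  have "\<sigma> (1/2) \<oplus>\<^bsub>A\<^esub> \<sigma> (1/2) = \<one>\<^bsub>A\<^esub>"
    using ring_hom_add[OF \<sigma>, of "1/2" "1/2"] ring_hom_one[OF \<sigma>] by simp
  then show ?thesis using pq by (simp add: A.l_distr[symmetric])
qed

lemma commute_yy:
  assumes a: "a \<in> carrier A" and j: "j \<le> k"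
    and 1: "a \<otimes>\<^bsub>A\<^esub> gam j j = gam j j \<otimes>\<^bsub>A\<^esub> a"
    and 2: "a \<otimes>\<^bsub>A\<^esub> \<Gamma> (Del j) (\<rho> j) = \<Gamma> (Del j) (\<rho> j) \<otimes>\<^bsub>A\<^esub> a"
  shows "a \<otimes>\<^bsub>A\<^esub> yy j = yy j \<otimes>\<^bsub>A\<^esub> a"
proof -
  have "a \<otimes>\<^bsub>A\<^esub> (\<sigma> (1/2) \<otimes>\<^bsub>A\<^esub> gam j j) = a \<otimes>\<^bsub>A\<^esub> \<sigma> (1/2) \<otimes>\<^bsub>A\<^esub> gam j j"
    using a j by (simp add: A.m_assoc)
  also have "\<dots> = \<sigma> (1/2) \<otimes>\<^bsub>A\<^esub> (a \<otimes>\<^bsub>A\<^esub> gam j j)"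
    using a j by (simp add: \<sigma>_central[symmetric] A.m_assoc)
  finally show ?thesis unfolding yy_def using a j 1 2 by (simp add: A.l_distr A.r_distr A.m_assoc)
qed

lemma commute_\<Gamma>_Del_\<rho>:
  assumes "a \<in> carrier A" "j \<le> k"
    and "\<And>p x. p \<le> j \<Longrightarrow> x \<in> carrier g \<Longrightarrow> a \<otimes>\<^bsub>A\<^esub> \<rho> p x = \<rho> p x \<otimes>\<^bsub>A\<^esub> a"
  shows "a \<otimes>\<^bsub>A\<^esub> \<Gamma> (Del j) (\<rho> j) = \<Gamma> (Del j) (\<rho> j) \<otimes>\<^bsub>A\<^esub> a"
  using assms by (intro \<Gamma>_commute commute_Del) auto

lemma kappa_yy: "\<lbrakk>i \<le> k; j \<le> k\<rbrakk> \<Longrightarrow> gam i i \<otimes>\<^bsub>A\<^esub> yy j = yy j \<otimes>\<^bsub>A\<^esub> gam i i"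
  by (intro commute_yy commute_\<Gamma>_Del_\<rho> gam_closed kappa_gam \<rho>_kappa[symmetric]) auto

text \<open>
  For \<open>i < j\<close> the contraction in \<open>y\<^sub>i\<close> lives on factors before \<open>j\<close>. It commutes with \<open>Del j\<close> by invariance
  and with \<open>\<rho>\<^sub>j\<close> trivially, hence with the contraction of the two.
\<close>

lemma yy_commute: "\<lbrakk>i < j; j \<le> k\<rbrakk> \<Longrightarrow> yy i \<otimes>\<^bsub>A\<^esub> yy j = yy j \<otimes>\<^bsub>A\<^esub> yy i"
proof (rule commute_yy)
  assume ij: "i < j" "j \<le> k"
  let ?a = "\<Gamma> (Del i) (\<rho> i)"
  have Del_a: "Del j x \<otimes>\<^bsub>A\<^esub> ?a = ?a \<otimes>\<^bsub>A\<^esub> Del j x" if "x \<in> carrier g" for x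
    using ij that by (intro \<Gamma>_invariant[of _ _ _ x]) (auto intro!: Del_Del Del_\<rho>)
  have \<rho>_a: "\<rho> j x \<otimes>\<^bsub>A\<^esub> ?a = ?a \<otimes>\<^bsub>A\<^esub> \<rho> j x" if "x \<in> carrier g" for x
    using ij that by (intro commute_\<Gamma>_Del_\<rho>) (auto simp: \<rho>_commute)
  have "?a \<otimes>\<^bsub>A\<^esub> \<Gamma> (Del j) (\<rho> j) = \<Gamma> (Del j) (\<rho> j) \<otimes>\<^bsub>A\<^esub> ?a"
    using ij by (intro \<Gamma>_commute) (auto simp: Del_a \<rho>_a)
  moreover have "gam i i \<otimes>\<^bsub>A\<^esub> \<Gamma> (Del j) (\<rho> j) = \<Gamma> (Del j) (\<rho> j) \<otimes>\<^bsub>A\<^esub> gam i i"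
    using ij by (intro commute_\<Gamma>_Del_\<rho>) (auto simp: \<rho>_kappa)
  ultimately have "\<Gamma> (Del j) (\<rho> j) \<otimes>\<^bsub>A\<^esub> yy i = yy i \<otimes>\<^bsub>A\<^esub> \<Gamma> (Del j) (\<rho> j)"
    using ij by (intro commute_yy) auto
  then show "yy i \<otimes>\<^bsub>A\<^esub> \<Gamma> (Del j) (\<rho> j) = \<Gamma> (Del j) (\<rho> j) \<otimes>\<^bsub>A\<^esub> yy i" by simp
qed (auto simp: kappa_yy)

text \<open>
  Let \<open>s = t\<^sub>s\<^sub>i\<close>. Conjugation by \<open>s\<close> turns \<open>y\<^sub>i\<close> into \<open>z = \<kappa>\<^bsub>i+1\<^esub>/2 + \<Sum>\<^bsub>l<i\<^esub> \<gamma>\<^bsub>l,i+1\<^esub>\<close>, which is \<open>y\<^bsub>i+1\<^esub>\<close> without its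
  last summand \<open>\<gamma>\<^bsub>i,i+1\<^esub>\<close>. Both claims about \<open>y\<close> follow, since \<open>\<gamma>\<^bsub>i,i+1\<^esub>\<close> commutes with \<open>s\<close>.
\<close>

lemma transp_t:
  assumes i: "1 \<le> i" "i < k"
  defines "s \<equiv> t (adj_transp i)"
  shows transp_closed: "s \<in> carrier A" and transp_square: "s \<otimes>\<^bsub>A\<^esub> s = \<one>\<^bsub>A\<^esub>"
    and transp_yy_conj: "yy (Suc i) \<ominus>\<^bsub>A\<^esub> (s \<otimes>\<^bsub>A\<^esub> yy i \<otimes>\<^bsub>A\<^esub> s) = gam i (Suc i)"
    and transp_yy_sum: "s \<otimes>\<^bsub>A\<^esub> (yy i \<oplus>\<^bsub>A\<^esub> yy (Suc i)) = (yy i \<oplus>\<^bsub>A\<^esub> yy (Suc i)) \<otimes>\<^bsub>A\<^esub> s"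
proof -
  note w = adj_transp_permutes[OF i]
  show s: "s \<in> carrier A" unfolding s_def by (rule t_closed[OF w])
  have "adj_transp i \<circ> adj_transp i = id" by (simp add: fun_eq_iff)
  then show ss: "s \<otimes>\<^bsub>A\<^esub> s = \<one>\<^bsub>A\<^esub>" unfolding s_def using t_mult[OF w w] t_id by simp
  define z where "z = \<sigma> (1/2) \<otimes>\<^bsub>A\<^esub> gam (Suc i) (Suc i) \<oplus>\<^bsub>A\<^esub> \<Gamma> (Del i) (\<rho> (Suc i))"
  have z: "z \<in> carrier A" unfolding z_def using i by simp
  have yS: "yy (Suc i) = z \<oplus>\<^bsub>A\<^esub> gam i (Suc i)"
    unfolding yy_def z_def using i by (simp add: \<Gamma>_Del_Suc_left A.a_assoc) (simp add: gam_def)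
  have sk: "s \<otimes>\<^bsub>A\<^esub> gam i i = gam (Suc i) (Suc i) \<otimes>\<^bsub>A\<^esub> s"
    unfolding s_def using t_gam[OF w, of i i] i by simp
  have "t (adj_transp i) \<otimes>\<^bsub>A\<^esub> Del i x = Del i x \<otimes>\<^bsub>A\<^esub> t (adj_transp i)" if "x \<in> carrier g" for x
    using i that by (intro t_Del[OF w]) (auto simp: image_iff transpose_def split: if_splits)
  then have sG: "s \<otimes>\<^bsub>A\<^esub> \<Gamma> (Del i) (\<rho> i) = \<Gamma> (Del i) (\<rho> (Suc i)) \<otimes>\<^bsub>A\<^esub> s"
    unfolding s_def using i w by (intro \<Gamma>_intertwine) (auto simp: t_\<rho>[OF w])
  have sh: "s \<otimes>\<^bsub>A\<^esub> (\<sigma> (1/2) \<otimes>\<^bsub>A\<^esub> gam i i) = \<sigma> (1/2) \<otimes>\<^bsub>A\<^esub> gam (Suc i) (Suc i) \<otimes>\<^bsub>A\<^esub> s"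
  proof -
    have "s \<otimes>\<^bsub>A\<^esub> (\<sigma> (1/2) \<otimes>\<^bsub>A\<^esub> gam i i) = s \<otimes>\<^bsub>A\<^esub> \<sigma> (1/2) \<otimes>\<^bsub>A\<^esub> gam i i"
      using s i by (simp add: A.m_assoc)
    also have "\<dots> = \<sigma> (1/2) \<otimes>\<^bsub>A\<^esub> (s \<otimes>\<^bsub>A\<^esub> gam i i)"
      using s i by (simp add: \<sigma>_central[symmetric] A.m_assoc)
    finally show ?thesis using s i by (simp add: sk A.m_assoc)
  qed
  have sy: "s \<otimes>\<^bsub>A\<^esub> yy i = z \<otimes>\<^bsub>A\<^esub> s"
    unfolding yy_def z_def using s i by (simp add: A.l_distr A.r_distr sh sG)
  have "s \<otimes>\<^bsub>A\<^esub> yy i \<otimes>\<^bsub>A\<^esub> s = z" using s z i by (simp add: sy A.m_assoc ss)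
  then show "yy (Suc i) \<ominus>\<^bsub>A\<^esub> (s \<otimes>\<^bsub>A\<^esub> yy i \<otimes>\<^bsub>A\<^esub> s) = gam i (Suc i)"
    unfolding yS using z i by (simp add: a_minus_def A.a_ac A.r_neg1 A.r_neg2)
  have "s \<otimes>\<^bsub>A\<^esub> z = s \<otimes>\<^bsub>A\<^esub> (s \<otimes>\<^bsub>A\<^esub> yy i \<otimes>\<^bsub>A\<^esub> s)" using s z i by (simp add: sy A.m_assoc ss)
  also have "\<dots> = s \<otimes>\<^bsub>A\<^esub> s \<otimes>\<^bsub>A\<^esub> yy i \<otimes>\<^bsub>A\<^esub> s" using s i by (simp add: A.m_assoc)
  also have "\<dots> = yy i \<otimes>\<^bsub>A\<^esub> s" using s i by (simp add: ss)
  finally have sz: "s \<otimes>\<^bsub>A\<^esub> z = yy i \<otimes>\<^bsub>A\<^esub> s" .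
  have sg: "s \<otimes>\<^bsub>A\<^esub> gam i (Suc i) = gam i (Suc i) \<otimes>\<^bsub>A\<^esub> s"
    unfolding s_def using t_gam[OF w, of i "Suc i"] i gam_sym[of i "Suc i"] by simp
  show "s \<otimes>\<^bsub>A\<^esub> (yy i \<oplus>\<^bsub>A\<^esub> yy (Suc i)) = (yy i \<oplus>\<^bsub>A\<^esub> yy (Suc i)) \<otimes>\<^bsub>A\<^esub> s"
    unfolding yS using s z i by (simp add: A.l_distr A.r_distr sy sz sg A.a_ac)
qed

lemma transp_yy:
  assumes i: "1 \<le> i" "i < k" and j: "j \<le> k" "j \<noteq> i" "j \<noteq> Suc i"
  shows "t (adj_transp i) \<otimes>\<^bsub>A\<^esub> yy j = yy j \<otimes>\<^bsub>A\<^esub> t (adj_transp i)"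
proof (rule commute_yy)
  note w = adj_transp_permutes[OF i]
  have wj: "adj_transp i j = j" using j by (simp add: transpose_def)
  show "t (adj_transp i) \<otimes>\<^bsub>A\<^esub> gam j j = gam j j \<otimes>\<^bsub>A\<^esub> t (adj_transp i)"
    using t_gam[OF w j(1) j(1)] wj by simp
  have "adj_transp i p < j" if "p < j" for p
    using that j by (auto simp: transpose_def)
  then have "adj_transp i ` {..<j} \<subseteq> {..<j}" by blast
  then have "adj_transp i ` {..<j} = {..<j}"
    using card_image[OF inj_on_subset[OF permutes_inj[OF w] subset_UNIV], of "{..<j}"]
    by (intro card_subset_eq) auto
  then have "t (adj_transp i) \<otimes>\<^bsub>A\<^esub> Del j x = Del j x \<otimes>\<^bsub>A\<^esub> t (adj_transp i)" if "x \<in> carrier g" for x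
    using j that by (intro t_Del[OF w]) auto
  then show "t (adj_transp i) \<otimes>\<^bsub>A\<^esub> \<Gamma> (Del j) (\<rho> j) = \<Gamma> (Del j) (\<rho> j) \<otimes>\<^bsub>A\<^esub> t (adj_transp i)"
    using j wj w by (intro \<Gamma>_intertwine) (auto simp: t_\<rho>[OF w])
qed (use adj_transp_permutes[OF i] j in auto)

lemma kappa1_transp_braid:
  assumes "1 < k"
  shows "gam 1 1 \<otimes>\<^bsub>A\<^esub> t (adj_transp 1) \<otimes>\<^bsub>A\<^esub> gam 1 1 \<otimes>\<^bsub>A\<^esub> t (adj_transp 1) =
    t (adj_transp 1) \<otimes>\<^bsub>A\<^esub> gam 1 1 \<otimes>\<^bsub>A\<^esub> t (adj_transp 1) \<otimes>\<^bsub>A\<^esub> gam 1 1"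
proof -
  define s where "s = t (adj_transp 1)"
  have i: "1 \<le> (1::nat)" by simp
  note w = adj_transp_permutes[OF i assms]
  have s: "s \<in> carrier A" unfolding s_def by (rule t_closed[OF w])
  have ss: "s \<otimes>\<^bsub>A\<^esub> s = \<one>\<^bsub>A\<^esub>" unfolding s_def by (rule transp_square[OF i assms])
  have sk: "s \<otimes>\<^bsub>A\<^esub> gam 1 1 = gam 2 2 \<otimes>\<^bsub>A\<^esub> s"
    unfolding s_def using t_gam[OF w, of 1 1] assms by (simp add: numeral_2_eq_2)
  have "s \<otimes>\<^bsub>A\<^esub> gam 1 1 \<otimes>\<^bsub>A\<^esub> s = gam 2 2" unfolding sk using s assms by (simp add: A.m_assoc ss)
  moreover have "gam 1 1 \<otimes>\<^bsub>A\<^esub> s \<otimes>\<^bsub>A\<^esub> gam 1 1 \<otimes>\<^bsub>A\<^esub> s = gam 1 1 \<otimes>\<^bsub>A\<^esub> (s \<otimes>\<^bsub>A\<^esub> gam 1 1 \<otimes>\<^bsub>A\<^esub> s)"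
    using s assms by (simp add: A.m_assoc)
  ultimately show ?thesis using kappa_gam[of 1 2 2] assms unfolding s_def[symmetric] by simp
qed

lemma transp_transp_gam:
  assumes i: "1 \<le> i" "i + 2 \<le> k"
  shows "t (adj_transp i) \<otimes>\<^bsub>A\<^esub> t (adj_transp (Suc i)) \<otimes>\<^bsub>A\<^esub> gam i (Suc i)
    \<otimes>\<^bsub>A\<^esub> t (adj_transp (Suc i)) \<otimes>\<^bsub>A\<^esub> t (adj_transp i) = gam (Suc i) (Suc (Suc i))"
proof -
  define s where "s = t (adj_transp i)"
  define s' where "s' = t (adj_transp (Suc i))"
  have i1: "i < k" and i2: "1 \<le> Suc i" "Suc i < k" using i by auto
  note w = adj_transp_permutes[OF i(1) i1] and w' = adj_transp_permutes[OF i2]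
  have c: "s \<in> carrier A" "s' \<in> carrier A" unfolding s_def s'_def using w w' by (auto simp del: One_nat_def)
  have ss: "s \<otimes>\<^bsub>A\<^esub> s = \<one>\<^bsub>A\<^esub>" "s' \<otimes>\<^bsub>A\<^esub> s' = \<one>\<^bsub>A\<^esub>"
    unfolding s_def s'_def by (rule transp_square[OF i(1) i1], rule transp_square[OF i2])
  have 1: "s' \<otimes>\<^bsub>A\<^esub> gam i (Suc i) = gam i (Suc (Suc i)) \<otimes>\<^bsub>A\<^esub> s'"
    unfolding s'_def using t_gam[OF w', of i "Suc i"] i by simp
  have 2: "s \<otimes>\<^bsub>A\<^esub> gam i (Suc (Suc i)) = gam (Suc i) (Suc (Suc i)) \<otimes>\<^bsub>A\<^esub> s"
    unfolding s_def using t_gam[OF w, of i "Suc (Suc i)"] i by simp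
  have "s \<otimes>\<^bsub>A\<^esub> s' \<otimes>\<^bsub>A\<^esub> gam i (Suc i) \<otimes>\<^bsub>A\<^esub> s' \<otimes>\<^bsub>A\<^esub> s = s \<otimes>\<^bsub>A\<^esub> (s' \<otimes>\<^bsub>A\<^esub> gam i (Suc i)) \<otimes>\<^bsub>A\<^esub> s' \<otimes>\<^bsub>A\<^esub> s"
    using c i by (simp add: A.m_assoc)
  also have "\<dots> = (s \<otimes>\<^bsub>A\<^esub> gam i (Suc (Suc i))) \<otimes>\<^bsub>A\<^esub> (s' \<otimes>\<^bsub>A\<^esub> s') \<otimes>\<^bsub>A\<^esub> s"
    unfolding 1 using c i by (simp add: A.m_assoc)
  also have "\<dots> = gam (Suc i) (Suc (Suc i)) \<otimes>\<^bsub>A\<^esub> (s \<otimes>\<^bsub>A\<^esub> s)"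
    unfolding 2 ss(2) using c i by (simp add: A.m_assoc)
  also have "\<dots> = gam (Suc i) (Suc (Suc i))" unfolding ss(1) using i by simp
  finally show ?thesis unfolding s_def s'_def .
qed

text \<open>
  The image of \<open>c\<^sub>j\<close>, as the Casimir element of the action on the factors \<open>0, \<dots>, j\<close>. Expanding the
  contraction one factor at a time gives its expressions by \<open>y\<close> and by \<open>\<kappa>\<close> and \<open>\<gamma>\<close>.
\<close>

definition cc :: "nat \<Rightarrow> 'a"
  where "cc j = \<Gamma> (Del (Suc j)) (Del (Suc j))"

lemma cc_closed [simp]: "j \<le> k \<Longrightarrow> cc j \<in> carrier A"
  unfolding cc_def by simp

lemma cc_0: "cc 0 = gam 0 0"
  unfolding cc_def gam_def
  by (simp add: \<Gamma>_Del_Suc_left \<Gamma>_Del_Suc_right Del_0 \<Gamma>_zero_left \<Gamma>_zero_right lin_zero)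

lemma cc_Suc:
  assumes j: "Suc j \<le> k"
  shows "cc (Suc j) = cc j \<oplus>\<^bsub>A\<^esub> (gam (Suc j) (Suc j) \<oplus>\<^bsub>A\<^esub>
    (\<Gamma> (Del (Suc j)) (\<rho> (Suc j)) \<oplus>\<^bsub>A\<^esub> \<Gamma> (Del (Suc j)) (\<rho> (Suc j))))"
proof -
  have "\<Gamma> (\<rho> (Suc j)) (Del (Suc j)) = \<Gamma> (Del (Suc j)) (\<rho> (Suc j))"
    using j by (intro \<Gamma>_sym) (auto simp: Del_\<rho>_other)
  then show ?thesis unfolding cc_def gam_def using j
    by (subst \<Gamma>_Del_Suc_left, simp, simp) (simp add: \<Gamma>_Del_Suc_right[of "Suc j"] A.a_ac)
qed

lemma cc_yy: "j \<le> k \<Longrightarrow> cc j = gam 0 0 \<oplus>\<^bsub>A\<^esub> add_pow A (2::nat) (\<Oplus>\<^bsub>A\<^esub>i\<in>{1..j}. yy i)"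
proof (induction j)
  case 0
  then show ?case by (simp add: cc_0 A.add_pow_two)
next
  case (Suc j)
  let ?S = "\<Oplus>\<^bsub>A\<^esub>i\<in>{1..j}. yy i" and ?G = "\<Gamma> (Del (Suc j)) (\<rho> (Suc j))" and ?h = "\<sigma> (1/2) \<otimes>\<^bsub>A\<^esub> gam (Suc j) (Suc j)"
  have S: "?S \<in> carrier A" using Suc.prems by (intro A.finsum_closed) auto
  have y: "yy (Suc j) \<in> carrier A" using Suc.prems by simp
  have c: "?G \<in> carrier A" "?h \<in> carrier A" using Suc.prems by auto
  have "{1..Suc j} = insert (Suc j) {1..j}" by auto
  then have sum: "(\<Oplus>\<^bsub>A\<^esub>i\<in>{1..Suc j}. yy i) = yy (Suc j) \<oplus>\<^bsub>A\<^esub> ?S"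
    using Suc.prems by (simp add: Pi_def)
  have "cc (Suc j) = (gam 0 0 \<oplus>\<^bsub>A\<^esub> (?S \<oplus>\<^bsub>A\<^esub> ?S)) \<oplus>\<^bsub>A\<^esub> ((?h \<oplus>\<^bsub>A\<^esub> ?h) \<oplus>\<^bsub>A\<^esub> (?G \<oplus>\<^bsub>A\<^esub> ?G))"
    using Suc S by (simp add: cc_Suc half_gam A.add_pow_two)
  also have "\<dots> = gam 0 0 \<oplus>\<^bsub>A\<^esub> ((?h \<oplus>\<^bsub>A\<^esub> ?G \<oplus>\<^bsub>A\<^esub> ?S) \<oplus>\<^bsub>A\<^esub> (?h \<oplus>\<^bsub>A\<^esub> ?G \<oplus>\<^bsub>A\<^esub> ?S))"
    using c S by (simp add: A.a_ac)
  also have "\<dots> = gam 0 0 \<oplus>\<^bsub>A\<^esub> ((yy (Suc j) \<oplus>\<^bsub>A\<^esub> ?S) \<oplus>\<^bsub>A\<^esub> (yy (Suc j) \<oplus>\<^bsub>A\<^esub> ?S))"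
    unfolding yy_def ..
  finally show ?case using S y by (simp only: sum A.add_pow_two A.a_closed)
qed

lemma \<Gamma>_Del_\<rho>: "\<lbrakk>n \<le> Suc k; q \<le> k\<rbrakk> \<Longrightarrow> \<Gamma> (Del n) (\<rho> q) = (\<Oplus>\<^bsub>A\<^esub>p\<in>{..<n}. gam p q)"
proof (induction n)
  case 0
  then show ?case by (simp add: Del_0 \<Gamma>_zero_left)
next
  case (Suc n)
  then have "(\<Oplus>\<^bsub>A\<^esub>p\<in>{..<n}. gam p q) \<in> carrier A" by (intro A.finsum_closed) auto
  then show ?case using Suc
    by (simp add: \<Gamma>_Del_Suc_left lessThan_Suc Pi_def gam_def[symmetric] A.a_comm)
qed

lemma cc_gam: "j \<le> k \<Longrightarrow> cc j = (\<Oplus>\<^bsub>A\<^esub>i\<in>{..j}. gam i i) \<oplus>\<^bsub>A\<^esub>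
    add_pow A (2::nat) (\<Oplus>\<^bsub>A\<^esub>p\<in>{(l, m). l < m \<and> m \<le> j}. gam (fst p) (snd p))"
proof (induction j)
  case 0
  have "{(l, m). l < m \<and> m \<le> (0::nat)} = {}" by auto
  then show ?case by (simp only: A.finsum_empty) (simp add: cc_0 A.add_pow_two)
next
  case (Suc j)
  let ?P = "{(l, m). l < m \<and> m \<le> j}" and ?N = "(\<lambda>l. (l, Suc j)) ` {..<Suc j}"
  let ?S = "\<Oplus>\<^bsub>A\<^esub>p\<in>?P. gam (fst p) (snd p)" and ?K = "\<Oplus>\<^bsub>A\<^esub>i\<in>{..j}. gam i i"
    and ?G = "\<Gamma> (Del (Suc j)) (\<rho> (Suc j))"
  have fin: "finite ?P" by (rule finite_subset[of _ "{..j} \<times> {..j}"]) auto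
  have P: "{(l, m). l < m \<and> m \<le> Suc j} = ?P \<union> ?N" by (auto simp: le_Suc_eq)
  have S: "?S \<in> carrier A" using Suc.prems by (intro A.finsum_closed) auto
  have K: "?K \<in> carrier A" using Suc.prems by (intro A.finsum_closed) auto
  have G: "?G \<in> carrier A" using Suc.prems by simp
  have N: "(\<Oplus>\<^bsub>A\<^esub>p\<in>?N. gam (fst p) (snd p)) = ?G"
  proof -
    have "(\<Oplus>\<^bsub>A\<^esub>p\<in>?N. gam (fst p) (snd p)) = (\<Oplus>\<^bsub>A\<^esub>l\<in>{..<Suc j}. gam (fst (l, Suc j)) (snd (l, Suc j)))"
    proof (rule A.finsum_reindex)
      show "(\<lambda>p. gam (fst p) (snd p)) \<in> ?N \<rightarrow> carrier A" using Suc.prems by auto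
    qed (simp add: inj_on_def)
    also have "\<dots> = (\<Oplus>\<^bsub>A\<^esub>l\<in>{..<Suc j}. gam l (Suc j))" by (simp only: fst_conv snd_conv)
    also have "\<dots> = ?G" using Suc.prems by (intro \<Gamma>_Del_\<rho>[symmetric]) auto
    finally show ?thesis .
  qed
  have PN: "(\<Oplus>\<^bsub>A\<^esub>p\<in>{(l, m). l < m \<and> m \<le> Suc j}. gam (fst p) (snd p)) = ?S \<oplus>\<^bsub>A\<^esub> ?G"
    unfolding P N[symmetric]
  proof (rule A.finsum_Un_disjoint[OF fin])
    show "?P \<inter> ?N = {}" by auto
    show "(\<lambda>p. gam (fst p) (snd p)) \<in> ?P \<rightarrow> carrier A" using Suc.prems by auto
    show "(\<lambda>p. gam (fst p) (snd p)) \<in> ?N \<rightarrow> carrier A" using Suc.prems by auto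
  qed simp
  have KS: "(\<Oplus>\<^bsub>A\<^esub>i\<in>{..Suc j}. gam i i) = gam (Suc j) (Suc j) \<oplus>\<^bsub>A\<^esub> ?K"
    unfolding atMost_Suc using Suc.prems by (intro A.finsum_insert) auto
  have c: "cc j = ?K \<oplus>\<^bsub>A\<^esub> (?S \<oplus>\<^bsub>A\<^esub> ?S)"
    using Suc.IH Suc.prems unfolding A.add_pow_two[OF S] by simp
  have shuffle: "(x \<oplus>\<^bsub>A\<^esub> (y \<oplus>\<^bsub>A\<^esub> y)) \<oplus>\<^bsub>A\<^esub> (z \<oplus>\<^bsub>A\<^esub> (u \<oplus>\<^bsub>A\<^esub> u)) = (z \<oplus>\<^bsub>A\<^esub> x) \<oplus>\<^bsub>A\<^esub> ((y \<oplus>\<^bsub>A\<^esub> u) \<oplus>\<^bsub>A\<^esub> (y \<oplus>\<^bsub>A\<^esub> u))"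
    if "x \<in> carrier A" "y \<in> carrier A" "z \<in> carrier A" "u \<in> carrier A" for x y z u
    using that by (simp add: A.a_ac)
  show ?case
    unfolding PN KS A.add_pow_two[OF A.a_closed[OF S G]] cc_Suc[OF Suc.prems] c
    by (rule shuffle[OF K S gam_closed[OF Suc.prems Suc.prems] G])
qed

end

section \<open>The enveloping algebra\<close>

context presentation
begin

lemma scalar_free_closed: "c \<in> carrier R \<Longrightarrow> c \<odot>\<^bsub>FA\<^esub> \<one>\<^bsub>FA\<^esub> \<in> carrier FA"
  using R.free_module_smultI[OF _ R.unit_vec_closed[of "[]" "lists S"]] by simp

lemma presented_scalar_hom: "presented_scalar R S rels \<in> ring_hom R PA"
proof (rule ring_hom_memI)
  fix c d assume c: "c \<in> carrier R" and d: "d \<in> carrier R"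
  note cc = scalar_free_closed[OF c] and dc = scalar_free_closed[OF d]
  show "presented_scalar R S rels c \<in> carrier PA" by (rule presented_scalar_closed[OF c])
  have "(c \<otimes> d) \<odot>\<^bsub>FA\<^esub> \<one>\<^bsub>FA\<^esub> = (c \<odot>\<^bsub>FA\<^esub> \<one>\<^bsub>FA\<^esub>) \<otimes>\<^bsub>FA\<^esub> (d \<odot>\<^bsub>FA\<^esub> \<one>\<^bsub>FA\<^esub>)"
    using c d by (simp add: fun_eq_iff R.word_conv_smult_left R.word_conv_one_left R.m_assoc)
  then show "presented_scalar R S rels (c \<otimes> d) = presented_scalar R S rels c \<otimes>\<^bsub>PA\<^esub> presented_scalar R S rels d"
    unfolding presented_scalar_def using ring_hom_mult[OF cls_hom cc dc] by simp
  have "(c \<oplus> d) \<odot>\<^bsub>FA\<^esub> \<one>\<^bsub>FA\<^esub> = (c \<odot>\<^bsub>FA\<^esub> \<one>\<^bsub>FA\<^esub>) \<oplus>\<^bsub>FA\<^esub> (d \<odot>\<^bsub>FA\<^esub> \<one>\<^bsub>FA\<^esub>)"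
    using c d by (simp add: fun_eq_iff R.l_distr)
  then show "presented_scalar R S rels (c \<oplus> d) = presented_scalar R S rels c \<oplus>\<^bsub>PA\<^esub> presented_scalar R S rels d"
    unfolding presented_scalar_def using ring_hom_add[OF cls_hom cc dc] by simp
next
  have "\<one> \<odot>\<^bsub>FA\<^esub> \<one>\<^bsub>FA\<^esub> = \<one>\<^bsub>FA\<^esub>" by (simp add: fun_eq_iff)
  then show "presented_scalar R S rels \<one> = \<one>\<^bsub>PA\<^esub>"
    unfolding presented_scalar_def using ring_hom_one[OF cls_hom] by simp
qed

lemma presented_scalar_central:
  assumes c: "c \<in> carrier R" and a: "a \<in> carrier PA"
  shows "presented_scalar R S rels c \<otimes>\<^bsub>PA\<^esub> a = a \<otimes>\<^bsub>PA\<^esub> presented_scalar R S rels c"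
proof -
  obtain p where p: "p \<in> carrier FA" "a = cls p" using a unfolding carrier_PA by blast
  note cc = scalar_free_closed[OF c]
  have "(c \<odot>\<^bsub>FA\<^esub> \<one>\<^bsub>FA\<^esub>) \<otimes>\<^bsub>FA\<^esub> p = p \<otimes>\<^bsub>FA\<^esub> (c \<odot>\<^bsub>FA\<^esub> \<one>\<^bsub>FA\<^esub>)"
    using c p(1) by (simp add: fun_eq_iff R.word_conv_smult_left R.word_conv_one_left
        R.word_conv_smult_right R.word_conv_one_right free_module_closed)
  then show ?thesis unfolding p(2) presented_scalar_def
    using ring_hom_mult[OF cls_hom cc p(1)] ring_hom_mult[OF cls_hom p(1) cc] by simp
qed

end

lemma (in abelian_group) add_minus_cancel:
  "\<lbrakk>x \<in> carrier G; y \<in> carrier G\<rbrakk> \<Longrightarrow> (x \<oplus> y) \<ominus> x = y"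
  by (simp add: a_minus_def a_comm[of x y] a_assoc r_neg)

text \<open>
  The center serves as the coefficient ring of the braid algebras, whose theory needs a commutative ring.
\<close>

lemma (in ring) center_ring_cring: "cring (center_ring R)"
proof -
  have simps: "carrier (center_ring R) = {z \<in> carrier R. \<forall>u \<in> carrier R. z \<otimes> u = u \<otimes> z}"
    "\<And>x y. x \<otimes>\<^bsub>center_ring R\<^esub> y = x \<otimes> y" "\<And>x y. x \<oplus>\<^bsub>center_ring R\<^esub> y = x \<oplus> y"
    "\<one>\<^bsub>center_ring R\<^esub> = \<one>" "\<zero>\<^bsub>center_ring R\<^esub> = \<zero>"
    unfolding center_ring_def by auto
  show ?thesis
  proof (rule cringI)
    show "abelian_group (center_ring R)"
    proof (rule abelian_groupI)
      fix z assume z: "z \<in> carrier (center_ring R)"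
      then have "\<ominus> z \<in> carrier (center_ring R)" unfolding simps by (auto simp: l_minus r_minus)
      moreover have "\<ominus> z \<oplus>\<^bsub>center_ring R\<^esub> z = \<zero>\<^bsub>center_ring R\<^esub>" using z unfolding simps by (auto simp: l_neg)
      ultimately show "\<exists>y\<in>carrier (center_ring R). y \<oplus>\<^bsub>center_ring R\<^esub> z = \<zero>\<^bsub>center_ring R\<^esub>" by blast
    next
      fix x y assume "x \<in> carrier (center_ring R)" "y \<in> carrier (center_ring R)"
      then show "x \<oplus>\<^bsub>center_ring R\<^esub> y \<in> carrier (center_ring R)"
        unfolding simps using l_distr r_distr by auto
    qed (use a_assoc a_comm in \<open>auto simp: simps\<close>)
    show "comm_monoid (center_ring R)"
    proof (rule comm_monoidI)
      fix x y assume "x \<in> carrier (center_ring R)" "y \<in> carrier (center_ring R)"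
      then have x: "x \<in> carrier R" "\<And>u. u \<in> carrier R \<Longrightarrow> x \<otimes> u = u \<otimes> x"
        and y: "y \<in> carrier R" "\<And>u. u \<in> carrier R \<Longrightarrow> y \<otimes> u = u \<otimes> y"
        unfolding simps by auto
      have "x \<otimes> y \<otimes> u = u \<otimes> (x \<otimes> y)" if u: "u \<in> carrier R" for u
        by (metis x y u m_assoc)
      then show "x \<otimes>\<^bsub>center_ring R\<^esub> y \<in> carrier (center_ring R)"
        unfolding simps using x(1) y(1) by blast
      show "x \<otimes>\<^bsub>center_ring R\<^esub> y = y \<otimes>\<^bsub>center_ring R\<^esub> x"
        unfolding simps by (rule x(2)[OF y(1)])
      fix z assume "z \<in> carrier (center_ring R)"
      then have "z \<in> carrier R" unfolding simps by blast
      then show "x \<otimes>\<^bsub>center_ring R\<^esub> y \<otimes>\<^bsub>center_ring R\<^esub> z = x \<otimes>\<^bsub>center_ring R\<^esub> (y \<otimes>\<^bsub>center_ring R\<^esub> z)"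
        unfolding simps by (rule m_assoc[OF x(1) y(1)])
    next
      fix x assume "x \<in> carrier (center_ring R)"
      then have "x \<in> carrier R" unfolding simps by blast
      then show "\<one>\<^bsub>center_ring R\<^esub> \<otimes>\<^bsub>center_ring R\<^esub> x = x" unfolding simps by (rule l_one)
    qed (simp add: simps)
  next
    fix x y z assume "x \<in> carrier (center_ring R)" "y \<in> carrier (center_ring R)" "z \<in> carrier (center_ring R)"
    then have "x \<in> carrier R" "y \<in> carrier R" "z \<in> carrier R" unfolding simps by blast+
    then show "(x \<oplus>\<^bsub>center_ring R\<^esub> y) \<otimes>\<^bsub>center_ring R\<^esub> z =
        x \<otimes>\<^bsub>center_ring R\<^esub> z \<oplus>\<^bsub>center_ring R\<^esub> y \<otimes>\<^bsub>center_ring R\<^esub> z"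
      unfolding simps by (rule l_distr)
  qed
qed

context lie_algebra
begin

lemma uea_presentation: "presentation CC (carrier g) (uea_rels g br)"
proof -
  interpret F: ring "free_algebra CC (carrier g)" by (rule cring.free_algebra_is_ring[OF CC_cring])
  have gen: "x \<in> carrier g \<Longrightarrow> free_gen CC x \<in> carrier (free_algebra CC (carrier g))" for x
    using cring.unit_vec_closed[OF CC_cring, of "[x]" "lists (carrier g)"] by simp
  have sm: "c \<odot>\<^bsub>free_algebra CC (carrier g)\<^esub> free_gen CC x \<in> carrier (free_algebra CC (carrier g))"
    if "x \<in> carrier g" for c x
    using cring.free_module_smultI[OF CC_cring, of c "free_gen CC x" "lists (carrier g)"] gen[OF that] by simp
  show ?thesis
  proof (intro presentation.intro presentation_axioms.intro CC_cring)
    fix a b assume "(a, b) \<in> uea_rels g br"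
    then show "a \<in> carrier (free_algebra CC (carrier g)) \<and> b \<in> carrier (free_algebra CC (carrier g))"
    proof cases
      case (uea_add x y)
      have "x \<oplus>\<^bsub>g\<^esub> y \<in> carrier g" using uea_add by simp
      then show ?thesis unfolding uea_add(1,2) by (intro conjI gen F.a_closed uea_add(3,4))
    next
      case (uea_smult x c)
      have "c \<odot>\<^bsub>g\<^esub> x \<in> carrier g" using uea_smult smult_closed[of c x] by simp
      then show ?thesis unfolding uea_smult(1,2) by (intro conjI gen sm uea_smult(3))
    next
      case (uea_br x y)
      then show ?thesis unfolding uea_br(1,2)
        by (intro conjI gen F.minus_closed F.m_closed br_closed) (use uea_br in auto)
    qed
  qed
qed

sublocale U: presentation CC "carrier g" "uea_rels g br"
  by (rule uea_presentation)

lemma uea_is_ring: "ring (uea g br)"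
  unfolding uea_def by (rule U.presented_algebra_is_ring)

abbreviation "uea_scalar \<equiv> presented_scalar CC (carrier g) (uea_rels g br)"

lemma uea_incl_closed [simp]: "x \<in> carrier g \<Longrightarrow> uea_incl g br x \<in> carrier (uea g br)"
  unfolding uea_incl_def uea_def by (rule U.presented_gen_closed)

lemma uea_scalar_closed [simp]: "uea_scalar c \<in> carrier (uea g br)"
  unfolding uea_def by (rule U.presented_scalar_closed) simp

lemma uea_scalar_hom: "uea_scalar \<in> ring_hom CC (uea g br)"
  unfolding uea_def by (rule U.presented_scalar_hom)

lemma uea_scalar_central:
  "a \<in> carrier (uea g br) \<Longrightarrow> uea_scalar c \<otimes>\<^bsub>uea g br\<^esub> a = a \<otimes>\<^bsub>uea g br\<^esub> uea_scalar c"
  unfolding uea_def by (rule U.presented_scalar_central) simp_all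

lemma uea_induct [consumes 1, case_names scalar incl add mult]:
  assumes "u \<in> carrier (uea g br)"
    and "\<And>c. Q (uea_scalar c)"
    and "\<And>x. x \<in> carrier g \<Longrightarrow> Q (uea_incl g br x)"
    and "\<And>a b. \<lbrakk>a \<in> carrier (uea g br); b \<in> carrier (uea g br); Q a; Q b\<rbrakk> \<Longrightarrow> Q (a \<oplus>\<^bsub>uea g br\<^esub> b)"
    and "\<And>a b. \<lbrakk>a \<in> carrier (uea g br); b \<in> carrier (uea g br); Q a; Q b\<rbrakk> \<Longrightarrow> Q (a \<otimes>\<^bsub>uea g br\<^esub> b)"
  shows "Q u"
  using assms unfolding uea_def uea_incl_def by (rule U.presented_algebra_induct)

lemma uea_incl_linear:
  shows "\<lbrakk>x \<in> carrier g; y \<in> carrier g\<rbrakk>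
      \<Longrightarrow> uea_incl g br (x \<oplus>\<^bsub>g\<^esub> y) = uea_incl g br x \<oplus>\<^bsub>uea g br\<^esub> uea_incl g br y"
    and "x \<in> carrier g \<Longrightarrow> uea_incl g br (c \<odot>\<^bsub>g\<^esub> x) = uea_scalar c \<otimes>\<^bsub>uea g br\<^esub> uea_incl g br x"
    and "\<lbrakk>x \<in> carrier g; y \<in> carrier g\<rbrakk>
      \<Longrightarrow> uea_incl g br x \<otimes>\<^bsub>uea g br\<^esub> uea_incl g br y =
        uea_incl g br y \<otimes>\<^bsub>uea g br\<^esub> uea_incl g br x \<oplus>\<^bsub>uea g br\<^esub> uea_incl g br (br x y)"
proof -
  interpret Ug: ring "uea g br" by (rule uea_is_ring)
  have hom: "presented_class CC (carrier g) (uea_rels g br) \<in> ring_hom (free_algebra CC (carrier g)) (uea g br)"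
    unfolding uea_def by (rule U.cls_hom)
  note gen = U.gen_closed
  {
    fix x y assume x: "x \<in> carrier g" and y: "y \<in> carrier g"
    show "uea_incl g br (x \<oplus>\<^bsub>g\<^esub> y) = uea_incl g br x \<oplus>\<^bsub>uea g br\<^esub> uea_incl g br y"
      unfolding uea_incl_def U.cls_eqI[OF uea_add[OF x y]]
      by (rule ring_hom_add[OF hom gen[OF x] gen[OF y]])
    let ?F = "free_algebra CC (carrier g)"
    let ?x = "free_gen CC x" and ?y = "free_gen CC y"
    let ?h = "presented_class CC (carrier g) (uea_rels g br)"
    have xy: "?x \<otimes>\<^bsub>?F\<^esub> ?y \<in> carrier ?F" "?y \<otimes>\<^bsub>?F\<^esub> ?x \<in> carrier ?F"
      using gen[OF x] gen[OF y] by (simp_all del: free_algebra_simps)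
    have "?x \<otimes>\<^bsub>?F\<^esub> ?y = ?y \<otimes>\<^bsub>?F\<^esub> ?x \<oplus>\<^bsub>?F\<^esub> (?x \<otimes>\<^bsub>?F\<^esub> ?y \<ominus>\<^bsub>?F\<^esub> ?y \<otimes>\<^bsub>?F\<^esub> ?x)"
      using xy by (simp add: a_minus_def U.F.a_ac U.F.r_neg U.F.r_neg1 U.F.r_neg2 del: free_algebra_simps)
    then have "?h (?x \<otimes>\<^bsub>?F\<^esub> ?y) = ?h (?y \<otimes>\<^bsub>?F\<^esub> ?x) \<oplus>\<^bsub>uea g br\<^esub> ?h (?x \<otimes>\<^bsub>?F\<^esub> ?y \<ominus>\<^bsub>?F\<^esub> ?y \<otimes>\<^bsub>?F\<^esub> ?x)"
      using ring_hom_add[OF hom xy(2) U.F.minus_closed[OF xy]] by simp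
    then show "uea_incl g br x \<otimes>\<^bsub>uea g br\<^esub> uea_incl g br y =
        uea_incl g br y \<otimes>\<^bsub>uea g br\<^esub> uea_incl g br x \<oplus>\<^bsub>uea g br\<^esub> uea_incl g br (br x y)"
      unfolding uea_incl_def U.cls_eqI[OF uea_br[OF x y]]
        ring_hom_mult[OF hom gen[OF x] gen[OF y]] ring_hom_mult[OF hom gen[OF y] gen[OF x]] .
  next
    fix c x assume x: "x \<in> carrier g"
    let ?F = "free_algebra CC (carrier g)"
    have "c \<odot>\<^bsub>?F\<^esub> free_gen CC x = (c \<odot>\<^bsub>?F\<^esub> \<one>\<^bsub>?F\<^esub>) \<otimes>\<^bsub>?F\<^esub> free_gen CC x"
      using cring.word_conv_smult_left[OF CC_cring, of c "unit_vec CC []" "free_gen CC x"]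
        cring.word_conv_one_left[OF CC_cring, of "free_gen CC x"] by (simp add: fun_eq_iff)
    then show "uea_incl g br (c \<odot>\<^bsub>g\<^esub> x) = uea_scalar c \<otimes>\<^bsub>uea g br\<^esub> uea_incl g br x"
      unfolding uea_incl_def presented_scalar_def U.cls_eqI[OF uea_smult[OF x]]
      using ring_hom_mult[OF hom U.scalar_free_closed gen[OF x], of c] by simp
  }
qed

end

context lie_module
begin

text \<open>The action as an extensional function, which makes it an element of the endomorphism ring.\<close>

definition rep :: "'g \<Rightarrow> 'm \<Rightarrow> 'm"
  where "rep x = (\<lambda>m\<in>carrier M. act x m)"

lemma act_commute:
  assumes "x \<in> carrier g" "y \<in> carrier g" "m \<in> carrier M"
  shows "act x (act y m) = act y (act x m) \<oplus>\<^bsub>M\<^esub> act (br x y) m"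
  using assms by (simp add: act_br act_closed a_minus_def M.a_ac M.r_neg M.r_neg1 M.r_neg2)

lemma act_mod_hom: "x \<in> carrier g \<Longrightarrow> act x \<in> mod_hom CC M M"
  by (rule mod_homI) (auto simp: act_closed act_add_right act_smult_right)

lemma smultM_closed [simp]: "m \<in> carrier M \<Longrightarrow> c \<odot>\<^bsub>M\<^esub> m \<in> carrier M"
  using M.smult_closed[of c m] by simp

lemma rep_closed: "x \<in> carrier g \<Longrightarrow> rep x \<in> carrier (End_ring M)"
  unfolding rep_def by (auto intro!: mod_homI simp: act_closed act_add_right act_smult_right)

lemma rep_linear:
  shows "\<lbrakk>x \<in> carrier g; y \<in> carrier g\<rbrakk> \<Longrightarrow> rep (x \<oplus>\<^bsub>g\<^esub> y) = rep x \<oplus>\<^bsub>End_ring M\<^esub> rep y"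
    and "x \<in> carrier g \<Longrightarrow> rep (c \<odot>\<^bsub>g\<^esub> x) = End_scalar M c \<otimes>\<^bsub>End_ring M\<^esub> rep x"
    and "\<lbrakk>x \<in> carrier g; y \<in> carrier g\<rbrakk> \<Longrightarrow> rep x \<otimes>\<^bsub>End_ring M\<^esub> rep y =
      rep y \<otimes>\<^bsub>End_ring M\<^esub> rep x \<oplus>\<^bsub>End_ring M\<^esub> rep (br x y)"
proof -
  show "rep x \<otimes>\<^bsub>End_ring M\<^esub> rep y = rep y \<otimes>\<^bsub>End_ring M\<^esub> rep x \<oplus>\<^bsub>End_ring M\<^esub> rep (br x y)"
    if x: "x \<in> carrier g" and y: "y \<in> carrier g"
  proof
    show "(rep x \<otimes>\<^bsub>End_ring M\<^esub> rep y) m =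
        (rep y \<otimes>\<^bsub>End_ring M\<^esub> rep x \<oplus>\<^bsub>End_ring M\<^esub> rep (br x y)) m" for m
      using act_commute[OF x y, of m] x y
      by (cases "m \<in> carrier M") (auto simp: rep_def compose_def act_closed)
  qed
qed (auto simp: rep_def fun_eq_iff act_add_left act_smult_left End_scalar_def compose_def act_closed)

lemma End_is_ring: "ring (End_ring M)"
  by (rule End_ring_is_ring[OF M.module_axioms])

lemma rep_evaluation: "evaluation CC (End_ring M) (End_scalar M) (carrier g) rep"
  by (intro evaluation.intro evaluation_axioms.intro CC_cring End_is_ring
      End_scalar_hom[OF M.module_axioms] rep_closed End_scalar_central[OF M.module_axioms])

lemma rep_presented_evaluation:
  "presented_evaluation CC (End_ring M) (End_scalar M) (carrier g) rep (uea_rels g br)"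
proof -
  interpret E: evaluation CC "End_ring M" "End_scalar M" "carrier g" rep by (rule rep_evaluation)
  note gen = U.gen_closed
  show ?thesis
  proof (intro presented_evaluation.intro presented_evaluation_axioms.intro rep_evaluation uea_presentation)
    fix a b assume "(a, b) \<in> uea_rels g br"
    then show "E.ev a = E.ev b"
    proof cases
      case (uea_add x y)
      have "x \<oplus>\<^bsub>g\<^esub> y \<in> carrier g" using uea_add by simp
      then show ?thesis unfolding uea_add(1,2) using uea_add(3,4)
        by (simp only: E.ev_add[OF gen gen] E.ev_gen rep_linear)
    next
      case (uea_smult x c)
      have "c \<odot>\<^bsub>g\<^esub> x \<in> carrier g" using uea_smult smult_closed[of c x] by simp
      then show ?thesis unfolding uea_smult(1,2) using uea_smult(3)
        by (simp only: E.ev_smult[OF _ gen] E.ev_gen rep_linear CC_simps UNIV_I)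
    next
      case (uea_br x y)
      let ?F = "free_algebra CC (carrier g)"
      let ?x = "free_gen CC x" and ?y = "free_gen CC y"
      have c: "?x \<otimes>\<^bsub>?F\<^esub> ?y \<in> carrier ?F" "?y \<otimes>\<^bsub>?F\<^esub> ?x \<in> carrier ?F"
        using gen[OF uea_br(3)] gen[OF uea_br(4)] by (simp_all del: free_algebra_simps)
      have r: "rep x \<in> carrier (End_ring M)" "rep y \<in> carrier (End_ring M)" "rep (br x y) \<in> carrier (End_ring M)"
        using uea_br rep_closed br_closed by auto
      interpret h: ring_hom_ring ?F "End_ring M" E.ev
        by (rule ring_hom_ringI2[OF U.F.ring_axioms E.A.ring_axioms E.ev_hom])
      have "E.ev (?x \<otimes>\<^bsub>?F\<^esub> ?y \<ominus>\<^bsub>?F\<^esub> ?y \<otimes>\<^bsub>?F\<^esub> ?x) =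
          rep x \<otimes>\<^bsub>End_ring M\<^esub> rep y \<ominus>\<^bsub>End_ring M\<^esub> rep y \<otimes>\<^bsub>End_ring M\<^esub> rep x"
        unfolding a_minus_def using c gen[OF uea_br(3)] gen[OF uea_br(4)] uea_br(3,4)
        by (simp add: E.ev_gen del: free_algebra_simps End_ring_simps)
      also have "\<dots> = rep (br x y)"
        unfolding rep_linear(3)[OF uea_br(3,4)] using r
        by (simp add: a_minus_def E.A.a_ac E.A.r_neg E.A.r_neg1 E.A.r_neg2 del: End_ring_simps)
      finally show ?thesis unfolding uea_br(1,2) using br_closed[OF uea_br(3,4)] by (simp only: E.ev_gen)
    qed
  qed
qed

sublocale E: presented_evaluation CC "End_ring M" "End_scalar M" "carrier g" rep "uea_rels g br"
  by (rule rep_presented_evaluation)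

lemma word_prod_apply:
  "\<lbrakk>w \<in> lists (carrier g); m \<in> carrier M\<rbrakk> \<Longrightarrow> word_prod (End_ring M) rep w m = foldr act w m \<and> foldr act w m \<in> carrier M"
proof (induction w rule: list.induct)
  case Nil
  then show ?case by (simp add: word_prod_def)
next
  case (Cons x w)
  then show ?case by (simp add: word_prod_def compose_def rep_def act_closed)
qed

text \<open>
  The action of the enveloping algebra is the homomorphism given by the universal property: a word acts
  as the product of its letters.
\<close>

lemma uea_act_eq_lift:
  assumes u: "u \<in> carrier (uea g br)"
  shows "uea_act M act u = E.lift u"
proof
  fix m
  let ?p = "SOME p. p \<in> u"
  obtain q where q: "q \<in> carrier (free_algebra CC (carrier g))"
    and uq: "u = presented_class CC (carrier g) (uea_rels g br) q"
    using u U.carrier_PA unfolding uea_def by blast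
  have "q \<in> u" unfolding uq presented_class_def using q by (rule U.I.a_rcos_self)
  then have "?p \<in> u" by (rule someI[of "\<lambda>p. p \<in> u"])
  then have p: "?p \<in> carrier (free_module CC (lists (carrier g)))"
    using U.I.a_elemrcos_carrier[OF q, of ?p] unfolding uq presented_class_def by simp
  have l: "E.lift u = free_lift CC (scalar_module (End_scalar M) (End_ring M)) (word_prod (End_ring M) rep) ?p"
    unfolding E.lift_def free_eval_def ..
  show "uea_act M act u m = E.lift u m"
  proof (cases "m \<in> carrier M")
    case True
    have w: "w \<in> lists (carrier g)" if "?p w \<noteq> 0" for w
      using p that by (auto simp: free_module_carrier_iff)
    have c: "End_scalar M (?p w) \<otimes>\<^bsub>End_ring M\<^esub> word_prod (End_ring M) rep w \<in> carrier (End_ring M)"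
      if "?p w \<noteq> 0" for w
      using E.word_prod_closed[OF w[OF that]] E.\<sigma>_closed E.A.m_closed by (simp del: End_ring_simps)
    have "E.lift u m = (\<Oplus>\<^bsub>M\<^esub>w\<in>{w. ?p w \<noteq> 0}.
        (End_scalar M (?p w) \<otimes>\<^bsub>End_ring M\<^esub> word_prod (End_ring M) rep w) m)"
      unfolding l free_lift_def using c True
      by (simp del: End_ring_simps) (intro End_finsum_apply[OF M.module_axioms], auto simp del: End_ring_simps)
    also have "\<dots> = (\<Oplus>\<^bsub>M\<^esub>w\<in>{w. ?p w \<noteq> 0}. ?p w \<odot>\<^bsub>M\<^esub> foldr act w m)"
      using True word_prod_apply w
      by (intro M.finsum_cong') (auto simp: compose_def End_scalar_def)
    also have "\<dots> = uea_act M act u m" unfolding uea_act_def using True by (simp add: Let_def)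
    finally show ?thesis by simp
  next
    case False
    have "E.lift u \<in> carrier (End_ring M)"
      using ring_hom_closed[OF E.lift_hom] u unfolding uea_def by blast
    then have "E.lift u \<in> extensional (carrier M)" by simp
    then show ?thesis unfolding uea_act_def using False by (simp add: extensional_def)
  qed
qed

lemma uea_act_hom: "uea_act M act \<in> ring_hom (uea g br) (End_ring M)"
proof -
  interpret Ug: ring "uea g br" by (rule uea_is_ring)
  have "E.lift \<in> ring_hom (uea g br) (End_ring M)" using E.lift_hom unfolding uea_def .
  then show ?thesis unfolding ring_hom_def by (simp add: uea_act_eq_lift Pi_def del: End_ring_simps)
qed

lemma uea_act_incl: "x \<in> carrier g \<Longrightarrow> uea_act M act (uea_incl g br x) = rep x"
  using E.lift_gen by (simp add: uea_act_eq_lift) (simp add: uea_incl_def)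

lemma uea_act_scalar: "uea_act M act (uea_scalar c) = End_scalar M c"
  using E.lift_scalar by (simp add: uea_act_eq_lift)

lemma uea_act_closed: "\<lbrakk>u \<in> carrier (uea g br); m \<in> carrier M\<rbrakk> \<Longrightarrow> uea_act M act u m \<in> carrier M"
  using ring_hom_closed[OF uea_act_hom, of u] mod_homD(1)[of "uea_act M act u" CC M M] by simp

lemma uea_act_commute:
  assumes a: "a \<in> carrier (End_ring M)" and u: "u \<in> carrier (uea g br)"
    and gen: "\<And>x. x \<in> carrier g \<Longrightarrow> a \<otimes>\<^bsub>End_ring M\<^esub> rep x = rep x \<otimes>\<^bsub>End_ring M\<^esub> a"
  shows "a \<otimes>\<^bsub>End_ring M\<^esub> uea_act M act u = uea_act M act u \<otimes>\<^bsub>End_ring M\<^esub> a"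
  unfolding uea_act_eq_lift[OF u]
  using u unfolding uea_def
  by (rule E.lift_commute[OF a _ End_scalar_central[OF M.module_axioms a, symmetric] gen])

end

text \<open>By induction on \<open>u\<close>: the elements that \<open>\<theta>\<close> intertwines form a subalgebra.\<close>

lemma uea_act_intertwine:
  assumes M: "lie_module g br M actM" and W: "lie_module g br W actW"
    and \<theta>: "\<theta> \<in> mod_hom CC M W"
    and eq: "\<And>x m. \<lbrakk>x \<in> carrier g; m \<in> carrier M\<rbrakk> \<Longrightarrow> \<theta> (actM x m) = actW x (\<theta> m)"
    and u: "u \<in> carrier (uea g br)" and m: "m \<in> carrier M"
  shows "\<theta> (uea_act M actM u m) = uea_act W actW u (\<theta> m)"
proof -
  interpret M: lie_module g br M actM by (rule M)
  interpret W: lie_module g br W actW by (rule W)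
  note \<theta>c = mod_homD(1)[OF \<theta>]
  have "\<forall>m\<in>carrier M. \<theta> (uea_act M actM u m) = uea_act W actW u (\<theta> m)"
    using u
  proof (induction u rule: M.uea_induct)
    case (scalar c)
    then show ?case
      by (simp add: M.uea_act_scalar W.uea_act_scalar End_scalar_def \<theta>c mod_homD(3)[OF \<theta>])
  next
    case (incl x)
    then show ?case
      by (simp add: M.uea_act_incl W.uea_act_incl M.rep_def W.rep_def \<theta>c eq)
  next
    case (add a b)
    then show ?case
      by (simp add: ring_hom_add[OF M.uea_act_hom] ring_hom_add[OF W.uea_act_hom] \<theta>c
          mod_homD(2)[OF \<theta>] M.uea_act_closed)
  next
    case (mult a b)
    then show ?case
      by (simp add: ring_hom_mult[OF M.uea_act_hom] ring_hom_mult[OF W.uea_act_hom] \<theta>c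
          M.uea_act_closed compose_def)
  qed
  then show ?thesis using m by blast
qed

context quadratic_lie_algebra
begin

lemma casimir_ring_uea: "casimir_ring g br form B dual (uea g br) uea_scalar"
  by (intro casimir_ring.intro casimir_ring_axioms.intro quadratic_lie_algebra_axioms uea_is_ring
      uea_scalar_hom uea_scalar_central)

lemma casimir_closed: "casimir g br B dual \<in> carrier (uea g br)"
proof -
  interpret Ug: ring "uea g br" by (rule uea_is_ring)
  show ?thesis unfolding casimir_def by (intro Ug.finsum_closed) auto
qed

text \<open>
  The inclusion of the Lie algebra is itself a Lie homomorphism, with \<open>\<kappa>\<close> as its contraction with itself.
  So \<open>\<kappa>\<close> commutes with the Lie algebra, which generates the enveloping algebra.
\<close>

lemma casimir_central: "casimir g br B dual \<in> carrier (center_ring (uea g br))"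
proof -
  interpret Ug: casimir_ring g br form B dual "uea g br" uea_scalar by (rule casimir_ring_uea)
  have lin: "Ug.lie_hom (uea_incl g br)"
    unfolding Ug.lie_hom_def
    by (intro conjI ballI Ug.linI uea_incl_linear uea_incl_closed)
  have \<kappa>: "casimir g br B dual = Ug.\<Gamma> (uea_incl g br) (uea_incl g br)"
    unfolding casimir_def Ug.\<Gamma>_def ..
  let ?\<kappa> = "casimir g br B dual"
  have "?\<kappa> \<otimes>\<^bsub>uea g br\<^esub> u = u \<otimes>\<^bsub>uea g br\<^esub> ?\<kappa>" if "u \<in> carrier (uea g br)" for u
    using that
  proof (induction u rule: uea_induct)
    case (scalar c)
    then show ?case using uea_scalar_central[OF casimir_closed] by simp
  next
    case (incl x)
    then show ?case using Ug.casimir_commutes[OF lin] unfolding \<kappa> by simp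
  next
    case (add a b)
    then show ?case using casimir_closed by (simp add: Ug.A.l_distr Ug.A.r_distr)
  next
    case (mult a b)
    have "?\<kappa> \<otimes>\<^bsub>uea g br\<^esub> (a \<otimes>\<^bsub>uea g br\<^esub> b) = (?\<kappa> \<otimes>\<^bsub>uea g br\<^esub> a) \<otimes>\<^bsub>uea g br\<^esub> b"
      using casimir_closed mult(1,2) by (simp add: Ug.A.m_assoc)
    also have "\<dots> = a \<otimes>\<^bsub>uea g br\<^esub> (?\<kappa> \<otimes>\<^bsub>uea g br\<^esub> b)"
      unfolding mult(3) using casimir_closed mult(1,2) by (simp add: Ug.A.m_assoc)
    also have "\<dots> = a \<otimes>\<^bsub>uea g br\<^esub> b \<otimes>\<^bsub>uea g br\<^esub> ?\<kappa>"
      unfolding mult(4) using casimir_closed mult(1,2) by (simp add: Ug.A.m_assoc)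
    finally show ?case .
  qed
  then show ?thesis using casimir_closed unfolding center_ring_def by simp
qed

lemma casimir_ring_End:
  "module CC W \<Longrightarrow> casimir_ring g br form B dual (End_ring W) (End_scalar W)"
  by (intro casimir_ring.intro casimir_ring_axioms.intro quadratic_lie_algebra_axioms
      End_ring_is_ring End_scalar_hom End_scalar_central)

lemma lie_module_of_lie_hom:
  assumes W: "module CC W" and r: "casimir_ring.lie_hom g br (End_ring W) (End_scalar W) r"
  shows "lie_module g br W r"
proof -
  interpret W: module CC W by (rule W)
  interpret E: casimir_ring g br form B dual "End_ring W" "End_scalar W" by (rule casimir_ring_End[OF W])
  have lin: "E.lin r" and comm: "\<And>x y. \<lbrakk>x \<in> carrier g; y \<in> carrier g\<rbrakk> \<Longrightarrow>
      r x \<otimes>\<^bsub>End_ring W\<^esub> r y = r y \<otimes>\<^bsub>End_ring W\<^esub> r x \<oplus>\<^bsub>End_ring W\<^esub> r (br x y)"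
    using r unfolding E.lie_hom_def by blast+
  have h: "r x \<in> mod_hom CC W W" if "x \<in> carrier g" for x using E.linD(1)[OF lin that] by simp
  show ?thesis
  proof (intro lie_module.intro lie_module_axioms.intro lie_algebra_axioms W)
    fix x y m assume x: "x \<in> carrier g" and y: "y \<in> carrier g" and m: "m \<in> carrier W"
    have c: "r x (r y m) \<in> carrier W" "r y (r x m) \<in> carrier W" "r (br x y) m \<in> carrier W"
      using mod_homD(1)[OF h] x y m br_closed by auto
    have "(r x \<otimes>\<^bsub>End_ring W\<^esub> r y) m = (r y \<otimes>\<^bsub>End_ring W\<^esub> r x \<oplus>\<^bsub>End_ring W\<^esub> r (br x y)) m"
      by (simp only: comm[OF x y])
    then have "r x (r y m) = r y (r x m) \<oplus>\<^bsub>W\<^esub> r (br x y) m"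
      using m by (simp add: compose_def)
    then show "r (br x y) m = r x (r y m) \<ominus>\<^bsub>W\<^esub> r y (r x m)"
      using W.add_minus_cancel[OF c(2,3)] by simp
  next
    fix c x m assume "x \<in> carrier g" "m \<in> carrier W"
    then show "r (c \<odot>\<^bsub>g\<^esub> x) m = c \<odot>\<^bsub>W\<^esub> r x m"
      using mod_homD(1)[OF h] by (simp add: E.linD(3)[OF lin] compose_def End_scalar_def)
  next
    fix x y m assume "x \<in> carrier g" "y \<in> carrier g" "m \<in> carrier W"
    then show "r (x \<oplus>\<^bsub>g\<^esub> y) m = r x m \<oplus>\<^bsub>W\<^esub> r y m"
      by (simp add: E.linD(2)[OF lin])
  next
    fix x m n assume x: "x \<in> carrier g" and m: "m \<in> carrier W" and n: "n \<in> carrier W"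
    show "r x m \<in> carrier W" by (rule mod_homD(1)[OF h[OF x] m])
    show "r x (m \<oplus>\<^bsub>W\<^esub> n) = r x m \<oplus>\<^bsub>W\<^esub> r x n" by (rule mod_homD(2)[OF h[OF x] m n])
    show "r x (c \<odot>\<^bsub>W\<^esub> m) = c \<odot>\<^bsub>W\<^esub> r x m" for c
      by (rule mod_homD(3)[OF h[OF x] _ m]) simp
  qed
qed

lemma uea_act_casimir:
  assumes "lie_module g br W actW"
  shows "uea_act W actW (casimir g br B dual) =
    (\<Oplus>\<^bsub>End_ring W\<^esub>b\<in>B. lie_module.rep W actW b \<otimes>\<^bsub>End_ring W\<^esub> lie_module.rep W actW (dual b))"
proof -
  interpret W: lie_module g br W actW by (rule assms)
  interpret Ug: ring "uea g br" by (rule uea_is_ring)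
  interpret h: ring_hom_ring "uea g br" "End_ring W" "uea_act W actW"
    by (rule ring_hom_ringI2[OF Ug.ring_axioms W.E.A.ring_axioms W.uea_act_hom])
  have "uea_act W actW (casimir g br B dual) =
      (\<Oplus>\<^bsub>End_ring W\<^esub>b\<in>B. uea_act W actW (uea_incl g br b \<otimes>\<^bsub>uea g br\<^esub> uea_incl g br (dual b)))"
    unfolding casimir_def by (subst h.hom_finsum) (auto simp: comp_def)
  also have "\<dots> = (\<Oplus>\<^bsub>End_ring W\<^esub>b\<in>B. W.rep b \<otimes>\<^bsub>End_ring W\<^esub> W.rep (dual b))"
    by (intro W.E.A.finsum_cong') (auto simp: W.uea_act_incl W.rep_closed simp del: End_ring_simps)
  finally show ?thesis .
qed

end

section \<open>Operators on the tensor space\<close>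

context tensor
begin

lemma multilinear_left:
  assumes a: "a \<in> mod_hom CC M M"
  shows "multilinear M V k TT (\<lambda>m vs. pure (a m) vs)"
  unfolding multilinear_def
proof (intro conjI ballI allI impI)
  fix vs assume vs: "vs \<in> tuples V k"
  show "(\<lambda>m. pure (a m) vs) \<in> mod_hom CC M TT"
    using mod_homD[OF a] mod_homD[OF pure_linear_left[OF vs]] by (intro mod_homI) auto
next
  fix m vs j assume "m \<in> carrier M" "vs \<in> tuples V k" "j < k"
  then show "(\<lambda>v. pure (a m) (vs[j := v])) \<in> mod_hom CC V TT"
    using pure_linear_right mod_homD(1)[OF a] by blast
qed

lemma multilinear_right:
  assumes b: "b \<in> mod_hom CC V V" and j: "j < k"
  shows "multilinear M V k TT (\<lambda>m vs. pure m (vs[j := b (vs ! j)]))"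
  unfolding multilinear_def
proof (intro conjI ballI allI impI)
  fix vs assume vs: "vs \<in> tuples V k"
  show "(\<lambda>m. pure m (vs[j := b (vs ! j)])) \<in> mod_hom CC M TT"
    using vs j mod_homD(1)[OF b] by (intro pure_linear_left) auto
next
  fix m vs i assume m: "m \<in> carrier M" and vs: "vs \<in> tuples V k" and i: "i < k"
  show "(\<lambda>v. pure m (vs[i := v, j := b (vs[i := v] ! j)])) \<in> mod_hom CC V TT"
  proof (cases "i = j")
    case True
    then have "(\<lambda>v. pure m (vs[i := v, j := b (vs[i := v] ! j)])) = (\<lambda>v. pure m (vs[j := b v]))"
      using i tuples_length[OF vs] by (auto simp: fun_eq_iff)
    moreover have "(\<lambda>v. pure m (vs[j := b v])) \<in> mod_hom CC V TT"
      using mod_homD[OF b] mod_homD[OF pure_linear_right[OF m vs j]] by (intro mod_homI) auto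
    ultimately show ?thesis by simp
  next
    case False
    then have "(\<lambda>v. pure m (vs[i := v, j := b (vs[i := v] ! j)])) =
        (\<lambda>v. pure m ((vs[j := b (vs ! j)])[i := v]))"
      by (auto simp: fun_eq_iff list_update_swap)
    moreover have "vs[j := b (vs ! j)] \<in> tuples V k" using vs j mod_homD(1)[OF b] by simp
    ultimately show ?thesis using pure_linear_right[OF m _ i] by simp
  qed
qed

end

text \<open>
  The vector in place \<open>j\<close> is moved to place \<open>u(j)\<close>. Permutations act on \<open>{1..k}\<close> while list positions
  start at \<open>0\<close>, which accounts for the shifts by one.
\<close>

definition permute_tuple :: "nat \<Rightarrow> (nat \<Rightarrow> nat) \<Rightarrow> 'v list \<Rightarrow> 'v list"
  where "permute_tuple k u vs = map (\<lambda>j. vs ! (inv_into UNIV u j - 1)) [1..<Suc k]"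

lemma permute_tuple_length [simp]: "length (permute_tuple k u vs) = k"
  unfolding permute_tuple_def by simp

lemma permute_tuple_nth: "j < k \<Longrightarrow> permute_tuple k u vs ! j = vs ! (inv_into UNIV u (Suc j) - 1)"
  unfolding permute_tuple_def by (simp del: upt_Suc)

lemma permutes_Suc_bounds:
  assumes "u permutes {1..k}" "j < (k::nat)"
  shows "u (Suc j) - 1 < k" "Suc (u (Suc j) - 1) = u (Suc j)"
  using permutes_in_image[OF assms(1), of "Suc j"] assms(2) by auto

lemma permute_tuple_closed:
  assumes u: "u permutes {1..k}" and vs: "vs \<in> tuples V k"
  shows "permute_tuple k u vs \<in> tuples V k"
proof -
  have "permute_tuple k u vs ! j \<in> carrier V" if "j < k" for j
    using vs permutes_Suc_bounds(1)[OF permutes_inv[OF u] that] that by (simp add: permute_tuple_nth)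
  then show ?thesis unfolding tuples_def by (auto simp: in_set_conv_nth)
qed

lemma permute_tuple_at:
  assumes u: "u permutes {1..k}" and j: "j < k"
  shows "permute_tuple k u vs ! (u (Suc j) - 1) = vs ! j"
  using permutes_Suc_bounds[OF u j] permutes_inverses(2)[OF u] by (simp add: permute_tuple_nth)

lemma permute_tuple_update:
  assumes u: "u permutes {1..k}" and j: "j < k" and l: "length vs = k"
  shows "permute_tuple k u (vs[j := v]) = (permute_tuple k u vs)[u (Suc j) - 1 := v]"
proof (rule nth_equalityI)
  fix i assume "i < length (permute_tuple k u (vs[j := v]))"
  then have i: "i < k" by simp
  note b = permutes_Suc_bounds[OF permutes_inv[OF u] i] and b' = permutes_Suc_bounds[OF u j]
  have "inv_into UNIV u (Suc i) - 1 = j \<longleftrightarrow> u (Suc j) - 1 = i"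
    using b(2) b'(2) permutes_inverses[OF u] by (metis Suc_inject diff_Suc_1)
  then show "permute_tuple k u (vs[j := v]) ! i = (permute_tuple k u vs)[u (Suc j) - 1 := v] ! i"
    using i b(1) b'(1) l by (auto simp: permute_tuple_nth nth_list_update)
qed simp

lemma permute_tuple_comp:
  assumes u: "u permutes {1..k}" and v: "v permutes {1..k}"
  shows "permute_tuple k u (permute_tuple k v vs) = permute_tuple k (u \<circ> v) vs"
proof (rule nth_equalityI)
  fix i assume "i < length (permute_tuple k u (permute_tuple k v vs))"
  then have i: "i < k" by simp
  have "inv_into UNIV (u \<circ> v) = inv_into UNIV v \<circ> inv_into UNIV u"
    by (rule o_inv_distrib[OF permutes_bij[OF u] permutes_bij[OF v]])
  then show "permute_tuple k u (permute_tuple k v vs) ! i = permute_tuple k (u \<circ> v) vs ! i"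
    using i permutes_Suc_bounds[OF permutes_inv[OF u] i] by (simp add: permute_tuple_nth)
qed simp

lemma permute_tuple_id: "length vs = k \<Longrightarrow> permute_tuple k id vs = vs"
  by (rule nth_equalityI) (auto simp: permute_tuple_nth)

context tensor
begin

lemma multilinear_permute:
  assumes u: "u permutes {1..k}"
  shows "multilinear M V k TT (\<lambda>m vs. pure m (permute_tuple k u vs))"
  unfolding multilinear_def
proof (intro conjI ballI allI impI)
  fix vs assume vs: "vs \<in> tuples V k"
  show "(\<lambda>m. pure m (permute_tuple k u vs)) \<in> mod_hom CC M TT"
    by (rule pure_linear_left[OF permute_tuple_closed[OF u vs]])
next
  fix m vs j assume m: "m \<in> carrier M" and vs: "vs \<in> tuples V k" and j: "j < k"
  show "(\<lambda>v. pure m (permute_tuple k u (vs[j := v]))) \<in> mod_hom CC V TT"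
    unfolding permute_tuple_update[OF u j tuples_length[OF vs]]
    by (rule pure_linear_right[OF m permute_tuple_closed[OF u vs] permutes_Suc_bounds(1)[OF u j]])
qed

lemma lift_End:
  "multilinear M V k TT f \<Longrightarrow> tensor_lift M V k TT f \<in> carrier (End_ring TT)"
  using tensor_lift_mod_hom[OF TT_module] tensor_lift_extensional[OF TT_module] by simp

lemma End_eqI:
  assumes a: "a \<in> carrier (End_ring TT)" and b: "b \<in> carrier (End_ring TT)"
    and eq: "\<And>m vs. \<lbrakk>m \<in> carrier M; vs \<in> tuples V k\<rbrakk> \<Longrightarrow> a (pure m vs) = b (pure m vs)"
  shows "a = b"
proof (rule extensionalityI)
  show "a \<in> extensional (carrier TT)" "b \<in> extensional (carrier TT)" using a b by auto
  show "a t = b t" if "t \<in> carrier TT" for t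
    by (rule mod_hom_tensor_eqI[OF TT_module, where h = a and h' = b]) (use a b eq that in auto)
qed

lemma End_apply_closed: "\<lbrakk>a \<in> carrier (End_ring TT); t \<in> carrier TT\<rbrakk> \<Longrightarrow> a t \<in> carrier TT"
  using mod_homD(1)[of a CC TT TT] by simp

end

locale tensor_action = quadratic_lie_algebra g br form B dual
    + M: lie_module g br M actM + V: lie_module g br V actV
  for g :: "(complex, 'g) module" and br form B dual
    and M :: "(complex, 'm) module" and actM and V :: "(complex, 'v) module" and actV +
  fixes k :: nat
begin

sublocale T: tensor M V k
  by (intro tensor.intro M.M.module_axioms V.M.module_axioms)

abbreviation "T \<equiv> tensor_space M V k"
abbreviation "pure \<equiv> pure_tensor M V k"

text \<open>
  The action on factor \<open>p\<close> of \<open>M \<otimes> V\<^sup>k\<close>, where factor \<open>0\<close> is \<open>M\<close> and factor \<open>p > 0\<close> is entry \<open>p - 1\<close>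
  of the list.
\<close>

definition act_at :: "nat \<Rightarrow> 'g \<Rightarrow> 'm \<Rightarrow> 'v list \<Rightarrow> ('m \<times> 'v list \<Rightarrow> complex) set"
  where "act_at p x m vs =
    (if p = 0 then pure (actM x m) vs else pure m (vs[p - 1 := actV x (vs ! (p - 1))]))"

definition \<rho> :: "nat \<Rightarrow> 'g \<Rightarrow> ('m \<times> 'v list \<Rightarrow> complex) set \<Rightarrow> ('m \<times> 'v list \<Rightarrow> complex) set"
  where "\<rho> p x = tensor_lift M V k T (act_at p x)"

definition \<tau> :: "(nat \<Rightarrow> nat) \<Rightarrow> ('m \<times> 'v list \<Rightarrow> complex) set \<Rightarrow> ('m \<times> 'v list \<Rightarrow> complex) set"
  where "\<tau> u = tensor_lift M V k T (\<lambda>m vs. pure m (permute_tuple k u vs))"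

lemma act_at_multilinear:
  assumes "p \<le> k" and x: "x \<in> carrier g"
  shows "multilinear M V k T (act_at p x)"
proof (cases "p = 0")
  case True
  then have "act_at p x = (\<lambda>m vs. pure (actM x m) vs)" by (simp add: act_at_def fun_eq_iff)
  then show ?thesis using T.multilinear_left[OF M.act_mod_hom[OF x]] by simp
next
  case False
  then have "act_at p x = (\<lambda>m vs. pure m (vs[p - 1 := actV x (vs ! (p - 1))]))"
    by (simp add: act_at_def fun_eq_iff)
  then show ?thesis using T.multilinear_right[OF V.act_mod_hom[OF x], of "p - 1"] False assms by simp
qed

lemma \<rho>_closed: "\<lbrakk>p \<le> k; x \<in> carrier g\<rbrakk> \<Longrightarrow> \<rho> p x \<in> carrier (End_ring T)"
  unfolding \<rho>_def by (rule T.lift_End[OF act_at_multilinear])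

lemma \<rho>_pure:
  "\<lbrakk>p \<le> k; x \<in> carrier g; m \<in> carrier M; vs \<in> tuples V k\<rbrakk> \<Longrightarrow> \<rho> p x (pure m vs) = act_at p x m vs"
  unfolding \<rho>_def by (rule T.tensor_lift_pure[OF T.TT_module act_at_multilinear])

lemma \<rho>_0_pure:
  "\<lbrakk>x \<in> carrier g; m \<in> carrier M; vs \<in> tuples V k\<rbrakk> \<Longrightarrow> \<rho> 0 x (pure m vs) = pure (actM x m) vs"
  by (simp add: \<rho>_pure act_at_def)

lemma \<rho>_Suc_pure:
  "\<lbrakk>j < k; x \<in> carrier g; m \<in> carrier M; vs \<in> tuples V k\<rbrakk>
    \<Longrightarrow> \<rho> (Suc j) x (pure m vs) = pure m (vs[j := actV x (vs ! j)])"
  by (simp add: \<rho>_pure act_at_def)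

lemma \<tau>_closed: "u permutes {1..k} \<Longrightarrow> \<tau> u \<in> carrier (End_ring T)"
  unfolding \<tau>_def by (rule T.lift_End[OF T.multilinear_permute])

lemma \<tau>_pure: "\<lbrakk>u permutes {1..k}; m \<in> carrier M; vs \<in> tuples V k\<rbrakk>
    \<Longrightarrow> \<tau> u (pure m vs) = pure m (permute_tuple k u vs)"
  unfolding \<tau>_def by (rule T.tensor_lift_pure[OF T.TT_module T.multilinear_permute])

sublocale C: casimir_ring g br form B dual "End_ring T" "End_scalar T"
  by (rule casimir_ring_End[OF T.TT_module])

lemma End_mult_pure:
  "\<lbrakk>m \<in> carrier M; vs \<in> tuples V k\<rbrakk>
    \<Longrightarrow> (a \<otimes>\<^bsub>End_ring T\<^esub> b) (pure m vs) = a (b (pure m vs))"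
  by (simp add: compose_def)

lemma End_add_pure:
  "\<lbrakk>m \<in> carrier M; vs \<in> tuples V k\<rbrakk>
    \<Longrightarrow> (a \<oplus>\<^bsub>End_ring T\<^esub> b) (pure m vs) = a (pure m vs) \<oplus>\<^bsub>T\<^esub> b (pure m vs)"
  by simp

lemma \<rho>_lie_hom:
  assumes p: "p \<le> k"
  shows "C.lie_hom (\<rho> p)"
  unfolding C.lie_hom_def
proof (intro conjI ballI C.linI)
  fix x y assume x: "x \<in> carrier g" and y: "y \<in> carrier g"
  show c: "\<rho> p x \<in> carrier (End_ring T)" by (rule \<rho>_closed[OF p x])
  have c': "\<rho> p y \<in> carrier (End_ring T)" by (rule \<rho>_closed[OF p y])
  have br: "br x y \<in> carrier g" and xy: "x \<oplus>\<^bsub>g\<^esub> y \<in> carrier g" using x y br_closed by auto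
  have cbr: "\<rho> p (br x y) \<in> carrier (End_ring T)" by (rule \<rho>_closed[OF p br])
  show "\<rho> p (x \<oplus>\<^bsub>g\<^esub> y) = \<rho> p x \<oplus>\<^bsub>End_ring T\<^esub> \<rho> p y"
  proof (rule T.End_eqI)
    fix m vs assume m: "m \<in> carrier M" and vs: "vs \<in> tuples V k"
    show "\<rho> p (x \<oplus>\<^bsub>g\<^esub> y) (pure m vs) = (\<rho> p x \<oplus>\<^bsub>End_ring T\<^esub> \<rho> p y) (pure m vs)"
    proof (cases p)
      case 0
      then show ?thesis using x y m vs xy
        by (simp only: End_add_pure \<rho>_0_pure M.act_add_left
            mod_homD(2)[OF T.pure_linear_left[OF vs]] M.act_closed)
    next
      case (Suc j)
      then have j: "j < k" using p by simp
      show ?thesis unfolding Suc using x y m vs xy j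
        by (simp only: End_add_pure \<rho>_Suc_pure V.act_add_left tuples_nth
            mod_homD(2)[OF T.pure_linear_right[OF m vs j]] V.act_closed)
    qed
  qed (use c c' C.A.a_closed \<rho>_closed[OF p xy] in blast)+
  show "\<rho> p x \<otimes>\<^bsub>End_ring T\<^esub> \<rho> p y =
      \<rho> p y \<otimes>\<^bsub>End_ring T\<^esub> \<rho> p x \<oplus>\<^bsub>End_ring T\<^esub> \<rho> p (br x y)"
  proof (rule T.End_eqI)
    fix m vs assume m: "m \<in> carrier M" and vs: "vs \<in> tuples V k"
    show "(\<rho> p x \<otimes>\<^bsub>End_ring T\<^esub> \<rho> p y) (pure m vs) =
        (\<rho> p y \<otimes>\<^bsub>End_ring T\<^esub> \<rho> p x \<oplus>\<^bsub>End_ring T\<^esub> \<rho> p (br x y)) (pure m vs)"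
    proof (cases p)
      case 0
      then show ?thesis using x y m vs br
        by (simp only: End_add_pure End_mult_pure \<rho>_0_pure M.act_closed M.act_commute[OF x y m]
            mod_homD(2)[OF T.pure_linear_left[OF vs]])
    next
      case (Suc j)
      then have j: "j < k" using p by simp
      have v: "vs ! j \<in> carrier V" using vs j by simp
      have up: "vs[j := actV x (vs ! j)] \<in> tuples V k" "vs[j := actV y (vs ! j)] \<in> tuples V k"
        using vs v x y V.act_closed by auto
      have l: "j < length vs" using j tuples_length[OF vs] by simp
      show ?thesis unfolding Suc using x y m vs br j v up l
        by (simp only: End_add_pure End_mult_pure \<rho>_Suc_pure nth_list_update_eq list_update_overwrite
            V.act_commute[OF x y v] mod_homD(2)[OF T.pure_linear_right[OF m vs j]] V.act_closed)
    qed
  qed (use c c' cbr C.A.a_closed C.A.m_closed in blast)+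
next
  fix c x assume x: "x \<in> carrier g"
  have cx: "c \<odot>\<^bsub>g\<^esub> x \<in> carrier g" using x by simp
  note r = \<rho>_closed[OF p x]
  show "\<rho> p (c \<odot>\<^bsub>g\<^esub> x) = End_scalar T c \<otimes>\<^bsub>End_ring T\<^esub> \<rho> p x"
  proof (rule T.End_eqI)
    show "End_scalar T c \<otimes>\<^bsub>End_ring T\<^esub> \<rho> p x \<in> carrier (End_ring T)"
      by (rule C.A.m_closed[OF C.\<sigma>_closed r])
    fix m vs assume m: "m \<in> carrier M" and vs: "vs \<in> tuples V k"
    have *: "(End_scalar T c \<otimes>\<^bsub>End_ring T\<^esub> \<rho> p x) (pure m vs) = c \<odot>\<^bsub>T\<^esub> \<rho> p x (pure m vs)"
      unfolding End_mult_pure[OF m vs] End_scalar_def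
      using T.End_apply_closed[OF r T.pure_closed[OF m vs]] by simp
    show "\<rho> p (c \<odot>\<^bsub>g\<^esub> x) (pure m vs) = (End_scalar T c \<otimes>\<^bsub>End_ring T\<^esub> \<rho> p x) (pure m vs)"
      unfolding *
    proof (cases p)
      case 0
      then show "\<rho> p (c \<odot>\<^bsub>g\<^esub> x) (pure m vs) = c \<odot>\<^bsub>T\<^esub> \<rho> p x (pure m vs)"
        using x m vs cx mod_homD(3)[OF T.pure_linear_left[OF vs], of c "actM x m"]
        by (simp add: \<rho>_0_pure M.act_smult_left M.act_closed)
    next
      case (Suc j)
      then have j: "j < k" using p by simp
      show "\<rho> p (c \<odot>\<^bsub>g\<^esub> x) (pure m vs) = c \<odot>\<^bsub>T\<^esub> \<rho> p x (pure m vs)"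
        unfolding Suc using x m vs cx j mod_homD(3)[OF T.pure_linear_right[OF m vs j], of c "actV x (vs ! j)"]
        by (simp add: \<rho>_Suc_pure V.act_smult_left V.act_closed)
    qed
  qed (rule \<rho>_closed[OF p cx])
qed

lemma \<rho>_commute_pure:
  assumes "p \<le> k" "q \<le> k" "p < q" and x: "x \<in> carrier g" and y: "y \<in> carrier g"
    and m: "m \<in> carrier M" and vs: "vs \<in> tuples V k"
  shows "\<rho> p x (\<rho> q y (pure m vs)) = \<rho> q y (\<rho> p x (pure m vs))"
proof -
  obtain j where q: "q = Suc j" and j: "j < k" using assms by (cases q) auto
  have yv: "actV y (vs ! j) \<in> carrier V" using y vs j V.act_closed by simp
  show ?thesis
  proof (cases p)
    case 0
    then show ?thesis unfolding q using x y m vs j yv by (simp add: \<rho>_0_pure \<rho>_Suc_pure M.act_closed)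
  next
    case (Suc i)
    then have i: "i < k" "i \<noteq> j" "j \<noteq> i" using assms q by auto
    have "actV x (vs ! i) \<in> carrier V" using x vs i V.act_closed by simp
    then show ?thesis unfolding q Suc using x y m vs j yv i
      by (simp add: \<rho>_Suc_pure list_update_swap[OF i(2)])
  qed
qed

text \<open>The required identities are equalities of endomorphisms, so they are checked on pure tensors.\<close>

sublocale braid_family g br form B dual "End_ring T" "End_scalar T" k \<rho> \<tau>
proof (intro braid_family.intro braid_family_axioms.intro C.casimir_ring_axioms)
  fix p assume "p \<le> k"
  then show "C.lie_hom (\<rho> p)" by (rule \<rho>_lie_hom)
next
  fix p q x y assume p: "p \<le> k" "q \<le> k" "p \<noteq> q" and x: "x \<in> carrier g" and y: "y \<in> carrier g"
  show "\<rho> p x \<otimes>\<^bsub>End_ring T\<^esub> \<rho> q y = \<rho> q y \<otimes>\<^bsub>End_ring T\<^esub> \<rho> p x"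
  proof (rule T.End_eqI)
    fix m vs assume m: "m \<in> carrier M" and vs: "vs \<in> tuples V k"
    show "(\<rho> p x \<otimes>\<^bsub>End_ring T\<^esub> \<rho> q y) (pure m vs) = (\<rho> q y \<otimes>\<^bsub>End_ring T\<^esub> \<rho> p x) (pure m vs)"
      unfolding End_mult_pure[OF m vs]
      using \<rho>_commute_pure[OF p(1,2) _ x y m vs] \<rho>_commute_pure[OF p(2,1) _ y x m vs] p(3)
      by (cases "p < q") auto
  qed (use \<rho>_closed p x y C.A.m_closed in blast)+
next
  fix w assume "w permutes {1..k}"
  then show "\<tau> w \<in> carrier (End_ring T)" by (rule \<tau>_closed)
next
  show "\<tau> id = \<one>\<^bsub>End_ring T\<^esub>"
  proof (rule T.End_eqI)
    show "\<tau> id \<in> carrier (End_ring T)" by (rule \<tau>_closed[OF permutes_id])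
    fix m vs assume m: "m \<in> carrier M" and vs: "vs \<in> tuples V k"
    then show "\<tau> id (pure m vs) = \<one>\<^bsub>End_ring T\<^esub> (pure m vs)"
      by (simp add: \<tau>_pure[OF permutes_id] permute_tuple_id tuples_length)
  qed (rule C.A.one_closed)
next
  fix u v assume u: "u permutes {1..k}" and v: "v permutes {1..k}"
  show "\<tau> u \<otimes>\<^bsub>End_ring T\<^esub> \<tau> v = \<tau> (u \<circ> v)"
  proof (rule T.End_eqI)
    fix m vs assume m: "m \<in> carrier M" and vs: "vs \<in> tuples V k"
    show "(\<tau> u \<otimes>\<^bsub>End_ring T\<^esub> \<tau> v) (pure m vs) = \<tau> (u \<circ> v) (pure m vs)"
      unfolding End_mult_pure[OF m vs] \<tau>_pure[OF v m vs] \<tau>_pure[OF u m permute_tuple_closed[OF v vs]]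
        \<tau>_pure[OF permutes_compose[OF v u] m vs] permute_tuple_comp[OF u v] ..
  qed (use \<tau>_closed u v permutes_compose[OF v u] C.A.m_closed in blast)+
next
  fix w p x assume w: "w permutes {1..k}" and p: "p \<le> k" and x: "x \<in> carrier g"
  show "\<tau> w \<otimes>\<^bsub>End_ring T\<^esub> \<rho> p x = \<rho> (w p) x \<otimes>\<^bsub>End_ring T\<^esub> \<tau> w"
  proof (rule T.End_eqI)
    fix m vs assume m: "m \<in> carrier M" and vs: "vs \<in> tuples V k"
    note pv = permute_tuple_closed[OF w vs]
    show "(\<tau> w \<otimes>\<^bsub>End_ring T\<^esub> \<rho> p x) (pure m vs) = (\<rho> (w p) x \<otimes>\<^bsub>End_ring T\<^esub> \<tau> w) (pure m vs)"
      unfolding End_mult_pure[OF m vs] \<tau>_pure[OF w m vs]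
    proof (cases p)
      case 0
      have w0: "w 0 = 0" using permutes_not_in[OF w, of 0] by simp
      show "\<tau> w (\<rho> p x (pure m vs)) = \<rho> (w p) x (pure m (permute_tuple k w vs))"
        unfolding 0 w0 using x m vs pv w by (simp add: \<rho>_0_pure \<tau>_pure M.act_closed)
    next
      case (Suc j)
      then have j: "j < k" using p by simp
      note b = permutes_Suc_bounds[OF w j]
      have xv: "actV x (vs ! j) \<in> carrier V" using x vs j V.act_closed by simp
      have "\<rho> (w (Suc j)) x (pure m (permute_tuple k w vs)) =
          \<rho> (Suc (w (Suc j) - 1)) x (pure m (permute_tuple k w vs))" using b(2) by simp
      also have "\<dots> = pure m ((permute_tuple k w vs)[w (Suc j) - 1 := actV x (vs ! j)])"
        unfolding \<rho>_Suc_pure[OF b(1) x m pv] permute_tuple_at[OF w j] ..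
      also have "\<dots> = \<tau> w (\<rho> (Suc j) x (pure m vs))"
        unfolding \<rho>_Suc_pure[OF j x m vs] \<tau>_pure[OF w m tuples_update[OF vs xv]]
          permute_tuple_update[OF w j tuples_length[OF vs]] ..
      finally show "\<tau> w (\<rho> p x (pure m vs)) = \<rho> (w p) x (pure m (permute_tuple k w vs))"
        unfolding Suc ..
    qed
  qed (use \<tau>_closed[OF w] \<rho>_closed[OF p x] \<rho>_closed[OF permutes_atMost[OF w p] x] C.A.m_closed in blast)+
qed

end

section \<open>The actions of the braid algebras\<close>

lemma mod_hom_comp:
  assumes "f \<in> mod_hom R M N" "h \<in> mod_hom R N W"
  shows "(\<lambda>x. h (f x)) \<in> mod_hom R M W"
  using mod_homD[OF assms(1)] mod_homD[OF assms(2)] by (intro mod_homI) auto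

lemma mod_hom_cong:
  assumes "module R M" "f \<in> mod_hom R M W" "\<And>x. x \<in> carrier M \<Longrightarrow> f x = f' x"
  shows "f' \<in> mod_hom R M W"
proof -
  interpret M: module R M by fact
  show ?thesis
    using mod_homD[OF assms(2)] by (intro mod_homI) (simp_all add: assms(3)[symmetric])
qed

context tensor
begin

lemma multilinear_cong:
  assumes "multilinear M V k W f" and "\<And>m vs. \<lbrakk>m \<in> carrier M; vs \<in> tuples V k\<rbrakk> \<Longrightarrow> f m vs = f' m vs"
  shows "multilinear M V k W f'"
  unfolding multilinear_def
proof (intro conjI ballI allI impI)
  fix vs assume vs: "vs \<in> tuples V k"
  show "(\<lambda>m. f' m vs) \<in> mod_hom CC M W"
    by (rule mod_hom_cong[OF M.module_axioms multilinearD(1)[OF assms(1) vs]]) (rule assms(2)[OF _ vs])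
next
  fix m vs j assume m: "m \<in> carrier M" and vs: "vs \<in> tuples V k" and j: "j < k"
  show "(\<lambda>v. f' m (vs[j := v])) \<in> mod_hom CC V W"
    by (rule mod_hom_cong[OF V.module_axioms multilinearD(2)[OF assms(1) m vs j]])
      (rule assms(2)[OF m tuples_update[OF vs]])
qed

lemma multilinear_comp_pure:
  assumes "h \<in> mod_hom CC TT W"
  shows "multilinear M V k W (\<lambda>m vs. h (pure m vs))"
  unfolding multilinear_def
  using mod_hom_comp[OF pure_linear_left assms] mod_hom_comp[OF pure_linear_right assms] by blast

end

lemma (in evaluation) ev_minus:
  assumes "p \<in> carrier (free_algebra R S)" "q \<in> carrier (free_algebra R S)"
  shows "ev (p \<ominus>\<^bsub>free_algebra R S\<^esub> q) = ev p \<ominus>\<^bsub>A\<^esub> ev q"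
proof -
  interpret h: ring_hom_ring "free_algebra R S" A ev
    by (rule ring_hom_ringI2[OF F.ring_axioms A.ring_axioms ev_hom])
  show ?thesis unfolding a_minus_def using assms by (simp del: free_algebra_simps)
qed

lemma (in ring) center_ring_hom:
  assumes h: "h \<in> ring_hom R A"
  shows "h \<in> ring_hom (center_ring R) A"
proof (rule ring_hom_memI)
  fix x y assume "x \<in> carrier (center_ring R)" "y \<in> carrier (center_ring R)"
  then have x: "x \<in> carrier R" and y: "y \<in> carrier R" unfolding center_ring_def by simp_all
  show "h x \<in> carrier A" by (rule ring_hom_closed[OF h x])
  show "h (x \<otimes>\<^bsub>center_ring R\<^esub> y) = h x \<otimes>\<^bsub>A\<^esub> h y" "h (x \<oplus>\<^bsub>center_ring R\<^esub> y) = h x \<oplus>\<^bsub>A\<^esub> h y"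
    unfolding center_ring_def using ring_hom_mult[OF h x y] ring_hom_add[OF h x y] by simp_all
next
  show "h \<one>\<^bsub>center_ring R\<^esub> = \<one>\<^bsub>A\<^esub>" unfolding center_ring_def using ring_hom_one[OF h] by simp
qed

lemma rep_eq:
  assumes "lie_module g br W r" and "r x \<in> carrier (End_ring W)"
  shows "lie_module.rep W r x = r x"
  unfolding lie_module.rep_def[OF assms(1)] using assms(2) by (simp add: extensional_restrict)

lemma lie_module_cong:
  assumes "lie_module g br W act" and eq: "\<And>x. x \<in> carrier g \<Longrightarrow> act' x = act x"
  shows "lie_module g br W act'"
proof -
  interpret W: lie_module g br W act by fact
  show ?thesis
    by (intro lie_module.intro lie_module_axioms.intro W.lie_algebra_axioms W.M.module_axioms)
      (simp_all add: eq W.act_closed W.act_add_left W.act_smult_left W.act_add_right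
        W.act_smult_right W.act_br W.br_closed)
qed

declare End_ring_simps [simp del] free_algebra_simps [simp del]

context tensor_action
begin

abbreviation "E \<equiv> End_ring T"
abbreviation "Ug \<equiv> uea g br"
abbreviation "\<kappa> \<equiv> casimir g br B dual"
abbreviation "\<Delta> \<equiv> tensor_act M actM V actV k"
abbreviation "Z \<equiv> center_ring Ug"

lemma finsum_pure:
  assumes "f \<in> I \<rightarrow> carrier E" "m \<in> carrier M" "vs \<in> tuples V k"
  shows "(\<Oplus>\<^bsub>E\<^esub>i\<in>I. f i) (pure m vs) = (\<Oplus>\<^bsub>T\<^esub>i\<in>I. f i (pure m vs))"
  by (rule End_finsum_apply[OF T.TT_module assms(1) T.pure_closed[OF assms(2,3)]])

lemma gam_pure:
  assumes "p \<le> k" "q \<le> k" and m: "m \<in> carrier M" and vs: "vs \<in> tuples V k"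
  shows "gam p q (pure m vs) = (\<Oplus>\<^bsub>T\<^esub>b\<in>B. \<rho> p b (\<rho> q (dual b) (pure m vs)))"
proof -
  have "gam p q (pure m vs) = (\<Oplus>\<^bsub>T\<^esub>b\<in>B. (\<rho> p b \<otimes>\<^bsub>E\<^esub> \<rho> q (dual b)) (pure m vs))"
    unfolding gam_def C.\<Gamma>_def using assms \<rho>_closed C.A.m_closed
    by (intro finsum_pure) auto
  then show ?thesis using m vs by (simp only: End_mult_pure)
qed

lemma gam_Suc_Suc_pure:
  assumes l: "l < k" "n < k" "l \<noteq> n" and m: "m \<in> carrier M" and vs: "vs \<in> tuples V k"
  shows "gam (Suc l) (Suc n) (pure m vs) =
    (\<Oplus>\<^bsub>T\<^esub>b\<in>B. pure m (vs[l := actV b (vs ! l), n := actV (dual b) (vs ! n)]))"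
proof -
  have c: "actV b (vs ! l) \<in> carrier V" "actV (dual b) (vs ! n) \<in> carrier V" if "b \<in> B" for b
    using that l vs V.act_closed by auto
  have "\<rho> (Suc l) b (\<rho> (Suc n) (dual b) (pure m vs)) =
      pure m (vs[l := actV b (vs ! l), n := actV (dual b) (vs ! n)])" if b: "b \<in> B" for b
    using b l m vs c[OF b] by (simp add: \<rho>_Suc_pure list_update_swap[OF l(3)])
  then show ?thesis
    using l m vs c by (subst gam_pure) (simp_all, intro T.TT.finsum_cong' refl, auto)
qed

lemma gam_0_Suc_pure:
  assumes l: "l < k" and m: "m \<in> carrier M" and vs: "vs \<in> tuples V k"
  shows "gam 0 (Suc l) (pure m vs) = (\<Oplus>\<^bsub>T\<^esub>b\<in>B. pure (actM b m) (vs[l := actV (dual b) (vs ! l)]))"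
proof -
  have c: "actM b m \<in> carrier M" "actV (dual b) (vs ! l) \<in> carrier V" if "b \<in> B" for b
    using that l vs m V.act_closed M.act_closed by auto
  have "\<rho> 0 b (\<rho> (Suc l) (dual b) (pure m vs)) = pure (actM b m) (vs[l := actV (dual b) (vs ! l)])"
    if b: "b \<in> B" for b
    using b l m vs c[OF b] by (simp add: \<rho>_Suc_pure \<rho>_0_pure)
  then show ?thesis
    using l m vs c by (subst gam_pure) (simp_all, intro T.TT.finsum_cong' refl, auto)
qed

lemma \<rho>_lie_module: "p \<le> k \<Longrightarrow> lie_module g br T (\<rho> p)"
  by (rule lie_module_of_lie_hom[OF T.TT_module \<rho>_lie_hom])

lemma Del_lie_module: "n \<le> Suc k \<Longrightarrow> lie_module g br T (Del n)"
  by (rule lie_module_of_lie_hom[OF T.TT_module Del_lie_hom])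

lemma uea_act_casimir_\<Gamma>:
  assumes r: "C.lie_hom r"
  shows "uea_act T r \<kappa> = C.\<Gamma> r r"
proof -
  have c: "r x \<in> carrier E" if "x \<in> carrier g" for x
    using r C.linD(1) that unfolding C.lie_hom_def by blast
  show ?thesis
    unfolding uea_act_casimir[OF lie_module_of_lie_hom[OF T.TT_module r]] C.\<Gamma>_def
    using c C.A.m_closed
    by (intro C.A.finsum_cong' refl) (auto simp: rep_eq[OF lie_module_of_lie_hom[OF T.TT_module r]])
qed

lemma gam_diag: "p \<le> k \<Longrightarrow> gam p p = uea_act T (\<rho> p) \<kappa>"
  unfolding gam_def by (rule uea_act_casimir_\<Gamma>[OF \<rho>_lie_hom, symmetric])

lemma cc_eq: "i \<le> k \<Longrightarrow> cc i = uea_act T (Del (Suc i)) \<kappa>"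
  unfolding cc_def by (rule uea_act_casimir_\<Gamma>[OF Del_lie_hom, symmetric]) simp

lemma uea_act_\<rho>_0:
  assumes u: "u \<in> carrier Ug" and m: "m \<in> carrier M" and vs: "vs \<in> tuples V k"
  shows "uea_act T (\<rho> 0) u (pure m vs) = pure (uea_act M actM u m) vs"
  by (rule uea_act_intertwine[OF M.lie_module_axioms \<rho>_lie_module T.pure_linear_left[OF vs] _ u m,
        symmetric])
    (simp_all add: \<rho>_0_pure vs)

lemma uea_act_\<rho>_Suc:
  assumes u: "u \<in> carrier Ug" and m: "m \<in> carrier M" and vs: "vs \<in> tuples V k" and j: "j < k"
  shows "uea_act T (\<rho> (Suc j)) u (pure m vs) = pure m (vs[j := uea_act V actV u (vs ! j)])"
proof -
  have "pure m (vs[j := uea_act V actV u (vs ! j)]) = uea_act T (\<rho> (Suc j)) u (pure m (vs[j := vs ! j]))"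
    by (rule uea_act_intertwine[OF V.lie_module_axioms \<rho>_lie_module T.pure_linear_right[OF m vs j] _ u])
      (use j vs m tuples_length[OF vs] in \<open>simp_all add: \<rho>_Suc_pure\<close>)
  then show ?thesis by simp
qed

lemma Del_Suc_pure:
  assumes x: "x \<in> carrier g" and m: "m \<in> carrier M" and vs: "vs \<in> tuples V k"
  shows "n \<le> k \<Longrightarrow> Del (Suc n) x (pure m vs) = pure (actM x m) vs \<oplus>\<^bsub>T\<^esub>
    (\<Oplus>\<^bsub>T\<^esub>j\<in>{..<n}. pure m (vs[j := actV x (vs ! j)]))"
proof (induction n)
  case 0
  have "Del (Suc 0) x = \<rho> 0 x" using x \<rho>_closed[of 0 x] by (simp add: Del_Suc Del_0)
  then show ?case using x m vs M.act_closed by (simp add: \<rho>_0_pure)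
next
  case (Suc n)
  have c: "pure m (vs[j := actV x (vs ! j)]) \<in> carrier T" if "j < k" for j
    using that x m vs V.act_closed by auto
  have s: "(\<Oplus>\<^bsub>T\<^esub>j\<in>{..<n}. pure m (vs[j := actV x (vs ! j)])) \<in> carrier T"
    using c Suc.prems by (intro T.TT.finsum_closed) auto
  have a: "pure (actM x m) vs \<in> carrier T" using x m vs M.act_closed by simp
  have "Del (Suc (Suc n)) x (pure m vs) = Del (Suc n) x (pure m vs) \<oplus>\<^bsub>T\<^esub> \<rho> (Suc n) x (pure m vs)"
    using Suc.prems by (simp only: Del_Suc[OF Suc.prems x] End_add_pure[OF m vs])
  also have "\<rho> (Suc n) x (pure m vs) = pure m (vs[n := actV x (vs ! n)])"
    using Suc.prems by (intro \<rho>_Suc_pure x m vs) simp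
  also have "(\<Oplus>\<^bsub>T\<^esub>j\<in>{..<Suc n}. pure m (vs[j := actV x (vs ! j)])) =
      pure m (vs[n := actV x (vs ! n)]) \<oplus>\<^bsub>T\<^esub> (\<Oplus>\<^bsub>T\<^esub>j\<in>{..<n}. pure m (vs[j := actV x (vs ! j)]))"
    unfolding lessThan_Suc using c Suc.prems by (intro T.TT.finsum_insert) auto
  ultimately show ?case using Suc a s c[of n] by (simp add: T.TT.a_ac)
qed

text \<open>
  The formula that defines the action on the tensor space is multilinear because it agrees with the
  operator \<open>Del (Suc k) x\<close> on pure tensors; so the linear extension in the definition makes sense and is
  that operator.
\<close>

lemma tensor_act_eq: "x \<in> carrier g \<Longrightarrow> \<Delta> x = Del (Suc k) x"
proof -
  assume x: "x \<in> carrier g"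
  have D: "Del (Suc k) x \<in> carrier E" by (rule Del_closed[OF le_refl x])
  then have "Del (Suc k) x \<in> mod_hom CC T T" by (simp add: End_ring_simps)
  then have "multilinear M V k T (\<lambda>m vs. Del (Suc k) x (pure m vs))"
    by (rule T.multilinear_comp_pure)
  then have ml: "multilinear M V k T (\<lambda>m vs. pure (actM x m) vs \<oplus>\<^bsub>T\<^esub>
      (\<Oplus>\<^bsub>T\<^esub>j\<in>{..<k}. pure m (vs[j := actV x (vs ! j)])))"
    by (rule T.multilinear_cong) (rule Del_Suc_pure[OF x _ _ le_refl])
  show "\<Delta> x = Del (Suc k) x"
    unfolding tensor_act_def
    by (rule T.End_eqI[OF T.lift_End[OF ml] D])
      (simp only: T.tensor_lift_pure[OF T.TT_module ml] Del_Suc_pure[OF x _ _ le_refl])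
qed

lemma tensor_lie_module: "lie_module g br T \<Delta>"
  by (rule lie_module_cong[OF Del_lie_module[OF le_refl] tensor_act_eq])

lemma commute_uea_act:
  assumes a: "a \<in> carrier E" and u: "u \<in> carrier Ug"
    and com: "\<And>x. x \<in> carrier g \<Longrightarrow> a \<otimes>\<^bsub>E\<^esub> Del (Suc k) x = Del (Suc k) x \<otimes>\<^bsub>E\<^esub> a"
  shows "a \<otimes>\<^bsub>E\<^esub> uea_act T \<Delta> u = uea_act T \<Delta> u \<otimes>\<^bsub>E\<^esub> a"
proof (rule lie_module.uea_act_commute[OF tensor_lie_module a u])
  fix x assume x: "x \<in> carrier g"
  have "\<Delta> x \<in> carrier E" using tensor_act_eq[OF x] Del_closed[OF le_refl x] by simp
  then show "a \<otimes>\<^bsub>E\<^esub> lie_module.rep T \<Delta> x = lie_module.rep T \<Delta> x \<otimes>\<^bsub>E\<^esub> a"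
    using com[OF x] by (simp add: rep_eq[OF tensor_lie_module] tensor_act_eq[OF x])
qed

text \<open>
  The action of the center on the factor \<open>M\<close>. Taken through \<open>\<rho>\<^sub>0\<close>, it is visibly a ring homomorphism.
\<close>

definition central_act :: "('g list \<Rightarrow> complex) set \<Rightarrow> ('m \<times> 'v list \<Rightarrow> complex) set \<Rightarrow> ('m \<times> 'v list \<Rightarrow> complex) set"
  where "central_act z = uea_act T (\<rho> 0) z"

lemma uea_act_\<rho>_0_hom: "uea_act T (\<rho> 0) \<in> ring_hom Ug E"
  by (rule lie_module.uea_act_hom[OF \<rho>_lie_module]) simp

lemma central_act_hom: "central_act \<in> ring_hom Z E"
  using ring.center_ring_hom[OF uea_is_ring uea_act_\<rho>_0_hom]
  unfolding central_act_def[abs_def] .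

lemma Z_carrier: "z \<in> carrier Z \<Longrightarrow> z \<in> carrier Ug"
  unfolding center_ring_def by simp

lemma central_act_closed: "z \<in> carrier Z \<Longrightarrow> central_act z \<in> carrier E"
  by (rule ring_hom_closed[OF central_act_hom])

lemma commute_central_act:
  assumes "a \<in> carrier E" "z \<in> carrier Z"
    and com: "\<And>x. x \<in> carrier g \<Longrightarrow> a \<otimes>\<^bsub>E\<^esub> \<rho> 0 x = \<rho> 0 x \<otimes>\<^bsub>E\<^esub> a"
  shows "a \<otimes>\<^bsub>E\<^esub> central_act z = central_act z \<otimes>\<^bsub>E\<^esub> a"
  unfolding central_act_def
proof (rule lie_module.uea_act_commute[OF \<rho>_lie_module[OF le0] assms(1) Z_carrier[OF assms(2)]])
  fix x assume x: "x \<in> carrier g"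
  show "a \<otimes>\<^bsub>E\<^esub> lie_module.rep T (\<rho> 0) x = lie_module.rep T (\<rho> 0) x \<otimes>\<^bsub>E\<^esub> a"
    using com[OF x] by (simp add: rep_eq[OF \<rho>_lie_module[OF le0]] \<rho>_closed[OF le0 x])
qed

text \<open>
  For \<open>p = 0\<close> this holds because \<open>z\<close> is central in the enveloping algebra, for \<open>p > 0\<close> because the two
  sides act on different factors.
\<close>

lemma central_act_\<rho>:
  assumes z: "z \<in> carrier Z" and p: "p \<le> k" and x: "x \<in> carrier g"
  shows "central_act z \<otimes>\<^bsub>E\<^esub> \<rho> p x = \<rho> p x \<otimes>\<^bsub>E\<^esub> central_act z"
proof (cases "p = 0")
  case True
  have i: "uea_act T (\<rho> 0) (uea_incl g br x) = \<rho> 0 x"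
    using lie_module.uea_act_incl[OF \<rho>_lie_module[OF le0] x] rep_eq[OF \<rho>_lie_module[OF le0] \<rho>_closed[OF le0 x]]
    by simp
  have "z \<otimes>\<^bsub>Ug\<^esub> uea_incl g br x = uea_incl g br x \<otimes>\<^bsub>Ug\<^esub> z"
    using z x unfolding center_ring_def by simp
  then have "uea_act T (\<rho> 0) (z \<otimes>\<^bsub>Ug\<^esub> uea_incl g br x) = uea_act T (\<rho> 0) (uea_incl g br x \<otimes>\<^bsub>Ug\<^esub> z)"
    by simp
  then show ?thesis unfolding True central_act_def
    using ring_hom_mult[OF uea_act_\<rho>_0_hom] Z_carrier[OF z] uea_incl_closed[OF x] i by simp
next
  case False
  then show ?thesis
    using p x z by (intro commute_central_act[symmetric] \<rho>_commute \<rho>_closed) auto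
qed

lemma Z_cring: "cring Z"
  by (rule ring.center_ring_cring[OF uea_is_ring])

lemmas \<tau>_mult = t_mult

definition braid_image :: "braid_gen \<Rightarrow> ('m \<times> 'v list \<Rightarrow> complex) set \<Rightarrow> ('m \<times> 'v list \<Rightarrow> complex) set"
  where "braid_image h = (case h of Tgen u \<Rightarrow> \<tau> u | Kgen i \<Rightarrow> gam i i | Ggen i j \<Rightarrow> gam i j)"

definition ybraid_image :: "ybraid_gen \<Rightarrow> ('m \<times> 'v list \<Rightarrow> complex) set \<Rightarrow> ('m \<times> 'v list \<Rightarrow> complex) set"
  where "ybraid_image h = (case h of YTgen u \<Rightarrow> \<tau> u | YK0gen \<Rightarrow> gam 0 0 | YK1gen \<Rightarrow> gam 1 1 | Ygen j \<Rightarrow> yy j)"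

lemma central_\<tau>:
  assumes "z \<in> carrier Z" "w permutes {1..k}"
  shows "central_act z \<otimes>\<^bsub>E\<^esub> \<tau> w = \<tau> w \<otimes>\<^bsub>E\<^esub> central_act z"
proof -
  have "w 0 = 0" using permutes_not_in[OF assms(2), of 0] by simp
  then show ?thesis using assms t_\<rho>[OF assms(2), of 0]
    by (intro commute_central_act[symmetric]) auto
qed

lemma central_gam: "\<lbrakk>z \<in> carrier Z; p \<le> k; q \<le> k\<rbrakk>
    \<Longrightarrow> central_act z \<otimes>\<^bsub>E\<^esub> gam p q = gam p q \<otimes>\<^bsub>E\<^esub> central_act z"
  by (intro commute_gam central_act_\<rho> central_act_closed)

lemma central_yy: "\<lbrakk>z \<in> carrier Z; j \<le> k\<rbrakk>
    \<Longrightarrow> central_act z \<otimes>\<^bsub>E\<^esub> yy j = yy j \<otimes>\<^bsub>E\<^esub> central_act z"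
  by (intro commute_yy commute_\<Gamma>_Del_\<rho> central_gam central_act_\<rho> central_act_closed) auto

lemma central_Del: "\<lbrakk>z \<in> carrier Z; x \<in> carrier g\<rbrakk>
    \<Longrightarrow> central_act z \<otimes>\<^bsub>E\<^esub> Del (Suc k) x = Del (Suc k) x \<otimes>\<^bsub>E\<^esub> central_act z"
  by (intro commute_Del central_act_\<rho> central_act_closed) auto

lemma \<tau>_Del:
  assumes w: "w permutes {1..k}" and x: "x \<in> carrier g"
  shows "\<tau> w \<otimes>\<^bsub>E\<^esub> Del (Suc k) x = Del (Suc k) x \<otimes>\<^bsub>E\<^esub> \<tau> w"
proof (rule t_Del[OF w le_refl _ x])
  have "w permutes {..<Suc k}" by (rule permutes_subset[OF w]) auto
  then show "w ` {..<Suc k} = {..<Suc k}" by (rule permutes_image)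
qed

lemma gam_Del: "\<lbrakk>p \<le> k; q \<le> k; x \<in> carrier g\<rbrakk>
    \<Longrightarrow> gam p q \<otimes>\<^bsub>E\<^esub> Del (Suc k) x = Del (Suc k) x \<otimes>\<^bsub>E\<^esub> gam p q"
  by (rule Del_gam[symmetric]) auto

lemma yy_Del:
  assumes j: "j \<le> k" and x: "x \<in> carrier g"
  shows "yy j \<otimes>\<^bsub>E\<^esub> Del (Suc k) x = Del (Suc k) x \<otimes>\<^bsub>E\<^esub> yy j"
proof (rule commute_yy[symmetric, OF Del_closed[OF le_refl x] j])
  show "Del (Suc k) x \<otimes>\<^bsub>E\<^esub> gam j j = gam j j \<otimes>\<^bsub>E\<^esub> Del (Suc k) x"
    using j x by (intro Del_gam) auto
  show "Del (Suc k) x \<otimes>\<^bsub>E\<^esub> C.\<Gamma> (Del j) (\<rho> j) = C.\<Gamma> (Del j) (\<rho> j) \<otimes>\<^bsub>E\<^esub> Del (Suc k) x"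
    using j x by (intro C.\<Gamma>_invariant[of _ _ _ x] Del_Del Del_\<rho>) auto
qed

lemma braid_evaluation: "evaluation Z E central_act (braid_gens k) braid_image"
proof (intro evaluation.intro evaluation_axioms.intro Z_cring C.A.ring_axioms central_act_hom)
  fix h assume "h \<in> braid_gens k"
  then show "braid_image h \<in> carrier E"
    unfolding braid_gens_def braid_image_def by auto
next
  fix z h assume "z \<in> carrier Z" "h \<in> braid_gens k"
  then show "central_act z \<otimes>\<^bsub>E\<^esub> braid_image h = braid_image h \<otimes>\<^bsub>E\<^esub> central_act z"
    unfolding braid_gens_def braid_image_def by (auto simp: central_\<tau> central_gam)
qed

lemma braid_presented_evaluation:
  "presented_evaluation Z E central_act (braid_gens k) braid_image (braid_rels Z k)"
proof -
  interpret ev: evaluation Z E central_act "braid_gens k" braid_image by (rule braid_evaluation)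
  let ?F = "braid_free Z k"
  have gen: "h \<in> braid_gens k \<Longrightarrow> free_gen Z h \<in> carrier ?F" for h
    using ev.R.unit_vec_closed[of "[h]" "lists (braid_gens k)"] by (simp add: free_algebra_simps)
  have T: "Tf Z u \<in> carrier ?F" "ev.ev (Tf Z u) = \<tau> u" if "u permutes {1..k}" for u
    using that gen ev.ev_gen by (auto simp: braid_gens_def braid_image_def)
  have K: "Kf Z i \<in> carrier ?F" "ev.ev (Kf Z i) = gam i i" if "i \<le> k" for i
    using that gen ev.ev_gen by (auto simp: braid_gens_def braid_image_def)
  have G: "Gf Z i j \<in> carrier ?F" "ev.ev (Gf Z i j) = gam i j" if "i \<le> k" "j \<le> k" "i \<noteq> j" for i j
    using that gen ev.ev_gen by (auto simp: braid_gens_def braid_image_def)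
  have rel: "a \<in> carrier ?F \<and> b \<in> carrier ?F \<and> ev.ev a = ev.ev b" if "(a, b) \<in> braid_rels Z k" for a b
    using that
  proof cases
    case t_one
    then show ?thesis using T[OF permutes_id] t_id ring_hom_one[OF ev.ev_hom] by simp
  next
    case (t_mult u v)
    then show ?thesis by (simp add: T ev.ev_mult permutes_compose \<tau>_mult)
  next
    case (t_kappa w i)
    then show ?thesis
      by (simp add: T K ev.ev_mult permutes_inv permutes_atMost t_gam_conj)
  next
    case (t_gamma w i j)
    have "w i \<noteq> w j" using t_gamma permutes_inj[OF t_gamma(3)] by (auto dest: injD)
    then show ?thesis using t_gamma
      by (simp add: T G ev.ev_mult permutes_inv permutes_atMost t_gam_conj)
  next
    case (kappa_kappa i j)
    then show ?thesis using kappa_gam[of i j j] by (simp add: K ev.ev_mult)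
  next
    case (kappa_gamma i l m)
    then show ?thesis using kappa_gam[of i l m] by (simp add: K G ev.ev_mult)
  next
    case (gamma_sym i j)
    then show ?thesis using gam_sym[of i j] by (simp add: G)
  next
    case (gamma_gamma p r l m)
    then show ?thesis using gam_gam[of p r l m] by (simp add: G ev.ev_mult)
  next
    case (gamma_four_term i j r)
    then show ?thesis using gam_four_term[of i j r] by (simp add: G ev.ev_mult ev.ev_add)
  qed
  show ?thesis
    using rel by (intro presented_evaluation.intro presented_evaluation_axioms.intro braid_evaluation
        presentation.intro presentation_axioms.intro Z_cring) blast+
qed

lemma ybraid_evaluation: "1 \<le> k \<Longrightarrow> evaluation Z E central_act (ybraid_gens k) ybraid_image"
proof (intro evaluation.intro evaluation_axioms.intro Z_cring C.A.ring_axioms central_act_hom)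
  fix h assume "1 \<le> k" "h \<in> ybraid_gens k"
  then show "ybraid_image h \<in> carrier E"
    unfolding ybraid_gens_def ybraid_image_def by auto
next
  fix z h assume "1 \<le> k" "z \<in> carrier Z" "h \<in> ybraid_gens k"
  then show "central_act z \<otimes>\<^bsub>E\<^esub> ybraid_image h = ybraid_image h \<otimes>\<^bsub>E\<^esub> central_act z"
    unfolding ybraid_gens_def ybraid_image_def by (auto simp: central_\<tau> central_gam central_yy)
qed

lemma transp_kappa0:
  assumes i: "1 \<le> i" "i < k"
  shows "\<tau> (adj_transp i) \<otimes>\<^bsub>E\<^esub> gam 0 0 = gam 0 0 \<otimes>\<^bsub>E\<^esub> \<tau> (adj_transp i)"
proof -
  have "adj_transp i 0 = 0" by (rule transpose_apply_other) (use i in auto)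
  then show ?thesis using t_gam[OF adj_transp_permutes[OF i] le0 le0] by simp
qed

lemma transp_kappa1:
  assumes j: "1 \<le> j" "j < k" "j \<noteq> 1"
  shows "\<tau> (adj_transp j) \<otimes>\<^bsub>E\<^esub> gam 1 1 = gam 1 1 \<otimes>\<^bsub>E\<^esub> \<tau> (adj_transp j)"
proof -
  have "adj_transp j 1 = 1" by (rule transpose_apply_other) (use j in auto)
  moreover have "1 \<le> k" using j by simp
  ultimately show ?thesis using t_gam[OF adj_transp_permutes[OF j(1,2)], of 1 1] by simp
qed

lemma ybraid_presented_evaluation:
  assumes k: "1 \<le> k"
  shows "presented_evaluation Z E central_act (ybraid_gens k) ybraid_image (ybraid_rels Z k)"
proof -
  interpret ev: evaluation Z E central_act "ybraid_gens k" ybraid_image by (rule ybraid_evaluation[OF k])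
  let ?F = "ybraid_free Z k"
  have gen: "h \<in> ybraid_gens k \<Longrightarrow> free_gen Z h \<in> carrier ?F" for h
    using ev.R.unit_vec_closed[of "[h]" "lists (ybraid_gens k)"] by (simp add: free_algebra_simps)
  have T: "YTf Z u \<in> carrier ?F" "ev.ev (YTf Z u) = \<tau> u" if "u permutes {1..k}" for u
    using that gen ev.ev_gen by (auto simp: ybraid_gens_def ybraid_image_def)
  have S: "Sf Z i \<in> carrier ?F" "ev.ev (Sf Z i) = \<tau> (adj_transp i)" if "1 \<le> i" "i < k" for i
    using T[OF adj_transp_permutes[OF that]] by auto
  have K0: "K0f Z \<in> carrier ?F" "ev.ev (K0f Z) = gam 0 0"
    using gen ev.ev_gen by (auto simp: ybraid_gens_def ybraid_image_def)
  have K1: "K1f Z \<in> carrier ?F" "ev.ev (K1f Z) = gam 1 1"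
    using gen ev.ev_gen by (auto simp: ybraid_gens_def ybraid_image_def)
  have Y: "Yf Z j \<in> carrier ?F" "ev.ev (Yf Z j) = yy j" if "1 \<le> j" "j \<le> k" for j
    using that gen ev.ev_gen by (auto simp: ybraid_gens_def ybraid_image_def)
  have yg: "ygamma Z k i \<in> carrier ?F" "ev.ev (ygamma Z k i) = gam i (Suc i)" if "1 \<le> i" "i < k" for i
  proof -
    have c: "Yf Z (Suc i) \<in> carrier ?F" "Yf Z i \<in> carrier ?F" using Y that by auto
    have "ev.ev (ygamma Z k i) = yy (Suc i) \<ominus>\<^bsub>E\<^esub> (\<tau> (adj_transp i) \<otimes>\<^bsub>E\<^esub> yy i \<otimes>\<^bsub>E\<^esub> \<tau> (adj_transp i))"
      unfolding ygamma_def using that c S Y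
      by (simp add: ev.ev_minus ev.ev_mult)
    then show "ev.ev (ygamma Z k i) = gam i (Suc i)" using transp_yy_conj[OF that] by simp
    show "ygamma Z k i \<in> carrier ?F" unfolding ygamma_def using that c S by simp
  qed
  have rel: "a \<in> carrier ?F \<and> b \<in> carrier ?F \<and> ev.ev a = ev.ev b" if "(a, b) \<in> ybraid_rels Z k" for a b
    using that
  proof cases
    case y_t_one
    then show ?thesis using T[OF permutes_id] t_id ring_hom_one[OF ev.ev_hom] by simp
  next
    case (y_t_mult u v)
    then show ?thesis by (simp add: T ev.ev_mult permutes_compose \<tau>_mult)
  next
    case (y_y i j)
    have "yy i \<otimes>\<^bsub>E\<^esub> yy j = yy j \<otimes>\<^bsub>E\<^esub> yy i"
    proof (cases i j rule: linorder_cases)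
      case less
      then show ?thesis by (rule yy_commute[OF _ y_y(6)])
    next
      case equal
      then show ?thesis by simp
    next
      case greater
      then show ?thesis by (rule yy_commute[OF _ y_y(4), symmetric])
    qed
    then show ?thesis unfolding y_y(1,2)
      by (simp only: ev.ev_mult ev.F.m_closed Y y_y(3-6) simp_thms)
  next
    case kappa0_kappa1
    then show ?thesis using kappa_gam[of 0 1 1] k by (simp add: K0 K1 ev.ev_mult)
  next
    case (kappa0_y i)
    then show ?thesis using kappa_yy[of 0 i] by (simp add: K0 Y ev.ev_mult)
  next
    case (kappa1_y i)
    then show ?thesis using kappa_yy[of 1 i] k by (simp add: K1 Y ev.ev_mult)
  next
    case (kappa0_s i)
    show ?thesis unfolding kappa0_s(1,2)
      by (simp only: ev.ev_mult ev.F.m_closed K0 S[OF kappa0_s(3,4)] transp_kappa0[OF kappa0_s(3,4)]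
          simp_thms)
  next
    case kappa1_s1
    show ?thesis unfolding kappa1_s1(1,2)
      by (simp only: ev.ev_mult ev.F.m_closed K1 S[OF le_refl kappa1_s1(3)]
          kappa1_transp_braid[OF kappa1_s1(3)] simp_thms)
  next
    case (kappa1_s j)
    show ?thesis unfolding kappa1_s(1,2)
      by (simp only: ev.ev_mult ev.F.m_closed K1 S[OF kappa1_s(3,4)] transp_kappa1[OF kappa1_s(3,4,5)]
          simp_thms)
  next
    case (s_y_sum i)
    then show ?thesis using transp_yy_sum[OF s_y_sum(3,4)] by (simp add: S Y ev.ev_mult ev.ev_add)
  next
    case (y_s i j)
    then show ?thesis using transp_yy[of i j] by (simp add: S Y ev.ev_mult)
  next
    case (s_s_gamma i)
    then show ?thesis using transp_transp_gam[of i] by (simp add: S yg ev.ev_mult)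
  qed
  show ?thesis
    using rel by (intro presented_evaluation.intro presented_evaluation_axioms.intro ybraid_evaluation[OF k]
        presentation.intro presentation_axioms.intro Z_cring) blast+
qed

end

context tensor_action
begin

text \<open>
  Appending the last \<open>k - i\<close> vectors is a linear map \<open>h\<close> from \<open>M \<otimes> V\<^sup>i\<close> to \<open>M \<otimes> V\<^sup>k\<close> that intertwines the
  action on \<open>M \<otimes> V\<^sup>i\<close> with the action on the factors \<open>0, \<dots>, i\<close>. Hence it intertwines the actions of the
  Casimir element, and the one on the right is \<open>c\<^sub>i\<close>.
\<close>

lemma tensor_append_pure:
  assumes i: "i \<le> k" and vs: "vs \<in> tuples V k" and m: "m \<in> carrier M"
  shows "tensor_append M V i (drop i vs)
      (uea_act (tensor_space M V i) (tensor_act M actM V actV i) \<kappa> (pure_tensor M V i m (take i vs))) =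
    cc i (pure m vs)"
proof -
  interpret Ti: tensor_action g br form B dual M actM V actV i
    by (intro tensor_action.intro quadratic_lie_algebra_axioms M.lie_module_axioms V.lie_module_axioms)
  define ws where "ws = drop i vs"
  have len: "length vs = k" by (rule tuples_length[OF vs])
  have ws: "length ws = k - i" "set ws \<subseteq> carrier V"
    using len vs unfolding ws_def tuples_def by (auto dest: in_set_dropD)
  have iws: "i + length ws = k" using i ws(1) by simp
  have app: "us @ ws \<in> tuples V k" if "us \<in> tuples V i" for us
    using that ws i unfolding tuples_def by auto
  have upd: "us[j := v] @ ws = (us @ ws)[j := v]" if "us \<in> tuples V i" "j < i" for us j v
    using that tuples_length[OF that(1)] by (simp add: list_update_append1)
  have ml: "multilinear M V i T (\<lambda>m us. pure m (us @ ws))"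
    unfolding multilinear_def
  proof (intro conjI ballI allI impI)
    fix us assume us: "us \<in> tuples V i"
    show "(\<lambda>m. pure m (us @ ws)) \<in> mod_hom CC M T" by (rule T.pure_linear_left[OF app[OF us]])
  next
    fix m us j assume m: "m \<in> carrier M" and us: "us \<in> tuples V i" and j: "j < i"
    show "(\<lambda>v. pure m (us[j := v] @ ws)) \<in> mod_hom CC V T"
      unfolding upd[OF us j] by (rule T.pure_linear_right[OF m app[OF us]]) (use i j in simp)
  qed
  define h where "h = tensor_lift M V i T (\<lambda>m us. pure m (us @ ws))"
  have h: "h \<in> mod_hom CC Ti.T T" unfolding h_def by (rule Ti.T.tensor_lift_mod_hom[OF T.TT_module ml])
  have h_pure: "h (Ti.pure m us) = pure m (us @ ws)" if "m \<in> carrier M" "us \<in> tuples V i" for m us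
    unfolding h_def by (rule Ti.T.tensor_lift_pure[OF T.TT_module ml that])
  have inter: "h (Ti.\<Delta> x t) = Del (Suc i) x (h t)" if x: "x \<in> carrier g" and t: "t \<in> carrier Ti.T" for x t
  proof (rule Ti.T.mod_hom_tensor_eqI[OF T.TT_module _ _ _ t])
    have D: "Del (Suc i) x \<in> mod_hom CC T T"
      using Del_closed[of "Suc i" x] i x by (simp add: End_ring_simps)
    have Di: "Ti.\<Delta> x \<in> mod_hom CC Ti.T Ti.T"
      using Ti.Del_closed[OF le_refl x] Ti.tensor_act_eq[OF x] by (simp add: End_ring_simps)
    show "(\<lambda>t. h (Ti.\<Delta> x t)) \<in> mod_hom CC Ti.T T" by (rule mod_hom_comp[OF Di h])
    show "(\<lambda>t. Del (Suc i) x (h t)) \<in> mod_hom CC Ti.T T" by (rule mod_hom_comp[OF h D])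
    fix m us assume m: "m \<in> carrier M" and us: "us \<in> tuples V i"
    have xm: "actM x m \<in> carrier M" by (rule M.act_closed[OF x m])
    have uj: "us[j := actV x (us ! j)] \<in> tuples V i" if "j < i" for j
      using us x that V.act_closed by auto
    have c: "Ti.pure m (us[j := actV x (us ! j)]) \<in> carrier Ti.T" if "j < i" for j
      by (rule Ti.T.pure_closed[OF m uj[OF that]])
    have s: "(\<Oplus>\<^bsub>Ti.T\<^esub>j\<in>{..<i}. Ti.pure m (us[j := actV x (us ! j)])) \<in> carrier Ti.T"
      using c by (intro Ti.T.TT.finsum_closed) auto
    have "h (Ti.\<Delta> x (Ti.pure m us)) = h (Ti.pure (actM x m) us \<oplus>\<^bsub>Ti.T\<^esub>
        (\<Oplus>\<^bsub>Ti.T\<^esub>j\<in>{..<i}. Ti.pure m (us[j := actV x (us ! j)])))"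
      unfolding Ti.tensor_act_eq[OF x] Ti.Del_Suc_pure[OF x m us le_refl] ..
    also have "\<dots> = h (Ti.pure (actM x m) us) \<oplus>\<^bsub>T\<^esub>
        h (\<Oplus>\<^bsub>Ti.T\<^esub>j\<in>{..<i}. Ti.pure m (us[j := actV x (us ! j)]))"
      by (rule mod_homD(2)[OF h Ti.T.pure_closed[OF xm us] s])
    also have "h (\<Oplus>\<^bsub>Ti.T\<^esub>j\<in>{..<i}. Ti.pure m (us[j := actV x (us ! j)])) =
        (\<Oplus>\<^bsub>T\<^esub>j\<in>{..<i}. h (Ti.pure m (us[j := actV x (us ! j)])))"
      using c by (intro mod_hom_finsum[OF h Ti.T.TT_module T.TT_module]) auto
    also have "\<dots> = (\<Oplus>\<^bsub>T\<^esub>j\<in>{..<i}. pure m ((us @ ws)[j := actV x ((us @ ws) ! j)]))"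
    proof (rule T.TT.finsum_cong')
      show "(\<lambda>j. pure m ((us @ ws)[j := actV x ((us @ ws) ! j)])) \<in> {..<i} \<rightarrow> carrier T"
        using app[OF us] m x i V.act_closed by auto
      fix j assume "j \<in> {..<i}"
      then have j: "j < i" by simp
      have "(us @ ws) ! j = us ! j" using j tuples_length[OF us] by (simp add: nth_append)
      then show "h (Ti.pure m (us[j := actV x (us ! j)])) = pure m ((us @ ws)[j := actV x ((us @ ws) ! j)])"
        using h_pure[OF m uj[OF j]] upd[OF us j] by simp
    qed simp
    also have "h (Ti.pure (actM x m) us) = pure (actM x m) (us @ ws)" by (rule h_pure[OF xm us])
    finally show "h (Ti.\<Delta> x (Ti.pure m us)) = Del (Suc i) x (h (Ti.pure m us))"
      unfolding h_pure[OF m us] Del_Suc_pure[OF x m app[OF us] i] .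
  qed
  have us: "take i vs \<in> tuples V i"
    using vs i unfolding tuples_def by (auto dest: in_set_takeD)
  have Del_module: "lie_module g br T (Del (Suc i))" by (rule Del_lie_module) (use i in simp)
  have "tensor_append M V i (drop i vs) = h"
    unfolding tensor_append_def ws_def[symmetric] iws h_def ..
  moreover have "h (uea_act Ti.T Ti.\<Delta> \<kappa> (Ti.pure m (take i vs))) =
      uea_act T (Del (Suc i)) \<kappa> (h (Ti.pure m (take i vs)))"
    by (rule uea_act_intertwine[OF Ti.tensor_lie_module Del_module h _ casimir_closed
          Ti.T.pure_closed[OF m us]]) (rule inter)
  moreover have "h (Ti.pure m (take i vs)) = pure m vs"
    unfolding h_pure[OF m us] ws_def by simp
  ultimately show ?thesis unfolding cc_eq[OF i] by simp
qed

definition \<Phi> :: "(braid_gen list \<Rightarrow> ('g list \<Rightarrow> complex) set) set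
    \<Rightarrow> ('m \<times> 'v list \<Rightarrow> complex) set \<Rightarrow> ('m \<times> 'v list \<Rightarrow> complex) set"
  where "\<Phi> = presented_evaluation.lift Z E central_act braid_image"

definition \<Psi> :: "(ybraid_gen list \<Rightarrow> ('g list \<Rightarrow> complex) set) set
    \<Rightarrow> ('m \<times> 'v list \<Rightarrow> complex) set \<Rightarrow> ('m \<times> 'v list \<Rightarrow> complex) set"
  where "\<Psi> = presented_evaluation.lift Z E central_act ybraid_image"

lemma \<Phi>_hom: "\<Phi> \<in> ring_hom (braid_algebra Z k) E"
  unfolding \<Phi>_def braid_algebra_def
  by (rule presented_evaluation.lift_hom[OF braid_presented_evaluation])

lemma \<Phi>_gen:
  assumes "h \<in> braid_gens k"
  shows "\<Phi> (presented_class Z (braid_gens k) (braid_rels Z k) (free_gen Z h)) = braid_image h"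
  unfolding \<Phi>_def by (rule presented_evaluation.lift_gen[OF braid_presented_evaluation assms])

lemma \<Phi>_t: "u permutes {1..k} \<Longrightarrow> \<Phi> (braid_t Z k u) = \<tau> u"
  unfolding braid_t_def by (subst \<Phi>_gen) (auto simp: braid_gens_def braid_image_def)

lemma \<Phi>_kappa: "i \<le> k \<Longrightarrow> \<Phi> (braid_kappa Z k i) = gam i i"
  unfolding braid_kappa_def by (subst \<Phi>_gen) (auto simp: braid_gens_def braid_image_def)

lemma \<Phi>_gamma: "\<lbrakk>i \<le> k; j \<le> k; i \<noteq> j\<rbrakk> \<Longrightarrow> \<Phi> (braid_gamma Z k i j) = gam i j"
  unfolding braid_gamma_def by (subst \<Phi>_gen) (auto simp: braid_gens_def braid_image_def)

lemma \<Phi>_scalar: "z \<in> carrier Z \<Longrightarrow> \<Phi> (braid_scalar Z k z) = central_act z"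
  unfolding \<Phi>_def braid_scalar_def
  by (rule presented_evaluation.lift_scalar[OF braid_presented_evaluation])

lemma \<Phi>_c:
  assumes i: "i \<le> k"
  shows "\<Phi> (braid_c Z k i) = cc i"
proof -
  interpret P: presented_evaluation Z E central_act "braid_gens k" braid_image "braid_rels Z k"
    by (rule braid_presented_evaluation)
  have ring: "ring (braid_algebra Z k)" unfolding braid_algebra_def by (rule P.presented_algebra_is_ring)
  interpret BA: ring "braid_algebra Z k" by (rule ring)
  interpret h: ring_hom_ring "braid_algebra Z k" E \<Phi>
    by (rule ring_hom_ringI2[OF ring C.A.ring_axioms \<Phi>_hom])
  have gens: "h \<in> braid_gens k \<Longrightarrow>
      presented_class Z (braid_gens k) (braid_rels Z k) (free_gen Z h) \<in> carrier (braid_algebra Z k)" for h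
    unfolding braid_algebra_def by (rule P.presented_gen_closed)
  have K: "braid_kappa Z k j \<in> carrier (braid_algebra Z k)" if "j \<le> k" for j
    unfolding braid_kappa_def using that by (intro gens) (auto simp: braid_gens_def)
  have G: "braid_gamma Z k l j \<in> carrier (braid_algebra Z k)" if "l \<le> k" "j \<le> k" "l \<noteq> j" for l j
    unfolding braid_gamma_def using that by (intro gens) (auto simp: braid_gens_def)
  let ?P = "{(l, m). l < m \<and> m \<le> i}"
  let ?K = "\<Oplus>\<^bsub>braid_algebra Z k\<^esub>j\<in>{..i}. braid_kappa Z k j"
  let ?G = "\<Oplus>\<^bsub>braid_algebra Z k\<^esub>p\<in>?P. braid_gamma Z k (fst p) (snd p)"
  have Gp: "braid_gamma Z k (fst p) (snd p) \<in> carrier (braid_algebra Z k)" if "p \<in> ?P" for p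
    using that i by (intro G) auto
  have Kc: "?K \<in> carrier (braid_algebra Z k)" using K i by (intro BA.finsum_closed) auto
  have Gc: "?G \<in> carrier (braid_algebra Z k)" using Gp by (intro BA.finsum_closed) blast
  have "\<Phi> ?K = finsum E (\<Phi> \<circ> braid_kappa Z k) {..i}" using K i by (intro h.hom_finsum) auto
  also have "\<dots> = (\<Oplus>\<^bsub>E\<^esub>j\<in>{..i}. gam j j)"
    using i by (intro C.A.finsum_cong' refl) (auto simp: \<Phi>_kappa)
  finally have \<Phi>K: "\<Phi> ?K = (\<Oplus>\<^bsub>E\<^esub>j\<in>{..i}. gam j j)" .
  have "\<Phi> ?G = finsum E (\<Phi> \<circ> (\<lambda>p. braid_gamma Z k (fst p) (snd p))) ?P"
    using Gp by (intro h.hom_finsum) blast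
  also have "\<dots> = (\<Oplus>\<^bsub>E\<^esub>p\<in>?P. gam (fst p) (snd p))"
    using i by (intro C.A.finsum_cong' refl) (auto simp: \<Phi>_gamma)
  finally have \<Phi>G: "\<Phi> ?G = (\<Oplus>\<^bsub>E\<^esub>p\<in>?P. gam (fst p) (snd p))" .
  have Gc': "(\<Oplus>\<^bsub>E\<^esub>p\<in>?P. gam (fst p) (snd p)) \<in> carrier E"
    using h.hom_closed[OF Gc] unfolding \<Phi>G .
  have "\<Phi> (braid_c Z k i) = \<Phi> ?K \<oplus>\<^bsub>E\<^esub> (\<Phi> ?G \<oplus>\<^bsub>E\<^esub> \<Phi> ?G)"
    unfolding braid_c_def BA.add_pow_two[OF Gc] using Kc Gc by simp
  then show ?thesis unfolding cc_gam[OF i] C.A.add_pow_two[OF Gc'] \<Phi>K \<Phi>G .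
qed

text \<open>
  Generators of the braid algebra commute with generators of the enveloping algebra; both actions are
  extended by \<open>lift_commute\<close>.
\<close>

lemma \<Phi>_commutes:
  assumes a: "a \<in> carrier (braid_algebra Z k)" and u: "u \<in> carrier Ug"
  shows "\<Phi> a \<otimes>\<^bsub>E\<^esub> uea_act T \<Delta> u = uea_act T \<Delta> u \<otimes>\<^bsub>E\<^esub> \<Phi> a"
proof -
  interpret P: presented_evaluation Z E central_act "braid_gens k" braid_image "braid_rels Z k"
    by (rule braid_presented_evaluation)
  have c: "uea_act T \<Delta> u \<in> carrier E"
    using lie_module.uea_act_hom[OF tensor_lie_module] u by (rule ring_hom_closed)
  have "uea_act T \<Delta> u \<otimes>\<^bsub>E\<^esub> P.lift a = P.lift a \<otimes>\<^bsub>E\<^esub> uea_act T \<Delta> u"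
  proof (rule P.lift_commute[OF c])
    show "a \<in> carrier P.PA" using a unfolding braid_algebra_def .
    fix z assume "z \<in> carrier Z"
    then show "uea_act T \<Delta> u \<otimes>\<^bsub>E\<^esub> central_act z = central_act z \<otimes>\<^bsub>E\<^esub> uea_act T \<Delta> u"
      by (intro commute_uea_act[symmetric] u central_act_closed central_Del)
  next
    fix h assume h: "h \<in> braid_gens k"
    have "braid_image h \<otimes>\<^bsub>E\<^esub> Del (Suc k) x = Del (Suc k) x \<otimes>\<^bsub>E\<^esub> braid_image h"
      if "x \<in> carrier g" for x
      using h that unfolding braid_gens_def braid_image_def by (auto intro: \<tau>_Del[unfolded One_nat_def] gam_Del)
    then show "uea_act T \<Delta> u \<otimes>\<^bsub>E\<^esub> braid_image h = braid_image h \<otimes>\<^bsub>E\<^esub> uea_act T \<Delta> u"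
      by (intro commute_uea_act[symmetric] u P.f_closed[OF h])
  qed
  then show ?thesis unfolding \<Phi>_def by simp
qed

context
  assumes k: "1 \<le> k"
begin

lemma \<Psi>_hom: "\<Psi> \<in> ring_hom (ybraid_algebra Z k) E"
  unfolding \<Psi>_def ybraid_algebra_def
  by (rule presented_evaluation.lift_hom[OF ybraid_presented_evaluation[OF k]])

lemma \<Psi>_gen:
  assumes "h \<in> ybraid_gens k"
  shows "\<Psi> (ybraid_class Z k (free_gen Z h)) = ybraid_image h"
  unfolding \<Psi>_def ybraid_class_def
  by (rule presented_evaluation.lift_gen[OF ybraid_presented_evaluation[OF k] assms])

lemma \<Psi>_scalar: "z \<in> carrier Z \<Longrightarrow> \<Psi> (ybraid_scalar Z k z) = central_act z"
  unfolding \<Psi>_def ybraid_scalar_def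
  by (rule presented_evaluation.lift_scalar[OF ybraid_presented_evaluation[OF k]])

lemma \<Psi>_t: "u permutes {1..k} \<Longrightarrow> \<Psi> (ybraid_class Z k (YTf Z u)) = \<tau> u"
  by (subst \<Psi>_gen) (auto simp: ybraid_gens_def ybraid_image_def)

lemma \<Psi>_kappa: "\<Psi> (ybraid_class Z k (K0f Z)) = gam 0 0" "\<Psi> (ybraid_class Z k (K1f Z)) = gam 1 1"
  by (subst \<Psi>_gen, auto simp: ybraid_gens_def ybraid_image_def)+

lemma \<Psi>_y: "\<lbrakk>1 \<le> j; j \<le> k\<rbrakk> \<Longrightarrow> \<Psi> (ybraid_class Z k (Yf Z j)) = yy j"
  by (subst \<Psi>_gen) (auto simp: ybraid_gens_def ybraid_image_def)

lemma \<Psi>_c: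
  assumes i: "i \<le> k"
  shows "\<Psi> (ybraid_c Z k i) = cc i"
proof -
  interpret P: presented_evaluation Z E central_act "ybraid_gens k" ybraid_image "ybraid_rels Z k"
    by (rule ybraid_presented_evaluation[OF k])
  have ring: "ring (ybraid_algebra Z k)" unfolding ybraid_algebra_def by (rule P.presented_algebra_is_ring)
  interpret BA: ring "ybraid_algebra Z k" by (rule ring)
  interpret h: ring_hom_ring "ybraid_algebra Z k" E \<Psi>
    by (rule ring_hom_ringI2[OF ring C.A.ring_axioms \<Psi>_hom])
  have gens: "h \<in> ybraid_gens k \<Longrightarrow> ybraid_class Z k (free_gen Z h) \<in> carrier (ybraid_algebra Z k)" for h
    unfolding ybraid_algebra_def ybraid_class_def by (rule P.presented_gen_closed)
  have K: "ybraid_class Z k (K0f Z) \<in> carrier (ybraid_algebra Z k)"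
    by (rule gens) (simp add: ybraid_gens_def)
  have Y: "ybraid_class Z k (Yf Z j) \<in> carrier (ybraid_algebra Z k)" if "1 \<le> j" "j \<le> k" for j
    by (rule gens) (use that in \<open>simp add: ybraid_gens_def\<close>)
  let ?Y = "\<Oplus>\<^bsub>ybraid_algebra Z k\<^esub>j\<in>{1..i}. ybraid_class Z k (Yf Z j)"
  have Yc: "?Y \<in> carrier (ybraid_algebra Z k)" using Y i by (intro BA.finsum_closed) auto
  have "\<Psi> ?Y = finsum E (\<Psi> \<circ> (\<lambda>j. ybraid_class Z k (Yf Z j))) {1..i}"
    using Y i by (intro h.hom_finsum) auto
  also have "\<dots> = (\<Oplus>\<^bsub>E\<^esub>j\<in>{1..i}. yy j)"
    using i by (intro C.A.finsum_cong' refl) (auto simp: \<Psi>_y)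
  finally have \<Psi>Y: "\<Psi> ?Y = (\<Oplus>\<^bsub>E\<^esub>j\<in>{1..i}. yy j)" .
  have Yc': "(\<Oplus>\<^bsub>E\<^esub>j\<in>{1..i}. yy j) \<in> carrier E"
    using h.hom_closed[OF Yc] unfolding \<Psi>Y .
  have "\<Psi> (ybraid_c Z k i) = gam 0 0 \<oplus>\<^bsub>E\<^esub> (\<Psi> ?Y \<oplus>\<^bsub>E\<^esub> \<Psi> ?Y)"
    unfolding ybraid_c_def BA.add_pow_two[OF Yc] using K Yc by (simp add: \<Psi>_kappa)
  then show ?thesis unfolding cc_yy[OF i] C.A.add_pow_two[OF Yc'] \<Psi>Y .
qed

lemma \<Psi>_commutes:
  assumes a: "a \<in> carrier (ybraid_algebra Z k)" and u: "u \<in> carrier Ug"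
  shows "\<Psi> a \<otimes>\<^bsub>E\<^esub> uea_act T \<Delta> u = uea_act T \<Delta> u \<otimes>\<^bsub>E\<^esub> \<Psi> a"
proof -
  interpret P: presented_evaluation Z E central_act "ybraid_gens k" ybraid_image "ybraid_rels Z k"
    by (rule ybraid_presented_evaluation[OF k])
  have c: "uea_act T \<Delta> u \<in> carrier E"
    using lie_module.uea_act_hom[OF tensor_lie_module] u by (rule ring_hom_closed)
  have "uea_act T \<Delta> u \<otimes>\<^bsub>E\<^esub> P.lift a = P.lift a \<otimes>\<^bsub>E\<^esub> uea_act T \<Delta> u"
  proof (rule P.lift_commute[OF c])
    show "a \<in> carrier P.PA" using a unfolding ybraid_algebra_def .
    fix z assume "z \<in> carrier Z"
    then show "uea_act T \<Delta> u \<otimes>\<^bsub>E\<^esub> central_act z = central_act z \<otimes>\<^bsub>E\<^esub> uea_act T \<Delta> u"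
      by (intro commute_uea_act[symmetric] u central_act_closed central_Del)
  next
    fix h assume h: "h \<in> ybraid_gens k"
    have "ybraid_image h \<otimes>\<^bsub>E\<^esub> Del (Suc k) x = Del (Suc k) x \<otimes>\<^bsub>E\<^esub> ybraid_image h"
      if "x \<in> carrier g" for x
      using h that k unfolding ybraid_gens_def ybraid_image_def by (auto intro: \<tau>_Del[unfolded One_nat_def] gam_Del yy_Del)
    then show "uea_act T \<Delta> u \<otimes>\<^bsub>E\<^esub> ybraid_image h = ybraid_image h \<otimes>\<^bsub>E\<^esub> uea_act T \<Delta> u"
      by (intro commute_uea_act[symmetric] u P.f_closed[OF h])
  qed
  then show ?thesis unfolding \<Psi>_def by simp
qed

end

lemma permute_transp:
  assumes i: "1 \<le> i" "i < k" and vs: "length vs = k"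
  shows "permute_tuple k (adj_transp i) vs = vs[i - 1 := vs ! i, i := vs ! (i - 1)]"
proof (rule nth_equalityI)
  fix j assume "j < length (permute_tuple k (adj_transp i) vs)"
  then have j: "j < k" by simp
  have "inv_into UNIV (adj_transp i) = adj_transp i" by (rule inv_transpose_eq)
  then show "permute_tuple k (adj_transp i) vs ! j = vs[i - 1 := vs ! i, i := vs ! (i - 1)] ! j"
    using i j vs by (auto simp: permute_tuple_nth nth_list_update transpose_def)
qed (simp add: vs)

end

theorem theorem1p2:
  fixes g :: "(complex, 'g) module" and br :: "'g \<Rightarrow> 'g \<Rightarrow> 'g"
    and form :: "'g \<Rightarrow> 'g \<Rightarrow> complex" and B :: "'g set" and dual :: "'g \<Rightarrow> 'g"
    and M :: "(complex, 'm) module" and actM :: "'g \<Rightarrow> 'm \<Rightarrow> 'm"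
    and V :: "(complex, 'v) module" and actV :: "'g \<Rightarrow> 'v \<Rightarrow> 'v"
    and k :: nat
  assumes lie: "lie_algebra g br"
    and basis: "finite_basis g B"
    and form: "bilinear_form g form" "symmetric_form g form" "nondegenerate_form g form"
      "ad_invariant_form g br form"
    and dual: "dual_basis g form B dual"
    and M: "lie_module g br M actM"
    and V: "lie_module g br V actV"
    and k: "1 \<le> k"
    and C: "C = center_ring (uea g br)"
    and \<kappa>: "\<kappa> = casimir g br B dual"
    and T: "T = tensor_space M V k"
    and pure: "pure = pure_tensor M V k"
  shows "\<kappa> \<in> carrier C \<and>
    (\<exists>\<Phi> \<in> ring_hom (braid_algebra C k) (End_ring T).
      (\<forall>m \<in> carrier M. \<forall>vs \<in> tuples V k.
        (\<forall>i. 1 \<le> i \<and> i < k \<longrightarrow>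
          \<Phi> (braid_t C k (adj_transp i)) (pure m vs) = pure m (vs[i - 1 := vs ! i, i := vs ! (i - 1)])) \<and>
        (\<forall>u. u permutes {1..k} \<longrightarrow>
          \<Phi> (braid_t C k u) (pure m vs) = pure m (map (\<lambda>j. vs ! (inv_into UNIV u j - 1)) [1..<Suc k])) \<and>
        (\<forall>i. 1 \<le> i \<and> i \<le> k \<longrightarrow>
          \<Phi> (braid_kappa C k i) (pure m vs) = pure m (vs[i - 1 := uea_act V actV \<kappa> (vs ! (i - 1))])) \<and>
        \<Phi> (braid_kappa C k 0) (pure m vs) = pure (uea_act M actM \<kappa> m) vs \<and>
        (\<forall>l n. 1 \<le> l \<and> l \<le> k \<and> 1 \<le> n \<and> n \<le> k \<and> l \<noteq> n \<longrightarrow>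
          \<Phi> (braid_gamma C k l n) (pure m vs) =
            (\<Oplus>\<^bsub>T\<^esub>b\<in>B. pure m (vs[l - 1 := actV b (vs ! (l - 1)), n - 1 := actV (dual b) (vs ! (n - 1))]))) \<and>
        (\<forall>l. 1 \<le> l \<and> l \<le> k \<longrightarrow>
          \<Phi> (braid_gamma C k 0 l) (pure m vs) =
            (\<Oplus>\<^bsub>T\<^esub>b\<in>B. pure (actM b m) (vs[l - 1 := actV (dual b) (vs ! (l - 1))]))) \<and>
        (\<forall>i. i \<le> k \<longrightarrow>
          \<Phi> (braid_c C k i) (pure m vs) =
            tensor_append M V i (drop i vs)
              (uea_act (tensor_space M V i) (tensor_act M actM V actV i) \<kappa>
                (pure_tensor M V i m (take i vs)))) \<and>
        (\<forall>z \<in> carrier C. \<Phi> (braid_scalar C k z) (pure m vs) = pure (uea_act M actM z m) vs)) \<and>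
      (\<forall>a \<in> carrier (braid_algebra C k). \<forall>u \<in> carrier (uea g br).
        \<Phi> a \<otimes>\<^bsub>End_ring T\<^esub> uea_act T (tensor_act M actM V actV k) u =
        uea_act T (tensor_act M actM V actV k) u \<otimes>\<^bsub>End_ring T\<^esub> \<Phi> a) \<and>
      (\<exists>\<Psi> \<in> ring_hom (ybraid_algebra C k) (End_ring T).
        (\<forall>u. u permutes {1..k} \<longrightarrow> \<Psi> (ybraid_class C k (YTf C u)) = \<Phi> (braid_t C k u)) \<and>
        \<Psi> (ybraid_class C k (K0f C)) = \<Phi> (braid_kappa C k 0) \<and>
        \<Psi> (ybraid_class C k (K1f C)) = \<Phi> (braid_kappa C k 1) \<and>
        (\<forall>i. i \<le> k \<longrightarrow> \<Psi> (ybraid_c C k i) = \<Phi> (braid_c C k i)) \<and>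
        (\<forall>z \<in> carrier C. \<Psi> (ybraid_scalar C k z) = \<Phi> (braid_scalar C k z)) \<and>
        (\<forall>a \<in> carrier (ybraid_algebra C k). \<forall>u \<in> carrier (uea g br).
          \<Psi> a \<otimes>\<^bsub>End_ring T\<^esub> uea_act T (tensor_act M actM V actV k) u =
          uea_act T (tensor_act M actM V actV k) u \<otimes>\<^bsub>End_ring T\<^esub> \<Psi> a)))"
proof -
  interpret lie_algebra g br by (rule lie)
  interpret Q: tensor_action g br form B dual M actM V actV k
    by (intro tensor_action.intro quadratic_lie_algebra.intro quadratic_lie_algebra_axioms.intro
        lie basis form dual M V)
  note defs = C \<kappa> T pure
  have casimir: "\<kappa> \<in> carrier C" unfolding defs by (rule Q.casimir_central)
  have hom: "Q.\<Phi> \<in> ring_hom (braid_algebra C k) (End_ring T)" unfolding defs by (rule Q.\<Phi>_hom)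
  have adjacent: "Q.\<Phi> (braid_t C k (adj_transp i)) (pure m vs) = pure m (vs[i - 1 := vs ! i, i := vs ! (i - 1)])"
    if "m \<in> carrier M" "vs \<in> tuples V k" "1 \<le> i" "i < k" for m vs i
    using that adj_transp_permutes[of i k] Q.permute_transp[of i vs] tuples_length[of vs V k]
    unfolding defs by (simp add: Q.\<Phi>_t Q.\<tau>_pure)
  have permutation: "Q.\<Phi> (braid_t C k u) (pure m vs) = pure m (map (\<lambda>j. vs ! (inv_into UNIV u j - 1)) [1..<Suc k])"
    if "m \<in> carrier M" "vs \<in> tuples V k" "u permutes {1..k}" for m vs u
    unfolding defs permute_tuple_def[symmetric] using that by (simp only: Q.\<Phi>_t Q.\<tau>_pure)
  have kappa_V: "Q.\<Phi> (braid_kappa C k i) (pure m vs) = pure m (vs[i - 1 := uea_act V actV \<kappa> (vs ! (i - 1))])"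
    if "m \<in> carrier M" "vs \<in> tuples V k" "1 \<le> i" "i \<le> k" for m vs i
    using that Q.uea_act_\<rho>_Suc[OF Q.casimir_closed that(1,2), of "i - 1"] unfolding defs
    by (simp add: Q.\<Phi>_kappa Q.gam_diag)
  have kappa_M: "Q.\<Phi> (braid_kappa C k 0) (pure m vs) = pure (uea_act M actM \<kappa> m) vs"
    if "m \<in> carrier M" "vs \<in> tuples V k" for m vs
    using Q.uea_act_\<rho>_0[OF Q.casimir_closed that] unfolding defs by (simp add: Q.\<Phi>_kappa Q.gam_diag)
  have gamma_V: "Q.\<Phi> (braid_gamma C k l n) (pure m vs) =
      (\<Oplus>\<^bsub>T\<^esub>b\<in>B. pure m (vs[l - 1 := actV b (vs ! (l - 1)), n - 1 := actV (dual b) (vs ! (n - 1))]))"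
    if "m \<in> carrier M" "vs \<in> tuples V k" "1 \<le> l" "l \<le> k" "1 \<le> n" "n \<le> k" "l \<noteq> n" for m vs l n
    using that Q.gam_Suc_Suc_pure[of "l - 1" "n - 1" m vs] unfolding defs by (simp add: Q.\<Phi>_gamma)
  have gamma_M: "Q.\<Phi> (braid_gamma C k 0 l) (pure m vs) =
      (\<Oplus>\<^bsub>T\<^esub>b\<in>B. pure (actM b m) (vs[l - 1 := actV (dual b) (vs ! (l - 1))]))"
    if "m \<in> carrier M" "vs \<in> tuples V k" "1 \<le> l" "l \<le> k" for m vs l
    using that Q.gam_0_Suc_pure[of "l - 1" m vs] unfolding defs by (simp add: Q.\<Phi>_gamma)
  have partial_casimir: "Q.\<Phi> (braid_c C k i) (pure m vs) = tensor_append M V i (drop i vs)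
      (uea_act (tensor_space M V i) (tensor_act M actM V actV i) \<kappa> (pure_tensor M V i m (take i vs)))"
    if "m \<in> carrier M" "vs \<in> tuples V k" "i \<le> k" for m vs i
    unfolding defs Q.\<Phi>_c[OF that(3)] by (rule Q.tensor_append_pure[OF that(3,2,1), symmetric])
  have scalars: "Q.\<Phi> (braid_scalar C k z) (pure m vs) = pure (uea_act M actM z m) vs"
    if "m \<in> carrier M" "vs \<in> tuples V k" "z \<in> carrier C" for m vs z
    using that(3) Q.uea_act_\<rho>_0[OF Q.Z_carrier that(1,2), of z] unfolding defs
    by (simp add: Q.\<Phi>_scalar Q.central_act_def)
  have commutes: "Q.\<Phi> a \<otimes>\<^bsub>End_ring T\<^esub> uea_act T (tensor_act M actM V actV k) u =
      uea_act T (tensor_act M actM V actV k) u \<otimes>\<^bsub>End_ring T\<^esub> Q.\<Phi> a"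
    if "a \<in> carrier (braid_algebra C k)" "u \<in> carrier (uea g br)" for a u
    using that unfolding defs by (rule Q.\<Phi>_commutes)
  have second_presentation: "\<exists>\<Psi> \<in> ring_hom (ybraid_algebra C k) (End_ring T).
        (\<forall>u. u permutes {1..k} \<longrightarrow> \<Psi> (ybraid_class C k (YTf C u)) = Q.\<Phi> (braid_t C k u)) \<and>
        \<Psi> (ybraid_class C k (K0f C)) = Q.\<Phi> (braid_kappa C k 0) \<and>
        \<Psi> (ybraid_class C k (K1f C)) = Q.\<Phi> (braid_kappa C k 1) \<and>
        (\<forall>i. i \<le> k \<longrightarrow> \<Psi> (ybraid_c C k i) = Q.\<Phi> (braid_c C k i)) \<and>
        (\<forall>z \<in> carrier C. \<Psi> (ybraid_scalar C k z) = Q.\<Phi> (braid_scalar C k z)) \<and>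
        (\<forall>a \<in> carrier (ybraid_algebra C k). \<forall>u \<in> carrier (uea g br).
          \<Psi> a \<otimes>\<^bsub>End_ring T\<^esub> uea_act T (tensor_act M actM V actV k) u =
          uea_act T (tensor_act M actM V actV k) u \<otimes>\<^bsub>End_ring T\<^esub> \<Psi> a)"
    unfolding defs
  proof (intro bexI[OF _ Q.\<Psi>_hom[OF k]] conjI allI impI ballI)
    show "Q.\<Psi> (ybraid_class Q.Z k (YTf Q.Z u)) = Q.\<Phi> (braid_t Q.Z k u)" if "u permutes {1..k}" for u
      unfolding Q.\<Psi>_t[OF k that] Q.\<Phi>_t[OF that] ..
    show "Q.\<Psi> (ybraid_class Q.Z k (K0f Q.Z)) = Q.\<Phi> (braid_kappa Q.Z k 0)"
      unfolding Q.\<Psi>_kappa(1)[OF k] Q.\<Phi>_kappa[OF le0] ..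
    show "Q.\<Psi> (ybraid_class Q.Z k (K1f Q.Z)) = Q.\<Phi> (braid_kappa Q.Z k 1)"
      unfolding Q.\<Psi>_kappa(2)[OF k] Q.\<Phi>_kappa[OF k] ..
    show "Q.\<Psi> (ybraid_c Q.Z k i) = Q.\<Phi> (braid_c Q.Z k i)" if "i \<le> k" for i
      unfolding Q.\<Psi>_c[OF k that] Q.\<Phi>_c[OF that] ..
    show "Q.\<Psi> (ybraid_scalar Q.Z k z) = Q.\<Phi> (braid_scalar Q.Z k z)" if "z \<in> carrier Q.Z" for z
      unfolding Q.\<Psi>_scalar[OF k that] Q.\<Phi>_scalar[OF that] ..
  qed (rule Q.\<Psi>_commutes[OF k])
  show ?thesis
  proof (rule conjI, rule casimir, rule bexI[OF _ hom], rule conjI, goal_cases)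
    case 1
    show ?case
    proof (intro ballI conjI allI impI, goal_cases)
      case (1 m vs i)
      then show ?case by (intro adjacent) auto
    next
      case (2 m vs u)
      then show ?case by (rule permutation)
    next
      case (3 m vs i)
      then show ?case by (intro kappa_V) auto
    next
      case (4 m vs)
      then show ?case by (rule kappa_M)
    next
      case (5 m vs l n)
      then show ?case by (intro gamma_V) auto
    next
      case (6 m vs l)
      then show ?case by (intro gamma_M) auto
    next
      case (7 m vs i)
      then show ?case by (rule partial_casimir)
    next
      case (8 m vs z)
      then show ?case by (rule scalars)
    qed
  next
    case 2
    show ?case
    proof (rule conjI)
      show "\<forall>a \<in> carrier (braid_algebra C k). \<forall>u \<in> carrier (uea g br).
        Q.\<Phi> a \<otimes>\<^bsub>End_ring T\<^esub> uea_act T (tensor_act M actM V actV k) u =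
        uea_act T (tensor_act M actM V actV k) u \<otimes>\<^bsub>End_ring T\<^esub> Q.\<Phi> a"
        by (rule ballI, rule ballI) (rule commutes)
    qed (rule second_presentation)
  qed
qed

end
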